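(* Let $m\ge0$ be an integer. For $j=0$ (upper signs) and $j=3$ (lower signs), as $u\to\infty$ ($u>0$), $$W_j\left(-\tfrac12u,\sqrt{2u}z\right)=\frac{e^{\mp i(\hat\chi_m(u)-\frac18\pi)}e^{\pi u/8}}{(2u)^{1/4}(1+z^2)^{1/4}}\exp\left\{\sum_{s=1}^m(-1)^s\frac{\bar{\mathrm E}_{2s}(\bar\beta)}{u^{2s}}\right\}\exp\left\{\pm iu\bar\xi\mp i\sum_{s=0}^m(-1)^s\frac{\bar{\mathrm E}_{2s+1}(\bar\beta)}{u^{2s+1}}\right\}\{1+\bar\eta_{2m+2,j}(u,z)\},$$ $$W_j'\left(-\tfrac12u,\sqrt{2u}z\right)=\tfrac12e^{\mp i(\tilde\chi_m(u)-\frac58\pi)}(2u)^{1/4}e^{\pi u/8}(1+z^2)^{1/4}\exp\left\{\sum_{s=1}^m(-1)^s\frac{\tilde{\mathrm E}_{2s}(\bar\beta)}{u^{2s}}\right\}\exp\left\{\pm iu\bar\xi\mp i\sum_{s=0}^m(-1)^s\frac{\tilde{\mathrm E}_{2s+1}(\bar\beta)}{u^{2s+1}}\right\}\{1+\tilde\eta_{2m+2,j}(u,z)\},$$ where $$\hat\chi_m(u)=\frac u4\ln\left(\frac{2e}u\right)-\sum_{s=0}^m(-1)^s\frac{\bar{\mathrm E}_{2s+1}(1)}{u^{2s+1}},\qquad\tilde\chi_m(u)=\frac u4\ln\left(\frac{2e}u\right)-\sum_{s=0}^m(-1)^s\frac{\tilde{\mathrm E}_{2s+1}(1)}{u^{2s+1}},$$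 and $\bar\eta_{2m+2,j}(u,z)$, $\tilde\eta_{2m+2,j}(u,z)$ are $\mathcal O(u^{-2m-2})$ uniformly in the right half plane except in neighbourhoods of $z=\pm i$. Moreover, with $n=2m+2$, $$|\bar\eta_{n,j}|\le u^{-n}\omega_{n}\exp\{u^{-1}\varpi_{n}+u^{-n}\omega_{n}\},\quad \varpi_n=4\sum_{s=0}^{n-2}\frac1{u^s}\int_1^{\bar\beta}\left|\bar{\mathrm E}_{s+1}'(p)dp\right|,$$ $$\omega_n=2\int_1^{\bar\beta}\left|\bar{\mathrm E}_n'(p)dp\right|+\sum_{s=1}^{n-1}\frac1{u^s}\int_1^{\bar\beta}\left|\sum_{k=s}^{n-1}(1-p^2)^2\bar{\mathrm E}_k'(p)\bar{\mathrm E}_{s+n-k-1}'(p)dp\right|,$$ and the same bound holds for $\tilde\eta_{n,j}$ with $\bar{\mathrm E}$ replaced by $\tilde{\mathrm E}$; the integrals are along the image under $z\mapsto\bar\beta$ of a path in the $z$ plane from $e^{\pi i/4}\infty$ ($j=0$) or $e^{-\pi i/4}\infty$ ($j=3$) to $z$, avoiding $z=\pm i$, consisting of a finite chain of $R_2$ arcs, and on which $\Im(\bar\xi)$ is monotonic.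
   Context: $U(a,z)$ is the parabolic cylinder function: the solution of $y''-(\tfrac14z^2+a)y=0$ with $U(a,z)\sim z^{-a-1/2}e^{-z^2/4}$ as $z\to\infty$, $|\arg z|\le\frac34\pi-\delta$. $W_j(a,z)=U((-1)^jia,(-i)^jze^{-\pi i/4})$ (here with $a=-\frac12u$), and the prime on $W_j$ denotes the derivative with respect to its second argument. $\bar\xi=\int_0^z(t^2+1)^{1/2}dt=\tfrac12z\sqrt{z^2+1}+\tfrac12\ln(z+\sqrt{z^2+1})$, real for real $z$, and $\bar\beta=z/\sqrt{z^2+1}$, positive for $z>0$, both continuous in the plane cut along $\pm iy$, $1\le y<\infty$. (Bars are not complex conjugates.) $\bar{\mathrm E}_1(\bar\beta)=\frac1{24}\bar\beta(6-5\bar\beta^2)$, $\bar{\mathrm E}_2(\bar\beta)=\frac1{16}(1-\bar\beta^2)^2(5\bar\beta^2-2)$, $\tilde{\mathrm E}_1(\bar\beta)=\frac1{24}\bar\beta(7\bar\beta^2-6)$, $\tilde{\mathrm E}_2(\bar\beta)=\frac1{16}(1-\bar\beta^2)^2(2-7\bar\beta^2)$, and for $s\ge2$ both sequences satisfy $$\mathsf E_{s+1}(\bar\beta)=-\tfrac12(1-\bar\beta^2)^2\mathsf E_s'(\bar\beta)-\tfrac12\int_{\sigma(s)}^{\bar\beta}(1-p^2)^2\sum_{j=1}^{s-1}\mathsf E_j'(p)\mathsf E_{s-j}'(p)\,dp,$$ with $\sigma(s)=1$ for $s$ odd and $\sigma(s)=0$ for $s$ even. An $R_2$ arc is one with a parametrization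 whose second derivative is continuous and whose first derivative does not vanish.
   Formalization: The uniform O-claim excludes, besides a neighbourhood of z=i (j=0) or z=-i (j=3), a neighbourhood of the whole cut z=-iy (j=0) or z=iy (j=3), y≥1, not only of its endpoint; near that cut W_j is a sum of two comparable exponentials and the claim fails. *)

theory Defs
  imports
    "HOL-Complex_Analysis.Complex_Analysis"
    "HOL-Library.Landau_Symbols"
begin

section \<open>Parabolic cylinder functions\<close>

definition is_parabolic_cylinder_U :: "complex \<Rightarrow> (complex \<Rightarrow> complex) \<Rightarrow> bool" where
  "is_parabolic_cylinder_U a y \<longleftrightarrow>
     y holomorphic_on UNIV \<and>
     (\<forall>z. (deriv ^^ 2) y z - (z\<^sup>2 / 4 + a) * y z = 0) \<and>
     (\<forall>\<delta>>0. y \<sim>[inf at_infinity (principal {z. \<bar>Arg z\<bar> \<le> 3 / 4 * pi - \<delta>})]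
        (\<lambda>z. z powr (- a - 1 / 2) * exp (- (z\<^sup>2) / 4)))"

definition parabolic_cylinder_U :: "complex \<Rightarrow> complex \<Rightarrow> complex" where
  "parabolic_cylinder_U a = (THE y. is_parabolic_cylinder_U a y)"

definition pcf_W :: "nat \<Rightarrow> complex \<Rightarrow> complex \<Rightarrow> complex" where
  "pcf_W j a z =
     parabolic_cylinder_U ((-1) ^ j * \<i> * a) ((- \<i>) ^ j * z * exp (- (of_real pi * \<i> / 4)))"


section \<open>The Liouville-Green variables\<close>

definition cut_plane :: "complex set" where
  "cut_plane = - {z. Re z = 0 \<and> 1 \<le> \<bar>Im z\<bar>}"

text \<open>
  For \<open>z\<close> in the cut plane, \<open>z\<^sup>2 + 1\<close> avoids the non-positive reals, so the principal square root
  and the principal power of \<open>z\<^sup>2 + 1\<close> are the branches that are continuous there and positive for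
  real \<open>z\<close>.
\<close>

definition xi_bar :: "complex \<Rightarrow> complex" where
  "xi_bar z = contour_integral (linepath 0 z) (\<lambda>t. csqrt (t\<^sup>2 + 1))"

definition beta_bar :: "complex \<Rightarrow> complex" where
  "beta_bar z = z / csqrt (z\<^sup>2 + 1)"


section \<open>The coefficients\<close>

definition LG_sigma :: "nat \<Rightarrow> complex" where
  "LG_sigma s = (if odd s then 1 else 0)"

text \<open>
  The recursion shared by both coefficient sequences, with the first two members as parameters.
  The last equation is the recursion for the member with index \<open>s + 1\<close>, where \<open>s = k + 2\<close>;
  the value at index \<open>0\<close> is a dummy.
\<close>

fun LG_coeff :: "(complex \<Rightarrow> complex) \<Rightarrow> (complex \<Rightarrow> complex) \<Rightarrow> nat \<Rightarrow> complex \<Rightarrow> complex" where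
  "LG_coeff e1 e2 0 = (\<lambda>b. 0)"
| "LG_coeff e1 e2 (Suc 0) = e1"
| "LG_coeff e1 e2 (Suc (Suc 0)) = e2"
| "LG_coeff e1 e2 (Suc (Suc (Suc k))) = (\<lambda>b.
     - (1 / 2) * (1 - b\<^sup>2)\<^sup>2 * deriv (LG_coeff e1 e2 (Suc (Suc k))) b
     - (1 / 2) * contour_integral (linepath (LG_sigma (Suc (Suc k))) b)
         (\<lambda>p. (1 - p\<^sup>2)\<^sup>2 *
           (\<Sum>j = 1..Suc k. deriv (LG_coeff e1 e2 j) p *
              deriv (LG_coeff e1 e2 (Suc (Suc k) - j)) p)))"

definition E_bar :: "nat \<Rightarrow> complex \<Rightarrow> complex" where
  "E_bar = LG_coeff
     (\<lambda>b. 1 / 24 * b * (6 - 5 * b\<^sup>2))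
     (\<lambda>b. 1 / 16 * (1 - b\<^sup>2)\<^sup>2 * (5 * b\<^sup>2 - 2))"

definition E_tilde :: "nat \<Rightarrow> complex \<Rightarrow> complex" where
  "E_tilde = LG_coeff
     (\<lambda>b. 1 / 24 * b * (7 * b\<^sup>2 - 6))
     (\<lambda>b. 1 / 16 * (1 - b\<^sup>2)\<^sup>2 * (2 - 7 * b\<^sup>2))"

text \<open>This is \<open>\<chi>\<^sub>m(u)\<close> for the coefficient sequence \<open>E\<close>.\<close>

definition LG_chi :: "(nat \<Rightarrow> complex \<Rightarrow> complex) \<Rightarrow> nat \<Rightarrow> real \<Rightarrow> complex" where
  "LG_chi E m u = of_real (u / 4 * ln (2 * exp 1 / u)) -
     (\<Sum>s = 0..m. (-1) ^ s * E (2 * s + 1) 1 / of_real u ^ (2 * s + 1))"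


section \<open>Paths and error bounds\<close>

definition R2_arc_on :: "real set \<Rightarrow> (real \<Rightarrow> complex) \<Rightarrow> bool" where
  "R2_arc_on I \<gamma> \<longleftrightarrow> (\<exists>\<gamma>' \<gamma>''.
     (\<forall>t\<in>I. (\<gamma> has_vector_derivative \<gamma>' t) (at t within I)) \<and>
     (\<forall>t\<in>I. (\<gamma>' has_vector_derivative \<gamma>'' t) (at t within I)) \<and>
     continuous_on I \<gamma>'' \<and> (\<forall>t\<in>I. \<gamma>' t \<noteq> 0))"

text \<open>
  A path coming from infinity is parametrized by \<open>(-\<infinity>, 0]\<close>. The breakpoints of the finite chain
  are \<open>\<tau> 0 < \<dots> < \<tau> k = 0\<close>; the first arc is the unbounded one.
\<close>

definition R2_chain :: "(real \<Rightarrow> complex) \<Rightarrow> bool" where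
  "R2_chain \<gamma> \<longleftrightarrow> (\<exists>(k::nat) \<tau>. \<tau> k = 0 \<and> (\<forall>i<k. \<tau> i < \<tau> (Suc i)) \<and>
     R2_arc_on {..\<tau> 0} \<gamma> \<and> (\<forall>i<k. R2_arc_on {\<tau> i..\<tau> (Suc i)} \<gamma>))"

text \<open>
  Admissible paths from \<open>e\<^bsup>i\<theta>\<^esup>\<infinity>\<close> to \<open>z\<close>. Staying in the cut plane entails avoiding \<open>\<plusminus>i\<close>, and
  makes \<open>xi_bar\<close> and \<open>beta_bar\<close> continuous along the path.
\<close>

definition LG_path :: "real \<Rightarrow> complex \<Rightarrow> (real \<Rightarrow> complex) \<Rightarrow> bool" where
  "LG_path \<theta> z \<gamma> \<longleftrightarrow>
     R2_chain \<gamma> \<and> \<gamma> ` {..0} \<subseteq> cut_plane \<and> \<gamma> 0 = z \<and>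
     filterlim \<gamma> at_infinity at_bot \<and> ((\<lambda>t. Arg (\<gamma> t)) \<longlongrightarrow> \<theta>) at_bot \<and>
     (monotone_on {..0} (\<le>) (\<le>) (\<lambda>t. Im (xi_bar (\<gamma> t))) \<or>
      monotone_on {..0} (\<le>) (\<ge>) (\<lambda>t. Im (xi_bar (\<gamma> t))))"

text \<open>
  The integral of \<open>\<bar>g(p) dp\<bar>\<close> along the image of \<open>\<gamma>\<close> under \<open>beta_bar\<close>. It is extended
  real-valued, so that divergence is not confused with the value \<open>0\<close>.
\<close>

definition beta_abs_integral :: "(real \<Rightarrow> complex) \<Rightarrow> (complex \<Rightarrow> complex) \<Rightarrow> ennreal" where
  "beta_abs_integral \<gamma> g =
     (\<integral>\<^sup>+t\<in>{..0}. ennreal (cmod (g (beta_bar (\<gamma> t)) *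
        vector_derivative (\<lambda>r. beta_bar (\<gamma> r)) (at t))) \<partial>lborel)"

definition LG_varpi ::
  "(nat \<Rightarrow> complex \<Rightarrow> complex) \<Rightarrow> nat \<Rightarrow> real \<Rightarrow> (real \<Rightarrow> complex) \<Rightarrow> ennreal" where
  "LG_varpi E n u \<gamma> =
     4 * (\<Sum>s = 0..n - 2. ennreal (1 / u ^ s) * beta_abs_integral \<gamma> (deriv (E (s + 1))))"

definition LG_omega ::
  "(nat \<Rightarrow> complex \<Rightarrow> complex) \<Rightarrow> nat \<Rightarrow> real \<Rightarrow> (real \<Rightarrow> complex) \<Rightarrow> ennreal" where
  "LG_omega E n u \<gamma> =
     2 * beta_abs_integral \<gamma> (deriv (E n)) +
     (\<Sum>s = 1..n - 1. ennreal (1 / u ^ s) *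
        beta_abs_integral \<gamma> (\<lambda>p. \<Sum>k = s..n - 1.
          (1 - p\<^sup>2)\<^sup>2 * deriv (E k) p * deriv (E (s + n - k - 1)) p))"

text \<open>If one of the integrals diverges, the bound is infinite and nothing is claimed.\<close>

definition LG_error_bound ::
  "(nat \<Rightarrow> complex \<Rightarrow> complex) \<Rightarrow> nat \<Rightarrow> real \<Rightarrow> (real \<Rightarrow> complex) \<Rightarrow> complex \<Rightarrow> bool" where
  "LG_error_bound E n u \<gamma> \<eta> \<longleftrightarrow>
     (LG_varpi E n u \<gamma> < \<infinity> \<and> LG_omega E n u \<gamma> < \<infinity> \<longrightarrow>
      cmod \<eta> \<le> enn2real (LG_omega E n u \<gamma>) / u ^ n *
        exp (enn2real (LG_varpi E n u \<gamma>) / u + enn2real (LG_omega E n u \<gamma>) / u ^ n))"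

text \<open>
  The region of uniform validity in the right half plane, for \<open>e = 1\<close> (\<open>j = 0\<close>) and \<open>e = -1\<close>
  (\<open>j = 3\<close>). Besides the disc around \<open>ei\<close>, one has to exclude a neighbourhood of the whole cut
  that starts at the other turning point \<open>-ei\<close>, not only of that point: this cut is the boundary
  of the sector of validity of the asymptotic form of \<open>U\<close> (\<open>arg = \<plusminus>3\<pi>/4\<close>), near it \<open>W\<^sub>j\<close> is a sum of
  two exponentials of comparable size (its zeros accumulate along it), and the error term does not
  tend to \<open>0\<close> uniformly.
\<close>

definition LG_region :: "real \<Rightarrow> real \<Rightarrow> complex set" where
  "LG_region e \<delta> = {z \<in> cut_plane. 0 \<le> Re z \<and> \<delta> \<le> dist z (of_real e * \<i>) \<and>
     (\<forall>y\<ge>1. \<delta> \<le> dist z (- of_real (e * y) * \<i>))}"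

end

theory Submission
  imports Defs "HOL-Real_Asymp.Real_Asymp"
begin

text \<open>
  Write \<open>w z = W\<^sub>j(-u/2, sqrt(2u) z)\<close>, so that \<open>w'' = -u\<^sup>2 (1 + z\<^sup>2) w\<close>, and let \<open>h\<close> be the quotient of
  \<open>w\<close> (or of \<open>w'\<close>) by the claimed expansion. With \<open>x = -\<i>e/u\<close>, where \<open>e = 1\<close> for \<open>j = 0\<close> and
  \<open>e = -1\<close> for \<open>j = 3\<close>, the exponent of the expansion is
  \<open>xi_bar / x + \<Sum>\<^sub>s x\<^sup>s E\<^sub>s(beta_bar)\<close>, and the recursion of the \<open>E\<^sub>s\<close> says exactly that
  \<open>h\<close> satisfies \<open>h'' + 2 (1/x + T) h' + R h = 0\<close> in the variable \<open>xi_bar\<close>, where \<open>R\<close> is of order \<open>u\<^sup>1\<^sup>-\<^sup>n\<close>.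
  As \<open>exp (2 xi_bar / x)\<close> does not decrease in modulus along an admissible path, a Gronwall argument
  for the pair \<open>(h', 2 (h - 1) / x + h')\<close>, which tends to \<open>0\<close> at the start of the path, gives the error
  bound. The uniform estimate comes from explicit paths: the ray in direction \<open>exp (\<i>e\<pi>/4)\<close>
  followed, where \<open>e Im z < 0\<close>, by a vertical segment.

  The behaviour at the start of the path is the defining asymptotic form of \<open>U\<close>. Its existence for
  \<open>Re a > -1/2\<close> follows from \<open>U(a, z) = exp (-z\<^sup>2/4) / \<Gamma>(a + 1/2) \<integral> t powr (a - 1/2) exp (-t\<^sup>2/2 - zt) dt\<close>
  by rotating the line of integration, which reaches \<open>\<bar>arg z\<bar> < 3\<pi>/4\<close>; uniqueness holds because the
  Wronskian of two such solutions vanishes at \<open>+\<infinity>\<close>.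
\<close>

section \<open>The coefficients\<close>

text \<open>Nothing can be read off \<open>parabolic_cylinder_U\<close>, a definite description,
  before existence and uniqueness are settled. The parameter occurring in W_j here is purely
  imaginary, hence inside the half plane \<open>Re a > - 1 / 2\<close> where the integral converges.
  The description constrains U alone and not its derivative, so the behaviour of h' and of w' at
  infinity is extracted by Cauchy estimates, each time in a slightly narrower sector; this is why
  the apertures 4/5, 9/10 and 19/20 occur. The pair in the Gronwall argument comes from h'' + 2 h' /
  x = 0, whose solutions are 1 and exp (- 2 xi / x): h' carries the exponential component and 2 (h -
  1) / x + h' the constant one. Their difference is 2 (h - 1) / x, so a common bound N gives |h - 1|
  <= N / u, and the bound at the end of one arc is the initial bound of the next. The expansions
  themselves are exact identities, because h is by definition the quotient; only its distance from 1
  is a matter of analysis.\<close>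

definition LG_F :: "(nat \<Rightarrow> complex \<Rightarrow> complex) \<Rightarrow> nat \<Rightarrow> complex \<Rightarrow> complex" where
  "LG_F E s b = (1 - b\<^sup>2)\<^sup>2 * deriv (E s) b"

text \<open>The properties of the coefficients that the analysis uses, common to both sequences.
  Since d beta / d xi = (1 - beta^2)^2, \<open>LG_F E s\<close> at \<open>beta_bar\<close> is the
  xi-derivative of E_s, and the recursion, differentiated once and multiplied by 2 (1 - b^2)^2, is
  free of integrals. The last clause is the effect of the base points
  \<open>LG_sigma\<close>.\<close>

definition LG_sequence :: "(nat \<Rightarrow> complex \<Rightarrow> complex) \<Rightarrow> bool" where
  "LG_sequence E \<longleftrightarrow> (\<forall>s. E s holomorphic_on UNIV) \<and>
     (\<forall>s\<ge>1. \<forall>b. 2 * LG_F E (Suc s) b =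
        - ((1 - b\<^sup>2)\<^sup>2 * deriv (LG_F E s) b) - (\<Sum>j = 1..s - 1. LG_F E j b * LG_F E (s - j) b)) \<and>
     (\<forall>s\<ge>1. E (2 * s) 1 = 0)"

lemma contour_integral_linepath_has_field_derivative:
  fixes f :: "complex \<Rightarrow> complex"
  assumes "f holomorphic_on UNIV"
  shows "((\<lambda>b. contour_integral (linepath a b) f) has_field_derivative f b) (at b)"
proof -
  obtain G where G: "\<And>x. (G has_field_derivative f x) (at x)"
    using holomorphic_convex_primitive'[OF convex_UNIV open_UNIV assms] by auto
  have "contour_integral (linepath a c) f = G c - G a" for c
    using contour_integral_unique[OF contour_integral_primitive[of UNIV G f "linepath a c"]] G
    by auto
  then show ?thesis
    by (auto intro!: derivative_eq_intros G)
qed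

lemma holomorphic_contour_integral_linepath:
  assumes "f holomorphic_on UNIV"
  shows "(\<lambda>b. contour_integral (linepath a b) f) holomorphic_on UNIV"
  using contour_integral_linepath_has_field_derivative[OF assms]
  by (auto simp: holomorphic_on_def field_differentiable_def intro: has_field_derivative_at_within)

lemma holomorphic_LG_coeff:
  assumes "e1 holomorphic_on UNIV" "e2 holomorphic_on UNIV"
  shows "LG_coeff e1 e2 s holomorphic_on UNIV"
proof (induction s rule: less_induct)
  case (less s)
  consider "s = 0" | "s = 1" | "s = 2" | k where "s = Suc (Suc (Suc k))"
    by (metis One_nat_def Suc_1 not0_implies_Suc)
  then show ?case
  proof cases
    case 4
    have "(\<lambda>p. (1 - p\<^sup>2)\<^sup>2 * (\<Sum>j = 1..Suc k. deriv (LG_coeff e1 e2 j) p *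
              deriv (LG_coeff e1 e2 (Suc (Suc k) - j)) p)) holomorphic_on UNIV"
      by (intro holomorphic_intros holomorphic_deriv less) (auto simp: 4)
    from holomorphic_contour_integral_linepath[OF this] show ?thesis
      unfolding 4 LG_coeff.simps
      by (intro holomorphic_intros holomorphic_deriv less) (auto simp: 4)
  qed (use assms in \<open>auto simp: numeral_2_eq_2\<close>)
qed

text \<open>Differentiation turns the integral in the recursion into its integrand, and each factor
  (1 - b^2)^2 then completes some \<open>deriv\<close> to an \<open>LG_F\<close>. The hypothesis on
  \<open>e2\<close> extends the recursion to s = 1.\<close>

lemma LG_coeff_recursion:
  assumes "e1 holomorphic_on UNIV"
    and e2: "\<And>b. e2 b = - (1 / 2) * ((1 - b\<^sup>2)\<^sup>2 * deriv e1 b)"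
    and "s \<ge> 1"
  shows "2 * LG_F (LG_coeff e1 e2) (Suc s) b = - ((1 - b\<^sup>2)\<^sup>2 * deriv (LG_F (LG_coeff e1 e2) s) b) -
    (\<Sum>j = 1..s - 1. LG_F (LG_coeff e1 e2) j b * LG_F (LG_coeff e1 e2) (s - j) b)"
proof -
  have e2': "e2 = (\<lambda>b. - (1 / 2) * ((1 - b\<^sup>2)\<^sup>2 * deriv e1 b))"
    using e2 by auto
  have h2: "e2 holomorphic_on UNIV"
    unfolding e2' by (intro holomorphic_intros holomorphic_deriv assms) auto
  note hol = holomorphic_LG_coeff[OF assms(1) h2]
  let ?E = "LG_coeff e1 e2"
  have holF: "LG_F ?E s holomorphic_on UNIV" for s
    unfolding LG_F_def by (intro holomorphic_intros holomorphic_deriv hol) auto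
  define g where "g = (\<lambda>p. (1 - p\<^sup>2)\<^sup>2 * (\<Sum>j = 1..s - 1. deriv (?E j) p * deriv (?E (s - j)) p))"
  have holg: "g holomorphic_on UNIV"
    unfolding g_def by (intro holomorphic_intros holomorphic_deriv hol) auto
  \<comment> \<open>For s = 1 the sum in \<open>g\<close> is empty and the formula is the hypothesis
    on \<open>e2\<close>; this gives index 2 the same shape as the later ones.\<close>
  have eq: "?E (Suc s) = (\<lambda>b. - (1 / 2) * LG_F ?E s b -
      (1 / 2) * contour_integral (linepath (LG_sigma s) b) g)"
  proof (cases "s = 1")
    case True
    then show ?thesis by (auto simp: g_def e2' LG_F_def fun_eq_iff numeral_2_eq_2)
  next
    case False
    then obtain k where k: "s = Suc (Suc k)"
      using \<open>s \<ge> 1\<close> by (metis One_nat_def not0_implies_Suc not_one_le_zero)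
    show ?thesis by (auto simp: k LG_F_def g_def fun_eq_iff)
  qed
  have "(?E (Suc s) has_field_derivative - (1 / 2) * deriv (LG_F ?E s) b - (1 / 2) * g b) (at b)"
    unfolding eq
    by (intro DERIV_diff DERIV_cmult contour_integral_linepath_has_field_derivative holg
          holomorphic_derivI[OF holF]) auto
  then have d: "deriv (?E (Suc s)) b = - (1 / 2) * deriv (LG_F ?E s) b - (1 / 2) * g b"
    by (rule DERIV_imp_deriv)
  have "2 * LG_F ?E (Suc s) b = - ((1 - b\<^sup>2)\<^sup>2 * deriv (LG_F ?E s) b) - (1 - b\<^sup>2)\<^sup>2 * g b"
    unfolding LG_F_def[of _ "Suc s"] d by (simp add: algebra_simps)
  also have "(1 - b\<^sup>2)\<^sup>2 * g b = (\<Sum>j = 1..s - 1. LG_F ?E j b * LG_F ?E (s - j) b)"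
    by (simp add: g_def LG_F_def sum_distrib_left mult_ac)
  finally show ?thesis .
qed

text \<open>At b = 1 the first term of the recursion dies with (1 - b^2)^2. For an even index beyond
  2 the integral starts at 1 as well, so it runs over a degenerate segment.\<close>

lemma LG_sequence_LG_coeff:
  assumes "e1 holomorphic_on UNIV"
    and e2: "\<And>b. e2 b = - (1 / 2) * ((1 - b\<^sup>2)\<^sup>2 * deriv e1 b)"
  shows "LG_sequence (LG_coeff e1 e2)"
proof -
  have e2': "e2 = (\<lambda>b. - (1 / 2) * ((1 - b\<^sup>2)\<^sup>2 * deriv e1 b))"
    using e2 by auto
  have h2: "e2 holomorphic_on UNIV"
    unfolding e2' by (intro holomorphic_intros holomorphic_deriv assms) auto
  have "LG_coeff e1 e2 (2 * s) 1 = 0" if s: "s \<ge> 1" for s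
  proof (cases "s = 1")
    case True
    then show ?thesis by (simp add: e2' numeral_2_eq_2)
  next
    case False
    then obtain k where k: "2 * s = Suc (Suc (Suc k))" "odd (Suc (Suc k))"
    proof -
      have "2 * s = Suc (Suc (Suc (2 * s - 3)))" using False s by auto
      moreover have "odd (Suc (Suc (2 * s - 3)))" using False s by presburger
      ultimately show ?thesis using that by blast
    qed
    show ?thesis unfolding k LG_coeff.simps using k(2) by (simp add: LG_sigma_def)
  qed
  then show ?thesis
    unfolding LG_sequence_def
    using holomorphic_LG_coeff[OF assms(1) h2] LG_coeff_recursion[OF assms] by blast
qed

lemma LG_sequence_E_bar: "LG_sequence E_bar"
  and deriv_E_bar_1: "deriv (E_bar 1) b = (6 - 15 * b\<^sup>2) / 24"
proof -
  have d: "deriv (\<lambda>b. 1 / 24 * b * (6 - 5 * b\<^sup>2)) b = (6 - 15 * b\<^sup>2) / 24" for b :: complex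
    by (rule DERIV_imp_deriv) (auto intro!: derivative_eq_intros simp: field_simps power2_eq_square)
  then show "deriv (E_bar 1) b = (6 - 15 * b\<^sup>2) / 24"
    by (simp add: E_bar_def)
  show "LG_sequence E_bar"
    unfolding E_bar_def
    by (rule LG_sequence_LG_coeff, intro holomorphic_intros, simp only: d) (simp add: field_simps)
qed

lemma LG_sequence_E_tilde: "LG_sequence E_tilde"
  and deriv_E_tilde_1: "deriv (E_tilde 1) b = (21 * b\<^sup>2 - 6) / 24"
proof -
  have d: "deriv (\<lambda>b. 1 / 24 * b * (7 * b\<^sup>2 - 6)) b = (21 * b\<^sup>2 - 6) / 24" for b :: complex
    by (rule DERIV_imp_deriv) (auto intro!: derivative_eq_intros simp: field_simps power2_eq_square)
  then show "deriv (E_tilde 1) b = (21 * b\<^sup>2 - 6) / 24"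
    by (simp add: E_tilde_def)
  show "LG_sequence E_tilde"
    unfolding E_tilde_def
    by (rule LG_sequence_LG_coeff, intro holomorphic_intros, simp only: d) (simp add: field_simps)
qed

section \<open>The Liouville-Green variables\<close>

lemma cut_plane_iff: "z \<in> cut_plane \<longleftrightarrow> z\<^sup>2 + 1 \<notin> \<real>\<^sub>\<le>\<^sub>0"
proof -
  have "z\<^sup>2 + 1 \<in> \<real>\<^sub>\<le>\<^sub>0 \<longleftrightarrow> Im (z\<^sup>2) = 0 \<and> Re (z\<^sup>2) \<le> - 1"
    by (auto simp: complex_nonpos_Reals_iff)
  also have "\<dots> \<longleftrightarrow> Re z = 0 \<and> 1 \<le> \<bar>Im z\<bar>"
  proof -
    have *: "1 \<le> \<bar>y\<bar> \<longleftrightarrow> y\<^sup>2 \<ge> 1" for y :: real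
      by (metis abs_square_le_1 abs_1 abs_le_square_iff one_power2)
    have "\<not> ((Re z)\<^sup>2 \<le> -1)" by (smt (verit) zero_le_power2)
    then show ?thesis unfolding *
      by (auto simp: Im_power2 Re_power2)
  qed
  finally show ?thesis by (auto simp: cut_plane_def)
qed

lemma open_cut_plane: "open cut_plane"
proof -
  have "cut_plane = (\<lambda>z. z\<^sup>2 + 1) -` (- \<real>\<^sub>\<le>\<^sub>0)" by (auto simp: cut_plane_iff)
  moreover have "continuous_on UNIV (\<lambda>z :: complex. z\<^sup>2 + 1)" by (intro continuous_intros)
  ultimately show ?thesis using open_vimage[OF open_Compl[OF closed_nonpos_Reals_complex]] by metis
qed

lemma cut_plane_nonzero: "z \<in> cut_plane \<Longrightarrow> z\<^sup>2 + 1 \<noteq> 0"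
  by (auto simp: cut_plane_iff)

lemma cut_plane_csqrt_nonzero: "z \<in> cut_plane \<Longrightarrow> csqrt (z\<^sup>2 + 1) \<noteq> 0"
  using cut_plane_nonzero by (simp add: csqrt_eq_0)

lemma Re_pos_imp_cut_plane: "Re z > 0 \<Longrightarrow> z \<in> cut_plane"
  by (auto simp: cut_plane_def)

lemma has_field_derivative_csqrt_cut_plane:
  assumes "z \<in> cut_plane"
  shows "((\<lambda>z. csqrt (z\<^sup>2 + 1)) has_field_derivative z / csqrt (z\<^sup>2 + 1)) (at z)"
proof -
  have d: "((\<lambda>z. z\<^sup>2 + 1) has_field_derivative 2 * z) (at z)"
    by (auto intro!: derivative_eq_intros)
  have n: "z\<^sup>2 + 1 \<notin> \<real>\<^sub>\<le>\<^sub>0" using assms by (simp add: cut_plane_iff)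
  show ?thesis
    by (rule DERIV_cong[OF DERIV_chain2[OF has_field_derivative_csqrt[OF n] d]])
      (simp add: inverse_eq_divide)
qed

lemma one_minus_beta_bar_sq:
  assumes "z \<in> cut_plane"
  shows "1 - (beta_bar z)\<^sup>2 = 1 / (z\<^sup>2 + 1)"
  using cut_plane_nonzero[OF assms] by (simp add: beta_bar_def power_divide field_simps)

text \<open>With q = \<open>csqrt (z\<^sup>2 + 1)\<close> the derivative is 1 / q^3. The form given
  here splits off d xi / dz = q and exhibits d beta / d xi.\<close>

lemma has_field_derivative_beta_bar:
  assumes "z \<in> cut_plane"
  shows "(beta_bar has_field_derivative (1 - (beta_bar z)\<^sup>2)\<^sup>2 * csqrt (z\<^sup>2 + 1)) (at z)"
proof -
  let ?q = "csqrt (z\<^sup>2 + 1)"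
  have q: "?q \<noteq> 0" "?q\<^sup>2 = z\<^sup>2 + 1"
    using cut_plane_csqrt_nonzero[OF assms] by auto
  have "(beta_bar has_field_derivative (1 * ?q - z * (z / ?q)) / (?q * ?q)) (at z)"
    unfolding beta_bar_def[abs_def]
    by (intro derivative_intros has_field_derivative_csqrt_cut_plane assms q)
  also have "(1 * ?q - z * (z / ?q)) / (?q * ?q) = 1 / ?q ^ 3"
    using q by (simp add: field_simps power2_eq_square power3_eq_cube)
  also have "\<dots> = (1 / ?q\<^sup>2)\<^sup>2 * ?q"
    using q(1) by (simp add: field_simps eval_nat_numeral)
  finally show ?thesis
    by (simp only: one_minus_beta_bar_sq[OF assms] q(2))
qed

text \<open>As (z + q) (q - z) = 1, a value z + q = r <= 0 would be nonzero and would force 2 q = r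
  + 1/r < 0, against Re q >= 0. It keeps the logarithm in \<open>xi_closed\<close> off its
  cut.\<close>

lemma csqrt_plus_not_nonpos:
  assumes "z \<in> cut_plane"
  shows "z + csqrt (z\<^sup>2 + 1) \<notin> \<real>\<^sub>\<le>\<^sub>0"
proof
  let ?q = "csqrt (z\<^sup>2 + 1)"
  assume *: "z + ?q \<in> \<real>\<^sub>\<le>\<^sub>0"
  then obtain r where r: "z + ?q = of_real r" "r \<le> 0"
    by (auto elim!: nonpos_Reals_cases)
  have prod: "(z + ?q) * (?q - z) = 1"
    using power2_csqrt[of "z\<^sup>2 + 1"] by (simp add: algebra_simps power2_eq_square)
  then have "r \<noteq> 0" using r by auto
  have "?q - z = of_real (1 / r)"
    using prod \<open>r \<noteq> 0\<close> unfolding r(1) by (simp add: eq_divide_eq mult.commute)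
  then have "(?q - z) + (z + ?q) = of_real (1 / r) + of_real r"
    using r(1) by simp
  then have "2 * ?q = of_real (r + 1 / r)"
    by (simp add: add.commute)
  then have "2 * Re ?q = r + 1 / r"
    by (metis Re_complex_of_real Re_complex_of_real mult_2 plus_complex.sel(1))
  moreover have "r + 1 / r < 0" using \<open>r \<noteq> 0\<close> r(2) by (simp add: add_neg_neg)
  moreover have "Re ?q \<ge> 0" using Re_csqrt by blast
  ultimately show False by linarith
qed

definition xi_closed :: "complex \<Rightarrow> complex" where
  "xi_closed z = z * csqrt (z\<^sup>2 + 1) / 2 + Ln (z + csqrt (z\<^sup>2 + 1)) / 2"

lemma has_field_derivative_xi_closed:
  assumes "z \<in> cut_plane"
  shows "(xi_closed has_field_derivative csqrt (z\<^sup>2 + 1)) (at z)"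
proof -
  let ?q = "csqrt (z\<^sup>2 + 1)"
  have q: "?q \<noteq> 0" "?q\<^sup>2 = z\<^sup>2 + 1" "z + ?q \<noteq> 0"
    using cut_plane_csqrt_nonzero[OF assms] csqrt_plus_not_nonpos[OF assms] by (auto simp del: csqrt_eq_0)
  have "(xi_closed has_field_derivative
      (1 * ?q + z / ?q * z) / 2 + inverse (z + ?q) * (1 + z / ?q) / 2) (at z)"
    unfolding xi_closed_def[abs_def]
    by (intro DERIV_add DERIV_cdivide DERIV_mult DERIV_ident has_field_derivative_csqrt_cut_plane assms
          DERIV_chain2[OF has_field_derivative_Ln] csqrt_plus_not_nonpos)
  also have "inverse (z + ?q) * (1 + z / ?q) / 2 = 1 / (2 * ?q)"
  proof -
    have "1 + z / ?q = (z + ?q) / ?q" using q by (simp add: field_simps)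
    then show ?thesis using q by simp
  qed
  also have "(1 * ?q + z / ?q * z) / 2 + 1 / (2 * ?q) = (?q\<^sup>2 + (z\<^sup>2 + 1)) / (2 * ?q)"
    using q(1) by (simp add: field_simps power2_eq_square)
  also have "\<dots> = (2 * ?q\<^sup>2) / (2 * ?q)" unfolding q(2) by simp
  also have "\<dots> = ?q" using q(1) by (simp add: power2_eq_square)
  finally show ?thesis .
qed

lemma closed_segment_0_cut_plane:
  assumes "z \<in> cut_plane" shows "closed_segment 0 z \<subseteq> cut_plane"
proof
  fix w assume "w \<in> closed_segment 0 z"
  then obtain r where r: "0 \<le> r" "r \<le> 1" "w = of_real r * z"
    by (auto simp: closed_segment_def scaleR_conv_of_real)
  have "r * \<bar>Im z\<bar> \<le> \<bar>Im z\<bar>" using r by (simp add: mult_left_le_one_le)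
  then show "w \<in> cut_plane" using assms r by (auto simp: cut_plane_def abs_mult)
qed

lemma xi_bar_eq_closed:
  assumes "z \<in> cut_plane"
  shows "xi_bar z = xi_closed z"
proof -
  have "((\<lambda>t. csqrt (t\<^sup>2 + 1)) has_contour_integral
      xi_closed (pathfinish (linepath 0 z)) - xi_closed (pathstart (linepath 0 z))) (linepath 0 z)"
  proof (rule contour_integral_primitive)
    show "(xi_closed has_field_derivative csqrt (t\<^sup>2 + 1)) (at t within cut_plane)"
      if "t \<in> cut_plane" for t
      using has_field_derivative_xi_closed[OF that] by (rule has_field_derivative_at_within)
    show "path_image (linepath 0 z) \<subseteq> cut_plane"
      using closed_segment_0_cut_plane[OF assms] by (simp only: path_image_linepath)
  qed (rule valid_path_linepath)
  moreover have "xi_closed 0 = 0" by (simp add: xi_closed_def)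
  ultimately show ?thesis
    unfolding xi_bar_def using contour_integral_unique by fastforce
qed

lemma has_field_derivative_xi_bar:
  assumes "z \<in> cut_plane"
  shows "(xi_bar has_field_derivative csqrt (z\<^sup>2 + 1)) (at z)"
  using has_field_derivative_transform_within_open
    [OF has_field_derivative_xi_closed[OF assms] open_cut_plane assms] xi_bar_eq_closed
  by auto

lemma holomorphic_on_cut_plane:
  "(\<lambda>z. csqrt (z\<^sup>2 + 1)) holomorphic_on cut_plane" "beta_bar holomorphic_on cut_plane"
  "xi_bar holomorphic_on cut_plane"
  using has_field_derivative_csqrt_cut_plane has_field_derivative_beta_bar
    has_field_derivative_xi_bar
  by (auto simp: holomorphic_on_open[OF open_cut_plane])

text \<open>The principal root halves the logarithm, and the halved imaginary part stays in the
  principal strip, so taking roots twice meets no branch jump.\<close>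

lemma powr_quarter_eq:
  assumes "z \<in> cut_plane"
  shows "(1 + z\<^sup>2) powr (1 / 4) = csqrt (csqrt (z\<^sup>2 + 1))"
proof -
  let ?q = "csqrt (z\<^sup>2 + 1)"
  have nz: "z\<^sup>2 + 1 \<noteq> 0" and q: "?q \<noteq> 0" using assms cut_plane_nonzero by auto
  have "?q = exp (Ln (z\<^sup>2 + 1) / 2)" by (rule csqrt_exp_Ln[OF nz])
  then have L: "Ln ?q = Ln (z\<^sup>2 + 1) / 2"
    using mpi_less_Im_Ln[OF nz] Im_Ln_le_pi[OF nz] pi_gt_zero
    by (simp add: Ln_exp)
  show ?thesis
    using csqrt_exp_Ln[OF q] nz unfolding L by (simp add: powr_def add.commute)
qed

lemma has_field_derivative_powr_quarter:
  assumes "z \<in> cut_plane"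
  shows "((\<lambda>z. (1 + z\<^sup>2) powr (1 / 4)) has_field_derivative
    (1 + z\<^sup>2) powr (1 / 4) * (beta_bar z * (1 - (beta_bar z)\<^sup>2) / 2 * csqrt (z\<^sup>2 + 1))) (at z)"
proof -
  let ?q = "csqrt (z\<^sup>2 + 1)"
  have q: "?q \<noteq> 0" using cut_plane_csqrt_nonzero[OF assms] .
  have n: "1 + z\<^sup>2 \<notin> \<real>\<^sub>\<le>\<^sub>0" "1 + z\<^sup>2 \<noteq> 0"
    using assms cut_plane_nonzero[OF assms] by (simp_all add: cut_plane_iff add.commute)
  have "((\<lambda>z. (1 + z\<^sup>2) powr (1 / 4)) has_field_derivative
     (1/4) * (1 + z\<^sup>2) powr (1 / 4 - 1) * (2 * z)) (at z)"
    using n by (auto intro!: derivative_eq_intros)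
  also have "(1 + z\<^sup>2) powr (1 / 4 - 1) = (1 + z\<^sup>2) powr (1 / 4) / (1 + z\<^sup>2)"
    unfolding powr_diff using n by simp
  finally have *: "((\<lambda>z. (1 + z\<^sup>2) powr (1 / 4)) has_field_derivative
     (1 / 4) * ((1 + z\<^sup>2) powr (1 / 4) / (1 + z\<^sup>2)) * (2 * z)) (at z)" .
  have b: "beta_bar z * ?q = z" using q by (simp add: beta_bar_def)
  have "beta_bar z * (1 - (beta_bar z)\<^sup>2) / 2 * ?q = (beta_bar z * ?q) * (1 - (beta_bar z)\<^sup>2) / 2"
    by (simp add: mult_ac)
  also have "\<dots> = z / (z\<^sup>2 + 1) / 2" unfolding b one_minus_beta_bar_sq[OF assms] by simp
  finally have c: "beta_bar z * (1 - (beta_bar z)\<^sup>2) / 2 * ?q = z / (z\<^sup>2 + 1) / 2" .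
  have "A * (z / (z\<^sup>2 + 1) / 2) = (1 / 4) * (A / (1 + z\<^sup>2)) * (2 * z)" for A
    by (simp only: add.commute[of "z\<^sup>2"] divide_inverse) (simp add: mult_ac)
  then show ?thesis unfolding c using * by simp
qed

section \<open>The transformed differential equation\<close>

text \<open>Everything is expressed through \<open>D = q\<^sup>-\<^sup>1 d/dz\<close> with \<open>q = csqrt (z\<^sup>2 + 1)\<close>, which is
  differentiation with respect to \<open>xi_bar\<close>.\<close>

definition xi_deriv :: "(complex \<Rightarrow> complex) \<Rightarrow> complex \<Rightarrow> complex" where
  "xi_deriv f z = deriv f z / csqrt (z\<^sup>2 + 1)"

lemma xi_derivI:
  assumes "(f has_field_derivative D * csqrt (z\<^sup>2 + 1)) (at z)" "z \<in> cut_plane"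
  shows "xi_deriv f z = D"
  using DERIV_imp_deriv[OF assms(1)] cut_plane_csqrt_nonzero[OF assms(2)]
  by (simp add: xi_deriv_def)

lemma has_field_derivative_xi_deriv:
  assumes "f holomorphic_on cut_plane" "z \<in> cut_plane"
  shows "(f has_field_derivative xi_deriv f z * csqrt (z\<^sup>2 + 1)) (at z)"
  using holomorphic_derivI[OF assms(1) open_cut_plane assms(2)] cut_plane_csqrt_nonzero[OF assms(2)]
  by (simp add: xi_deriv_def)

lemma holomorphic_xi_deriv:
  assumes "f holomorphic_on cut_plane"
  shows "xi_deriv f holomorphic_on cut_plane"
  unfolding xi_deriv_def[abs_def]
  by (intro holomorphic_on_divide holomorphic_deriv assms open_cut_plane holomorphic_on_cut_plane
        cut_plane_csqrt_nonzero)

lemma xi_deriv_cong: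
  assumes "z \<in> cut_plane" "\<And>z. z \<in> cut_plane \<Longrightarrow> f z = g z"
  shows "xi_deriv f z = xi_deriv g z"
proof -
  have "\<forall>\<^sub>F w in nhds z. w \<in> cut_plane"
    using open_cut_plane assms(1) by (simp add: eventually_nhds_in_open)
  then have "\<forall>\<^sub>F w in nhds z. f w = g w"
    by (rule eventually_mono) (use assms(2) in auto)
  then show ?thesis unfolding xi_deriv_def by (simp add: deriv_cong_ev)
qed

text \<open>The xi-derivative of the truncated exponent, the sum of x^s E_s for s < n.\<close>

definition LG_T :: "(nat \<Rightarrow> complex \<Rightarrow> complex) \<Rightarrow> nat \<Rightarrow> complex \<Rightarrow> complex \<Rightarrow> complex" where
  "LG_T E n x b = (\<Sum>s = 1..n - 1. x ^ s * LG_F E s b)"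

text \<open>What the recursion fails to cancel after truncation: the first term is the broken end of
  a telescoping sum, the others are the products of degree at least n in the square of
  \<open>LG_T\<close>.\<close>

definition LG_R :: "(nat \<Rightarrow> complex \<Rightarrow> complex) \<Rightarrow> nat \<Rightarrow> complex \<Rightarrow> complex \<Rightarrow> complex" where
  "LG_R E n x b = - 2 * x ^ (n - 1) * LG_F E n b +
     (\<Sum>s = 1..n - 1. x ^ (n - 1 + s) *
        (\<Sum>k = s..n - 1. LG_F E k b * LG_F E (s + n - k - 1) b))"

text \<open>The double sum is grouped by total degree i + j: up to n - 1 in the first part, n - 1 +
  s in the second.\<close>

lemma square_sum_split:
  fixes a :: "nat \<Rightarrow> 'a :: comm_ring_1"
  assumes "n \<ge> 2"
  shows "(\<Sum>s = 1..n - 1. x ^ s * a s)\<^sup>2 =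
    (\<Sum>s = 1..n - 1. x ^ s * (\<Sum>j = 1..s - 1. a j * a (s - j))) +
    (\<Sum>s = 1..n - 1. x ^ (n - 1 + s) * (\<Sum>k = s..n - 1. a k * a (s + n - k - 1)))"
proof -
  let ?g = "\<lambda>(i, j). x ^ (i + j) * (a i * a j)"
  let ?A = "{1..n - 1} \<times> {1..n - 1}"
  have "(\<Sum>s = 1..n - 1. x ^ s * a s)\<^sup>2 = (\<Sum>i = 1..n - 1. \<Sum>j = 1..n - 1. (x ^ i * a i) * (x ^ j * a j))"
    by (simp add: power2_eq_square sum_product)
  also have "\<dots> = (\<Sum>p\<in>?A. ?g p)"
    by (simp add: sum.cartesian_product power_add mult_ac)
  also have "\<dots> = (\<Sum>p\<in>{p\<in>?A. fst p + snd p \<le> n - 1}. ?g p) + (\<Sum>p\<in>{p\<in>?A. \<not> fst p + snd p \<le> n - 1}. ?g p)"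
  proof -
    have "?A = {p\<in>?A. fst p + snd p \<le> n - 1} \<union> {p\<in>?A. \<not> fst p + snd p \<le> n - 1}" by blast
    from arg_cong[where f = "sum ?g", OF this] show ?thesis
      by (rule trans) (rule sum.union_disjoint; auto)
  qed
  also have "(\<Sum>p\<in>{p\<in>?A. fst p + snd p \<le> n - 1}. ?g p) =
      (\<Sum>(s, j)\<in>Sigma {1..n - 1} (\<lambda>s. {1..s - 1}). x ^ s * (a j * a (s - j)))"
    by (rule sum.reindex_bij_witness[of _ "\<lambda>(s, j). (j, s - j)" "\<lambda>(i, j). (i + j, i)"]) auto
  also have "\<dots> = (\<Sum>s = 1..n - 1. x ^ s * (\<Sum>j = 1..s - 1. a j * a (s - j)))"
    by (simp add: sum.Sigma sum_distrib_left)
  also have "(\<Sum>p\<in>{p\<in>?A. \<not> fst p + snd p \<le> n - 1}. ?g p) =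
      (\<Sum>(s, k)\<in>Sigma {1..n - 1} (\<lambda>s. {s..n - 1}). x ^ (n - 1 + s) * (a k * a (s + n - k - 1)))"
    by (rule sum.reindex_bij_witness[of _ "\<lambda>(s, k). (k, s + n - k - 1)" "\<lambda>(i, j). (i + j + 1 - n, i)"]) auto
  also have "\<dots> = (\<Sum>s = 1..n - 1. x ^ (n - 1 + s) * (\<Sum>k = s..n - 1. a k * a (s + n - k - 1)))"
    by (simp add: sum.Sigma sum_distrib_left)
  finally show ?thesis .
qed

lemma holomorphic_LG_F:
  assumes "LG_sequence E" shows "LG_F E s holomorphic_on UNIV"
  using assms unfolding LG_F_def LG_sequence_def by (intro holomorphic_intros holomorphic_deriv) auto

text \<open>This is the Riccati equation for the logarithmic derivative of the expansion. The
  recursion replaces the derivative of F_s by - 2 F_(s+1) minus a convolution; the convolutions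
  cancel the low degrees of T^2, and 2 T / x against the shifted sum telescopes to 2 F_1 - 2 x^(n-1)
  F_n.\<close>

lemma LG_residual:
  assumes E: "LG_sequence E" and n: "n \<ge> 2" and x: "x \<noteq> 0"
  shows "2 * LG_T E n x b / x + (LG_T E n x b)\<^sup>2 + (1 - b\<^sup>2)\<^sup>2 * deriv (LG_T E n x) b =
    2 * LG_F E 1 b + LG_R E n x b"
proof -
  let ?F = "\<lambda>s. LG_F E s b"
  let ?C = "\<lambda>s. \<Sum>j = 1..s - 1. ?F j * ?F (s - j)"
  have "(LG_T E n x has_field_derivative (\<Sum>s = 1..n - 1. x ^ s * deriv (LG_F E s) b)) (at b)"
    unfolding LG_T_def[abs_def]
    by (intro DERIV_sum DERIV_cmult holomorphic_derivI[OF holomorphic_LG_F[OF E]]) auto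
  then have "(1 - b\<^sup>2)\<^sup>2 * deriv (LG_T E n x) b = (\<Sum>s = 1..n - 1. x ^ s * ((1 - b\<^sup>2)\<^sup>2 * deriv (LG_F E s) b))"
    by (simp add: DERIV_imp_deriv sum_distrib_left mult_ac)
  also have "\<dots> = (\<Sum>s = 1..n - 1. x ^ s * (- 2 * ?F (Suc s) - ?C s))"
  proof (rule sum.cong)
    fix s assume "s \<in> {1..n - 1}"
    then have "2 * ?F (Suc s) = - ((1 - b\<^sup>2)\<^sup>2 * deriv (LG_F E s) b) - ?C s"
      using E unfolding LG_sequence_def by auto
    moreover have "d = - 2 * a - c" if "2 * a = - d - c" for a c d :: complex
      using that by simp
    ultimately have "(1 - b\<^sup>2)\<^sup>2 * deriv (LG_F E s) b = - 2 * ?F (Suc s) - ?C s"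
      by blast
    then show "x ^ s * ((1 - b\<^sup>2)\<^sup>2 * deriv (LG_F E s) b) = x ^ s * (- 2 * ?F (Suc s) - ?C s)"
      by metis
  qed simp
  also have "\<dots> = - 2 * (\<Sum>s = 1..n - 1. x ^ s * ?F (Suc s)) - (\<Sum>s = 1..n - 1. x ^ s * ?C s)"
    by (simp add: algebra_simps sum_subtractf sum_distrib_left sum_negf)
  finally have D: "(1 - b\<^sup>2)\<^sup>2 * deriv (LG_T E n x) b = \<dots>" .
  have T: "2 * LG_T E n x b / x = 2 * (\<Sum>s = 1..n - 1. x ^ (s - 1) * ?F s)"
  proof -
    have "x ^ s * ?F s / x = x ^ (s - 1) * ?F s" if "s \<in> {1..n - 1}" for s
      using that x by (cases s) auto
    then have "(\<Sum>s = 1..n - 1. x ^ s * ?F s / x) = (\<Sum>s = 1..n - 1. x ^ (s - 1) * ?F s)"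
      by (intro sum.cong) auto
    then have "LG_T E n x b / x = (\<Sum>s = 1..n - 1. x ^ (s - 1) * ?F s)"
      unfolding LG_T_def sum_divide_distrib .
    then show ?thesis by (metis times_divide_eq_right)
  qed
  have tele: "(\<Sum>s = 1..n - 1. x ^ (s - 1) * ?F s) - (\<Sum>s = 1..n - 1. x ^ s * ?F (Suc s)) =
      ?F 1 - x ^ (n - 1) * ?F n"
  proof -
    have "(\<Sum>s = Suc 0..k. x ^ (s - 1) * ?F s - x ^ s * ?F (Suc s)) = ?F 1 - x ^ k * ?F (Suc k)" for k
      by (induction k) auto
    from this[of "n - 1"] show ?thesis using n by (simp add: sum_subtractf)
  qed
  have alg: "2 * A + X + (- 2 * B - P) = 2 * f + (- 2 * w * f' + Q)"
    if "X = P + Q" "A - B = f - w * f'" for A B P Q X f f' w :: complex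
    using that by algebra
  show ?thesis
    unfolding D T unfolding LG_T_def LG_R_def by (rule alg[OF square_sum_split[OF n] tele])
qed

text \<open>
  Both \<open>w\<close> (with \<open>\<sigma> = 1\<close>) and \<open>w'\<close> (with \<open>\<sigma> = -1\<close>) satisfy the equation assumed here, where
  \<open>\<sigma> b (1 - b\<^sup>2) / 2\<close> is the logarithmic \<open>xi\<close>-derivative of \<open>(1 + z\<^sup>2) powr (\<sigma> / 4)\<close>.
\<close>
lemma LG_transform:
  assumes E: "LG_sequence E" and n: "n \<ge> 2" and x: "x \<noteq> 0" and z: "z \<in> cut_plane"
    and v: "v holomorphic_on cut_plane"
    and ode: "\<And>z. z \<in> cut_plane \<Longrightarrow> xi_deriv (xi_deriv v) z =
      v z / x\<^sup>2 - \<sigma> * beta_bar z * (1 - (beta_bar z)\<^sup>2) * xi_deriv v z"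
    and F1: "\<And>b. 2 * LG_F E 1 b = (1 - b\<^sup>2)\<^sup>2 * (\<sigma>\<^sup>2 * b\<^sup>2 / 4 + \<sigma> * (1 - 3 * b\<^sup>2) / 2)"
    and G: "\<And>z. z \<in> cut_plane \<Longrightarrow> (G has_field_derivative
       G z * ((\<sigma> * beta_bar z * (1 - (beta_bar z)\<^sup>2) / 2 - 1 / x - LG_T E n x (beta_bar z)) *
         csqrt (z\<^sup>2 + 1))) (at z)"
  defines "h \<equiv> \<lambda>z. v z * G z"
  shows "xi_deriv (xi_deriv h) z =
      - 2 * (1 / x + LG_T E n x (beta_bar z)) * xi_deriv h z - LG_R E n x (beta_bar z) * h z"
proof -
  \<comment> \<open>\<rho> is the logarithmic xi-derivative of \<open>G\<close>, and
    \<open>d\<close> is the xi-derivative of \<rho>.\<close>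
  define \<rho> where "\<rho> b = \<sigma> * b * (1 - b\<^sup>2) / 2 - 1 / x - LG_T E n x b" for b
  define d where "d b = (1 - b\<^sup>2)\<^sup>2 * (\<sigma> * (1 - 3 * b\<^sup>2) / 2 - deriv (LG_T E n x) b)" for b
  have Gh: "G holomorphic_on cut_plane"
    using G by (auto simp: holomorphic_on_open[OF open_cut_plane])
  have Th: "LG_T E n x holomorphic_on UNIV"
    unfolding LG_T_def[abs_def] by (intro holomorphic_intros holomorphic_LG_F E)
  have \<rho>': "((\<lambda>z. \<rho> (beta_bar z)) has_field_derivative d (beta_bar z) * csqrt (z\<^sup>2 + 1)) (at z)"
    if z: "z \<in> cut_plane" for z
  proof -
    have "(\<rho> has_field_derivative (\<sigma> * (1 - 3 * b\<^sup>2) / 2 - deriv (LG_T E n x) b)) (at b)" for b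
    proof -
      have "((\<lambda>b. \<sigma> * b * (1 - b\<^sup>2) / 2) has_field_derivative \<sigma> * (1 - 3 * b\<^sup>2) / 2) (at b)"
        by (auto intro!: derivative_eq_intros simp: field_simps power2_eq_square)
      then have "(\<rho> has_field_derivative (\<sigma> * (1 - 3 * b\<^sup>2) / 2 - 0 - deriv (LG_T E n x) b)) (at b)"
        unfolding \<rho>_def[abs_def]
        by (intro DERIV_diff DERIV_const holomorphic_derivI[OF Th]) auto
      then show ?thesis by simp
    qed
    from DERIV_chain2[OF this has_field_derivative_beta_bar[OF z]] show ?thesis
      by (simp add: d_def mult_ac)
  qed
  have G': "(G has_field_derivative G z * (\<rho> (beta_bar z) * csqrt (z\<^sup>2 + 1))) (at z)"
    if "z \<in> cut_plane" for z
    using G[OF that] by (simp add: \<rho>_def)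
  note v' = has_field_derivative_xi_deriv[OF v]
  note v'' = has_field_derivative_xi_deriv[OF holomorphic_xi_deriv[OF v]]
  have h1: "xi_deriv h z = G z * (xi_deriv v z + \<rho> (beta_bar z) * v z)" if z: "z \<in> cut_plane" for z
  proof (rule xi_derivI[OF _ z])
    show "(h has_field_derivative G z * (xi_deriv v z + \<rho> (beta_bar z) * v z) * csqrt (z\<^sup>2 + 1)) (at z)"
      unfolding h_def
      by (rule DERIV_cong[OF DERIV_mult[OF v'[OF z] G'[OF z]]]) (simp add: algebra_simps)
  qed
  define b where "b = beta_bar z"
  have "xi_deriv (xi_deriv h) z = xi_deriv (\<lambda>z. G z * (xi_deriv v z + \<rho> (beta_bar z) * v z)) z"
    by (rule xi_deriv_cong[OF z h1])
  also have "\<dots> = G z * \<rho> b * (xi_deriv v z + \<rho> b * v z) +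
      G z * (xi_deriv (xi_deriv v) z + d b * v z + \<rho> b * xi_deriv v z)"
  proof (rule xi_derivI[OF _ z])
    show "((\<lambda>z. G z * (xi_deriv v z + \<rho> (beta_bar z) * v z)) has_field_derivative
      (G z * \<rho> b * (xi_deriv v z + \<rho> b * v z) +
      G z * (xi_deriv (xi_deriv v) z + d b * v z + \<rho> b * xi_deriv v z)) * csqrt (z\<^sup>2 + 1)) (at z)"
      by (rule DERIV_cong[OF DERIV_mult[OF G'[OF z] DERIV_add[OF v''[OF z]
              DERIV_mult[OF \<rho>'[OF z] v'[OF z]]]]])
         (simp add: b_def algebra_simps)
  qed
  finally have h2: "xi_deriv (xi_deriv h) z = \<dots>" .
  have res: "2 * LG_T E n x b / x + (LG_T E n x b)\<^sup>2 + (1 - b\<^sup>2)\<^sup>2 * deriv (LG_T E n x) b =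
    (1 - b\<^sup>2)\<^sup>2 * (\<sigma>\<^sup>2 * b\<^sup>2 / 4 + \<sigma> * (1 - 3 * b\<^sup>2) / 2) + LG_R E n x b"
    using LG_residual[OF E n x, of b] F1[of b] by simp
  \<comment> \<open>With 1/x as a variable of its own all relations are polynomial, and the claim is
    an algebraic consequence of them.\<close>
  define y where "y = 1 / x"
  have y: "2 * LG_T E n x b / x = 2 * LG_T E n x b * y" "v z / x\<^sup>2 = v z * y\<^sup>2" "1 / x = y"
    using x by (simp_all add: y_def power_divide)
  have "\<rho> b = \<sigma> * b * (1 - b\<^sup>2) * (1 / 2) - y - LG_T E n x b"
    by (simp add: \<rho>_def y)
  moreover have "2 * LG_T E n x b * y + (LG_T E n x b)\<^sup>2 + (1 - b\<^sup>2)\<^sup>2 * deriv (LG_T E n x) b =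
    (1 - b\<^sup>2)\<^sup>2 * (\<sigma>\<^sup>2 * b\<^sup>2 * (1/4) + \<sigma> * (1 - 3 * b\<^sup>2) * (1/2)) + LG_R E n x b"
    using res unfolding y by simp
  moreover have "d b = (1 - b\<^sup>2)\<^sup>2 * (\<sigma> * (1 - 3 * b\<^sup>2) * (1 / 2) - deriv (LG_T E n x) b)"
    by (simp add: d_def)
  ultimately show ?thesis
    unfolding h2 h1[OF z] ode[OF z] b_def[symmetric] y unfolding h_def
    by algebra
qed

section \<open>A Gronwall estimate along arcs\<close>

text \<open>The majorant \<open>\<Psi>\<close> times the integrating factor exp (- K) grows no
  faster than the integral of r, because exp (- K) <= 1. The forcing term is thereby also multiplied
  by the exponential, which is the form of the bound in the theorem.\<close>

lemma gronwall:
  fixes N k r :: "real \<Rightarrow> real"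
  assumes "t \<in> {a..b}"
    and cont: "continuous_on {a..b} N" "continuous_on {a..b} k" "continuous_on {a..b} r"
    and pos: "\<And>s. s \<in> {a..b} \<Longrightarrow> 0 \<le> k s" "\<And>s. s \<in> {a..b} \<Longrightarrow> 0 \<le> r s"
    and N: "\<And>t. t \<in> {a..b} \<Longrightarrow> N t \<le> c + integral {a..t} (\<lambda>s. k s * N s + r s)"
  shows "N t \<le> (c + integral {a..t} r) * exp (integral {a..t} k)"
proof -
  define \<Psi> where "\<Psi> t = c + integral {a..t} (\<lambda>s. k s * N s + r s)" for t
  define K where "K t = integral {a..t} k" for t
  define Q where "Q t = integral {a..t} r - \<Psi> t * exp (- K t)" for t
  have c': "continuous_on {a..b} (\<lambda>s. k s * N s + r s)" by (intro continuous_intros cont)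
  have d\<Psi>: "(\<Psi> has_real_derivative k t * N t + r t) (at t within {a..b})" if "t \<in> {a..b}" for t
    unfolding \<Psi>_def[abs_def]
    using integral_has_real_derivative[OF c' that] by (auto intro!: derivative_eq_intros)
  have dK: "(K has_real_derivative k t) (at t within {a..b})" if "t \<in> {a..b}" for t
    unfolding K_def[abs_def] using integral_has_real_derivative[OF cont(2) that] .
  have K0: "0 \<le> K t" if "t \<in> {a..b}" for t
    unfolding K_def
    by (rule integral_nonneg[OF integrable_continuous_interval[OF continuous_on_subset[OF cont(2)]]])
       (use that pos in auto)
  have dQ: "(Q has_real_derivative r t - ((k t * N t + r t) * exp (- K t) + exp (- K t) * (- k t) * \<Psi> t))
      (at t within {a..b})" if "t \<in> {a..b}" for t
  proof -
    have "((\<lambda>t. exp (- K t)) has_real_derivative exp (- K t) * (- k t)) (at t within {a..b})"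
      by (intro DERIV_chain2[OF DERIV_exp] DERIV_minus dK that)
    then show ?thesis
      unfolding Q_def[abs_def]
      by (intro DERIV_diff integral_has_real_derivative[OF cont(3) that] DERIV_mult d\<Psi> that)
  qed
  \<comment> \<open>The derivative is a sum of two nonnegative terms: one by N <= \<Psi>, the other
    by exp (- K) <= 1.\<close>
  have dQ0: "0 \<le> r t - ((k t * N t + r t) * exp (- K t) + exp (- K t) * (- k t) * \<Psi> t)"
    if t: "t \<in> {a..b}" for t
  proof -
    have "0 \<le> k t * (\<Psi> t - N t) * exp (- K t)"
      using N[OF t] pos(1)[OF t] by (simp add: \<Psi>_def)
    moreover have "0 \<le> r t * (1 - exp (- K t))"
      using K0[OF t] pos(2)[OF t] by simp
    ultimately show ?thesis by (simp add: algebra_simps)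
  qed
  have "\<exists>x\<in>{a..t}. Q t - Q a = (r x - ((k x * N x + r x) * exp (- K x) + exp (- K x) * (- k x) * \<Psi> x)) * (t - a)"
  proof (rule mvt_very_simple)
    show "(Q has_derivative (*) (r x - ((k x * N x + r x) * exp (- K x) + exp (- K x) * (- k x) * \<Psi> x)))
        (at x within {a..t})" if "a \<le> x" "x \<le> t" for x
      using dQ[of x] that assms(1)
      by (auto simp: has_field_derivative_def intro: has_derivative_subset)
  qed (use assms(1) in auto)
  then have "Q a \<le> Q t"
    using dQ0 assms(1) by (smt (verit, ccfv_threshold) atLeastAtMost_iff mult_nonneg_nonneg)
  moreover have "Q a = - c" by (simp add: Q_def \<Psi>_def K_def)
  ultimately have "\<Psi> t * exp (- K t) \<le> c + integral {a..t} r"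
    by (simp add: Q_def)
  then have "\<Psi> t \<le> (c + integral {a..t} r) * exp (K t)"
    by (simp add: exp_minus field_simps)
  with N[OF assms(1)] show ?thesis by (simp add: \<Psi>_def K_def)
qed

text \<open>
  Along a path on which \<open>exp (2 c x)\<close> does not decrease in modulus, \<open>p\<close> and \<open>2 c a + p\<close> together
  control the solution; using both instead of \<open>a\<close> and \<open>p\<close> makes the estimate compose over
  consecutive arcs without losing a factor.
\<close>
lemma LG_arc_estimate:
  fixes a p x x' T R :: "real \<Rightarrow> complex" and c :: complex and \<kappa> \<rho> :: "real \<Rightarrow> real"
  assumes st: "s \<le> t"
    and c: "c \<noteq> 0"
    and x: "\<And>r. r \<in> {s..t} \<Longrightarrow> (x has_vector_derivative x' r) (at r within {s..t})"
    and a: "\<And>r. r \<in> {s..t} \<Longrightarrow> (a has_vector_derivative p r * x' r) (at r within {s..t})"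
    and p: "\<And>r. r \<in> {s..t} \<Longrightarrow> (p has_vector_derivative
       (- 2 * (c + T r) * p r - R r * (1 + a r)) * x' r) (at r within {s..t})"
    and mono: "\<And>r r'. s \<le> r \<Longrightarrow> r \<le> r' \<Longrightarrow> r' \<le> t \<Longrightarrow> Re (c * x r) \<le> Re (c * x r')"
    and cont: "continuous_on {s..t} \<kappa>" "continuous_on {s..t} \<rho>"
    and \<kappa>: "\<And>r. r \<in> {s..t} \<Longrightarrow> (2 * cmod (T r) + cmod (R r) / cmod c) * cmod (x' r) \<le> \<kappa> r"
    and \<rho>: "\<And>r. r \<in> {s..t} \<Longrightarrow> cmod (R r) * cmod (x' r) \<le> \<rho> r"
    and init: "cmod (p s) \<le> \<Phi>" "cmod (2 * c * a s + p s) \<le> \<Phi>"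
  shows "cmod (p t) \<le> (\<Phi> + integral {s..t} \<rho>) * exp (integral {s..t} \<kappa>)"
    and "cmod (2 * c * a t + p t) \<le> (\<Phi> + integral {s..t} \<rho>) * exp (integral {s..t} \<kappa>)"
proof -
  define N where "N r = max (cmod (p r)) (cmod (2 * c * a r + p r))" for r
  define g where "g r = - (2 * T r * p r + R r * (1 + a r)) * x' r" for r
  have ca: "continuous_on {s..t} a" and cp: "continuous_on {s..t} p"
    unfolding continuous_on_eq_continuous_within
    using has_vector_derivative_continuous[OF a] has_vector_derivative_continuous[OF p] by blast+
  have contN: "continuous_on {s..t} N"
    unfolding N_def by (intro continuous_intros ca cp)
  \<comment> \<open>2 c a is the difference of the two controlled quantities, so the factors 2
    cancel.\<close>
  have aN: "cmod c * cmod (a r) \<le> N r" for r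
  proof -
    have "2 * (cmod c * cmod (a r)) = cmod ((2 * c * a r + p r) - p r)" by (simp add: norm_mult)
    also have "\<dots> \<le> cmod (2 * c * a r + p r) + cmod (p r)" by (rule norm_triangle_ineq4)
    also have "\<dots> \<le> 2 * N r" by (simp add: N_def)
    finally show ?thesis by simp
  qed
  have gb: "cmod (g r) \<le> \<kappa> r * N r + \<rho> r" if r: "r \<in> {s..t}" for r
  proof -
    have N0: "0 \<le> N r" by (simp add: N_def le_max_iff_disj)
    have "cmod (g r) \<le> (2 * cmod (T r) * cmod (p r) + cmod (R r) * (1 + cmod (a r))) * cmod (x' r)"
      unfolding g_def norm_mult norm_minus_cancel
      by (intro mult_right_mono order.trans[OF norm_triangle_ineq] add_mono)
         (auto simp: norm_mult intro!: mult_left_mono order.trans[OF norm_triangle_ineq])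
    also have "\<dots> \<le> (2 * cmod (T r) * N r + cmod (R r) * (1 + N r / cmod c)) * cmod (x' r)"
      using aN[of r] c
      by (intro mult_right_mono add_mono mult_left_mono) (auto simp: N_def field_simps)
    also have "\<dots> = (2 * cmod (T r) + cmod (R r) / cmod c) * cmod (x' r) * N r + cmod (R r) * cmod (x' r)"
      using c by (simp add: field_simps)
    also have "\<dots> \<le> \<kappa> r * N r + \<rho> r"
      by (intro add_mono mult_right_mono \<kappa> \<rho> r N0)
    finally show ?thesis .
  qed
  have c1: "continuous_on {s..r} (\<lambda>r. \<kappa> r * N r + \<rho> r)" if "r \<le> t" for r
    by (intro continuous_intros continuous_on_subset[OF contN] continuous_on_subset[OF cont(1)]
          continuous_on_subset[OF cont(2)]) (use that in auto)
  have bound: "N r \<le> \<Phi> + integral {s..r} (\<lambda>s. \<kappa> s * N s + \<rho> s)" if r: "r \<in> {s..t}" for r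
  proof -
    let ?I = "integral {s..r} (\<lambda>s. \<kappa> s * N s + \<rho> s)"
    have sub: "{s..r} \<subseteq> {s..t}" using r by auto
    have int: "(\<lambda>s. \<kappa> s * N s + \<rho> s) integrable_on {s..r}"
      using c1 r by (intro integrable_continuous_interval) auto
    \<comment> \<open>In the derivative of 2 c a + p the terms 2 c p cancel, leaving only the
      perturbation \<open>g\<close>.\<close>
    have "(g has_integral (2 * c * a r + p r) - (2 * c * a s + p s)) {s..r}"
    proof (rule fundamental_theorem_of_calculus)
      fix q assume q: "q \<in> {s..r}"
      then have q': "q \<in> {s..t}" using sub by auto
      have "((\<lambda>r. 2 * c * a r + p r) has_vector_derivative
          2 * c * (p q * x' q) + (- 2 * (c + T q) * p q - R q * (1 + a q)) * x' q) (at q within {s..t})"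
        by (intro has_vector_derivative_add has_vector_derivative_mult_right a p q')
      then show "((\<lambda>r. 2 * c * a r + p r) has_vector_derivative g q) (at q within {s..r})"
        using sub by (auto simp: g_def algebra_simps intro: has_vector_derivative_within_subset)
    qed (use r in auto)
    then have "cmod ((2 * c * a r + p r) - (2 * c * a s + p s)) \<le> ?I"
      by (metis (no_types, lifting) gb has_integral_integrable_integral int integral_norm_bound_integral
          sub subset_iff)
    then have 1: "cmod (2 * c * a r + p r) \<le> \<Phi> + ?I"
      using init(2) norm_triangle_ineq2[of "2 * c * a r + p r" "2 * c * a s + p s"] by linarith
    \<comment> \<open>The integrating factor that removes - 2 c p from the equation for p.
      Normalised at the end point r, it is 1 there and, by \<open>mono\<close>, at most 1 in modulus
      before.\<close>
    define X where "X q = exp (2 * c * (x q - x r))" for q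
    have Xle: "cmod (X q) \<le> 1" if "q \<in> {s..r}" for q
      using mono[of q r] that r by (auto simp: X_def algebra_simps)
    have "((\<lambda>q. X q * g q) has_integral X r * p r - X s * p s) {s..r}"
    proof (rule fundamental_theorem_of_calculus)
      fix q assume q: "q \<in> {s..r}"
      then have q': "q \<in> {s..t}" using sub by auto
      have dX: "(X has_vector_derivative (2 * c * x' q) * X q) (at q within {s..t})"
      proof -
        have "((\<lambda>q. 2 * c * (x q - x r)) has_vector_derivative 2 * c * x' q) (at q within {s..t})"
          by (auto intro!: derivative_eq_intros x[OF q'])
        from field_vector_diff_chain_within[OF this has_field_derivative_at_within[OF DERIV_exp]]
        show ?thesis by (simp add: X_def[abs_def] o_def)
      qed
      have "((\<lambda>q. X q * p q) has_vector_derivative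
          X q * ((- 2 * (c + T q) * p q - R q * (1 + a q)) * x' q) + (2 * c * x' q) * X q * p q) (at q within {s..t})"
        by (intro has_vector_derivative_mult dX p q')
      then show "((\<lambda>q. X q * p q) has_vector_derivative X q * g q) (at q within {s..r})"
        using sub by (auto simp: g_def algebra_simps intro: has_vector_derivative_within_subset)
    qed (use r in auto)
    moreover have "cmod (X q * g q) \<le> \<kappa> q * N q + \<rho> q" if "q \<in> {s..r}" for q
      using mult_mono[OF Xle[OF that] gb[of q]] that r by (auto simp: norm_mult)
    ultimately have "cmod (X r * p r - X s * p s) \<le> ?I"
      by (metis (no_types, lifting) has_integral_integrable_integral int integral_norm_bound_integral)
    moreover have "X r = 1" by (simp add: X_def)
    moreover have "cmod (X s * p s) \<le> \<Phi>"
      using mult_mono[OF Xle[of s] init(1)] r by (auto simp: norm_mult)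
    ultimately have 2: "cmod (p r) \<le> \<Phi> + ?I"
      using norm_triangle_ineq2[of "p r" "X s * p s"] by simp
    show ?thesis using 1 2 by (simp add: N_def)
  qed
  have "N t \<le> (\<Phi> + integral {s..t} \<rho>) * exp (integral {s..t} \<kappa>)"
  proof (rule gronwall[OF _ contN cont _ _ bound])
    show "0 \<le> \<kappa> r" if "r \<in> {s..t}" for r
      by (rule order.trans[OF _ \<kappa>[OF that]]) auto
    show "0 \<le> \<rho> r" if "r \<in> {s..t}" for r
      by (rule order.trans[OF _ \<rho>[OF that]]) auto
  qed (use st in auto)
  then show "cmod (p t) \<le> (\<Phi> + integral {s..t} \<rho>) * exp (integral {s..t} \<kappa>)"
    and "cmod (2 * c * a t + p t) \<le> (\<Phi> + integral {s..t} \<rho>) * exp (integral {s..t} \<kappa>)"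
    by (auto simp: N_def)
qed

section \<open>Mellin-type integrals\<close>

text \<open>Domination of the integrand on a disc is enough: Cauchy's inequality on discs of half
  the radius converts it into domination of the derivatives, hence of the difference quotients, and
  dominated convergence applies along every sequence.\<close>

lemma has_field_derivative_lebesgue_integral:
  fixes f :: "complex \<Rightarrow> 'a \<Rightarrow> complex"
  assumes r: "r > 0" and S: "open S" "cball z r \<subseteq> S"
    and hol: "\<And>t. t \<in> space M \<Longrightarrow> (\<lambda>w. f w t) holomorphic_on S"
    and meas: "\<And>w. w \<in> cball z r \<Longrightarrow> f w \<in> borel_measurable M"
    and g: "integrable M g"
    and dom: "\<And>w t. w \<in> cball z r \<Longrightarrow> t \<in> space M \<Longrightarrow> cmod (f w t) \<le> g t"
  shows "((\<lambda>w. \<integral>t. f w t \<partial>M) has_field_derivative (\<integral>t. deriv (\<lambda>w. f w t) z \<partial>M)) (at z)"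
    and "integrable M (\<lambda>t. deriv (\<lambda>w. f w t) z)"
    and "integrable M (f z)"
proof -
  define \<rho> where "\<rho> = r / 2"
  have \<rho>: "\<rho> > 0" "2 * \<rho> = r" using r by (auto simp: \<rho>_def)
  have int: "integrable M (f w)" if "w \<in> cball z r" for w
    by (rule Bochner_Integration.integrable_bound[OF g meas[OF that]])
      (use dom[OF that] in \<open>auto intro!: AE_I2 order.trans[OF _ abs_ge_self]\<close>)
  then show "integrable M (f z)" using r by simp
  have quot: "cmod ((f w t - f z t) / (w - z)) \<le> g t / \<rho>"
    if w: "w \<in> ball z \<rho>" "w \<noteq> z" and t: "t \<in> space M" for w t
  proof -
    have d: "cmod (deriv (\<lambda>w. f w t) v) \<le> g t / \<rho>" if v: "v \<in> ball z \<rho>" for v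
    proof -
      have sub: "cball v \<rho> \<subseteq> cball z r"
        using v \<rho> by (auto simp: subset_iff) (smt (verit) dist_triangle2 dist_commute)
      have "cmod ((deriv ^^ 1) (\<lambda>w. f w t) v) \<le> fact 1 * g t / \<rho> ^ 1"
      proof (rule Cauchy_inequality)
        show "(\<lambda>w. f w t) holomorphic_on ball v \<rho>"
          by (rule holomorphic_on_subset[OF hol[OF t]]) (use sub S ball_subset_cball[of v \<rho>] in blast)
        show "continuous_on (cball v \<rho>) (\<lambda>w. f w t)"
          by (rule holomorphic_on_imp_continuous_on, rule holomorphic_on_subset[OF hol[OF t]])
            (use sub S in auto)
        show "cmod (f x t) \<le> g t" if "cmod (v - x) = \<rho>" for x
          using dom[OF _ t, of x] sub that by (auto simp: dist_norm subset_iff)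
      qed (use \<rho> in auto)
      then show ?thesis by simp
    qed
    have "cmod (f w t - f z t) \<le> g t / \<rho> * cmod (w - z)"
    proof (rule field_differentiable_bound[OF convex_ball _ d])
      show "((\<lambda>w. f w t) has_field_derivative deriv (\<lambda>w. f w t) v) (at v within ball z \<rho>)"
        if "v \<in> ball z \<rho>" for v
        by (rule has_field_derivative_at_within, rule holomorphic_derivI[OF hol[OF t] S(1)])
          (use that S \<rho> in auto)
    qed (use w \<rho> in auto)
    then show ?thesis using w(2) by (simp add: norm_divide divide_le_eq)
  qed
  have der: "((\<lambda>w. f w t) has_field_derivative deriv (\<lambda>w. f w t) z) (at z)"
    if "t \<in> space M" for t
    by (rule holomorphic_derivI[OF hol[OF that] S(1)]) (use S r in auto)
  have main: "integrable M (\<lambda>t. deriv (\<lambda>w. f w t) z) \<and>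
      (\<lambda>n. \<integral>t. (f (X n) t - f z t) / (X n - z) \<partial>M) \<longlonglongrightarrow> (\<integral>t. deriv (\<lambda>w. f w t) z \<partial>M)"
    if X: "\<And>n. X n \<in> ball z \<rho> - {z}" "X \<longlonglongrightarrow> z" for X
  proof -
    have m: "(\<lambda>t. (f (X n) t - f z t) / (X n - z)) \<in> borel_measurable M" for n
      using X(1)[of n] \<rho> by (intro borel_measurable_divide borel_measurable_diff meas borel_measurable_const) auto
    have l: "(\<lambda>n. (f (X n) t - f z t) / (X n - z)) \<longlonglongrightarrow> deriv (\<lambda>w. f w t) z"
      if "t \<in> space M" for t
    proof -
      have "((\<lambda>w. (f w t - f z t) / (w - z)) \<longlongrightarrow> deriv (\<lambda>w. f w t) z) (at z)"
        using der[OF that] unfolding has_field_derivative_iff .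
      then show ?thesis
        unfolding tendsto_at_iff_sequentially using X by (auto simp: o_def)
    qed
    have m': "(\<lambda>t. deriv (\<lambda>w. f w t) z) \<in> borel_measurable M"
      by (rule borel_measurable_LIMSEQ_metric[OF m l])
    have g': "integrable M (\<lambda>t. g t / \<rho>)" using g by simp
    have b: "AE t in M. cmod ((f (X n) t - f z t) / (X n - z)) \<le> g t / \<rho>" for n
      using quot X(1)[of n] by (intro AE_I2) auto
    have l': "AE t in M. (\<lambda>n. (f (X n) t - f z t) / (X n - z)) \<longlonglongrightarrow> deriv (\<lambda>w. f w t) z"
      using l by (intro AE_I2) auto
    show ?thesis
      using integrable_dominated_convergence[OF m' m g' l' b]
        integral_dominated_convergence[OF m' m g' l' b] by blast
  qed
  show "integrable M (\<lambda>t. deriv (\<lambda>w. f w t) z)"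
  proof -
    \<comment> \<open>A concrete admissible sequence, to extract integrability of the derivative
      from \<open>main\<close>.\<close>
    define X where "X n = z + of_real (\<rho> / real (Suc (Suc n)))" for n
    have "X n \<in> ball z \<rho> - {z}" for n
      using \<rho> by (auto simp: X_def dist_norm divide_less_eq simp del: of_real_divide of_nat_Suc)
    moreover have "(\<lambda>n. \<rho> / real (Suc (Suc n))) \<longlonglongrightarrow> 0" by real_asymp
    then have "X \<longlonglongrightarrow> z + of_real 0" unfolding X_def[abs_def] by (intro tendsto_intros)
    then have "X \<longlonglongrightarrow> z" by simp
    ultimately show ?thesis using main by blast
  qed
  show "((\<lambda>w. \<integral>t. f w t \<partial>M) has_field_derivative (\<integral>t. deriv (\<lambda>w. f w t) z \<partial>M)) (at z)"
    unfolding has_field_derivative_iff tendsto_at_iff_sequentially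
  proof (intro allI impI)
    fix X assume X: "\<forall>i. X i \<in> UNIV - {z}" "X \<longlonglongrightarrow> z"
    then obtain N where N: "\<And>n. n \<ge> N \<Longrightarrow> X n \<in> ball z \<rho>"
      using \<rho> unfolding lim_sequentially by (fastforce simp: dist_commute)
    let ?q = "\<lambda>n. \<integral>t. (f (X n) t - f z t) / (X n - z) \<partial>M"
    have "(\<lambda>n. ?q (n + N)) \<longlonglongrightarrow> (\<integral>t. deriv (\<lambda>w. f w t) z \<partial>M)"
      using main[of "\<lambda>n. X (n + N)"] N X LIMSEQ_ignore_initial_segment[OF X(2)] by auto
    moreover have "?q n = ((\<integral>t. f (X n) t \<partial>M) - (\<integral>t. f z t \<partial>M)) / (X n - z)" if "n \<ge> N" for n
    proof -
      have "integrable M (f (X n))" "integrable M (f z)"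
        using N[OF that] \<rho> by (auto intro!: int)
      then show ?thesis by simp
    qed
    ultimately have "(\<lambda>n. ((\<integral>t. f (X (n + N)) t \<partial>M) - (\<integral>t. f z t \<partial>M)) / (X (n + N) - z))
        \<longlonglongrightarrow> (\<integral>t. deriv (\<lambda>w. f w t) z \<partial>M)" using X(1) by simp
    from LIMSEQ_offset[OF this]
    show "((\<lambda>w. ((\<integral>t. f w t \<partial>M) - (\<integral>t. f z t \<partial>M)) / (w - z)) \<circ> X)
        \<longlonglongrightarrow> (\<integral>t. deriv (\<lambda>w. f w t) z \<partial>M)" by (simp add: o_def)
  qed
qed

text \<open>Extending t powr (b - 1) by 0 lets all integrals run over the whole line with respect to
  \<open>lborel\<close>.\<close>

definition mellin_weight :: "complex \<Rightarrow> real \<Rightarrow> complex" where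
  "mellin_weight b t = (if t > 0 then of_real t powr (b - 1) else 0)"

lemma measurable_mellin_weight [measurable]: "mellin_weight b \<in> borel_measurable borel"
proof -
  have "mellin_weight b = (\<lambda>t. if t > 0 then exp ((b - 1) * of_real (ln t)) else 0)"
    by (auto simp: mellin_weight_def powr_def Ln_of_real)
  then show ?thesis by simp
qed

lemma mellin_weight_Suc: "mellin_weight (b + 1) t = of_real t * mellin_weight b t"
  by (auto simp: mellin_weight_def powr_diff)

lemma mellin_integrable_exp:
  assumes "Re b > 0" "c > 0"
  shows "integrable lborel (\<lambda>t. mellin_weight b t * of_real (exp (- c * t)))"
proof -
  have "set_integrable lebesgue {0<..} (\<lambda>t. complex_of_real t powr (b - 1) / of_real (exp (c * t)))"
    using absolutely_integrable_Gamma_integral[OF assms] .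
  then have "integrable lebesgue (\<lambda>t. mellin_weight b t * of_real (exp (- c * t)))"
    unfolding set_integrable_def
    by (rule Bochner_Integration.integrable_cong[THEN iffD1, rotated -1])
      (auto simp: mellin_weight_def indicator_def exp_minus field_simps)
  then show ?thesis
    by (subst (asm) integrable_completion) measurable
qed

lemma mellin_integrable:
  assumes "Re b > 0" "c > 0" and meas: "G \<in> borel_measurable borel"
    and G: "\<And>t. t > 0 \<Longrightarrow> cmod (G t) \<le> C * exp (- c * t)"
  shows "integrable lborel (\<lambda>t. mellin_weight b t * G t)"
proof (rule Bochner_Integration.integrable_bound)
  show "integrable lborel (\<lambda>t. of_real C * (mellin_weight b t * of_real (exp (- c * t))))"
    using mellin_integrable_exp[OF assms(1,2)] by simp
  show "(\<lambda>t. mellin_weight b t * G t) \<in> borel_measurable lborel"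
    using meas by measurable
  have "cmod (mellin_weight b t * G t) \<le> cmod (of_real C * (mellin_weight b t * of_real (exp (- c * t))))" for t
  proof (cases "t > 0")
    case True
    have "cmod (mellin_weight b t * G t) \<le> cmod (mellin_weight b t) * (\<bar>C\<bar> * exp (- c * t))"
      unfolding norm_mult
      by (intro mult_left_mono order.trans[OF G[OF True]]) (auto intro: mult_right_mono)
    then show ?thesis by (simp add: norm_mult mult_ac)
  qed (simp add: mellin_weight_def)
  then show "AE t in lborel. cmod (mellin_weight b t * G t) \<le>
      cmod (of_real C * (mellin_weight b t * of_real (exp (- c * t))))" by simp
qed

lemma mellin_Gamma:
  assumes "Re b > 0"
  shows "(\<integral>t. mellin_weight b t * of_real (exp (- t)) \<partial>lborel) = Gamma b"
proof -
  have i: "integrable lborel (\<lambda>t. mellin_weight b t * of_real (exp (- t)))"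
    using mellin_integrable_exp[OF assms, of 1] by simp
  have "((\<lambda>t. if t \<in> {0<..} then complex_of_real t powr (b - 1) / of_real (exp t) else 0) has_integral Gamma b) UNIV"
    using Gamma_integral_complex'[OF assms] by (subst has_integral_restrict_UNIV)
  also have "(\<lambda>t. if t \<in> {0<..} then complex_of_real t powr (b - 1) / of_real (exp t) else 0) =
      (\<lambda>t. mellin_weight b t * of_real (exp (- t)))"
    by (auto simp: mellin_weight_def exp_minus field_simps)
  finally show ?thesis
    using has_integral_unique has_integral_integral_lborel[OF i] by blast
qed

text \<open>The two integrands add up to the derivative of t powr b * G t, which vanishes at 0
  because Re b > 0 and at infinity because G decays exponentially.\<close>

lemma mellin_by_parts:
  assumes b: "Re b > 0" and c: "c > 0"
    and G': "\<And>t. t > 0 \<Longrightarrow> (G has_vector_derivative G' t) (at t)"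
    and cont: "\<And>t. t > 0 \<Longrightarrow> isCont G' t"
    and G: "\<And>t. t > 0 \<Longrightarrow> cmod (G t) \<le> C * exp (- c * t)"
    and int: "integrable lborel (\<lambda>t. mellin_weight b t * G t)"
      "integrable lborel (\<lambda>t. mellin_weight (b + 1) t * G' t)"
  shows "b * (\<integral>t. mellin_weight b t * G t \<partial>lborel) + (\<integral>t. mellin_weight (b + 1) t * G' t \<partial>lborel) = 0"
proof -
  define f where "f t = b * of_real t powr (b - 1) * G t + of_real t powr b * G' t" for t :: real
  define F where "F t = of_real t powr b * G t" for t :: real
  have dp: "((\<lambda>t. complex_of_real t powr b) has_vector_derivative b * of_real t powr (b - 1)) (at t)"
    if "t > 0" for t
  proof -
    have "((\<lambda>z. z powr b) has_field_derivative b * of_real t powr (b - 1)) (at (complex_of_real t))"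
      using that by (intro has_field_derivative_powr) (auto simp: complex_nonpos_Reals_iff)
    then show ?thesis
      by (rule has_vector_derivative_real_field)
  qed
  have dF: "(F has_vector_derivative f t) (at t)" if "t > 0" for t
    unfolding F_def[abs_def] f_def
    by (rule has_vector_derivative_eq_rhs[OF has_vector_derivative_mult[OF dp[OF that] G'[OF that]]]) simp
  have F_le: "cmod (F t) \<le> \<bar>C\<bar> * (t powr Re b * exp (- c * t))" if "t > 0" for t
  proof -
    have "cmod (F t) \<le> t powr Re b * (C * exp (- c * t))"
      using that G[OF that] by (simp add: F_def norm_mult norm_powr_real_powr mult_left_mono)
    also have "\<dots> \<le> t powr Re b * (\<bar>C\<bar> * exp (- c * t))"
      by (intro mult_left_mono mult_right_mono) auto
    finally show ?thesis by (simp add: mult_ac)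
  qed
  have eq: "indicator {0<..} t *\<^sub>R f t = b * (mellin_weight b t * G t) + mellin_weight (b + 1) t * G' t" for t
    by (auto simp: f_def mellin_weight_def)
  have "(LBINT t=0..\<infinity>. f t) = 0 - 0"
  proof (rule interval_integral_FTC_integrable)
    show "isCont f t" if "0 < ereal t" for t
      unfolding f_def using that G'[of t] cont[of t]
      by (auto intro!: continuous_intros has_vector_derivative_continuous[of G] simp: zero_ereal_def)
    show "set_integrable lborel (einterval 0 \<infinity>) f"
    proof -
      have "einterval 0 \<infinity> = {0<..}" by (auto simp: einterval_def zero_ereal_def)
      then show ?thesis unfolding set_integrable_def using int by (simp add: eq)
    qed
    have "((\<lambda>t. \<bar>C\<bar> * (t powr Re b * exp (- c * t))) \<longlongrightarrow> 0) (at_right 0)"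
      using b by real_asymp
    then have "(F \<longlongrightarrow> 0) (at_right 0)"
      by (rule Lim_null_comparison[rotated]) (rule eventually_mono[OF eventually_at_right_less F_le])
    then show "((F \<circ> real_of_ereal) \<longlongrightarrow> 0) (at_right 0)"
      by (simp add: zero_ereal_def ereal_tendsto_simps)
    have "((\<lambda>t. \<bar>C\<bar> * (t powr Re b * exp (- c * t))) \<longlongrightarrow> 0) at_top"
      using b c by real_asymp
    then have "(F \<longlongrightarrow> 0) at_top"
      by (rule Lim_null_comparison[rotated]) (rule eventually_mono[OF eventually_gt_at_top F_le])
    then show "((F \<circ> real_of_ereal) \<longlongrightarrow> 0) (at_left \<infinity>)"
      by (simp add: ereal_tendsto_simps)
  qed (auto intro: dF simp: zero_ereal_def)
  moreover have "(LBINT t=0..\<infinity>. f t) = (\<integral>t. b * (mellin_weight b t * G t) + mellin_weight (b + 1) t * G' t \<partial>lborel)"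
  proof -
    have "einterval 0 \<infinity> = {0<..}" by (auto simp: einterval_def zero_ereal_def)
    then show ?thesis
      by (simp add: interval_lebesgue_integral_def set_lebesgue_integral_def eq)
  qed
  ultimately show ?thesis using int by simp
qed

text \<open>Integrating along the ray through \<open>\<mu>\<close> instead of the positive axis does not change the
  value: the \<open>\<mu>\<close>-derivative of the integrand is an exact \<open>s\<close>-derivative.\<close>
lemma mellin_rotate:
  assumes b: "Re b > 0" and \<Omega>: "open \<Omega>" "convex \<Omega>" "\<Omega> \<subseteq> - \<real>\<^sub>\<le>\<^sub>0"
    and g: "g holomorphic_on UNIV"
    and bound: "\<And>\<mu>. \<mu> \<in> \<Omega> \<Longrightarrow> \<exists>r>0. \<exists>c>0. \<exists>C. cball \<mu> r \<subseteq> \<Omega> \<and>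
      (\<forall>\<nu>\<in>cball \<mu> r. \<forall>s>0. cmod (g (\<nu> * of_real s)) \<le> C * exp (- c * s))"
    and \<mu>: "\<mu> \<in> \<Omega>" "\<nu> \<in> \<Omega>"
  shows "\<mu> powr b * (\<integral>s. mellin_weight b s * g (\<mu> * of_real s) \<partial>lborel) =
    \<nu> powr b * (\<integral>s. mellin_weight b s * g (\<nu> * of_real s) \<partial>lborel)"
proof -
  define I where "I \<mu> = (\<integral>s. mellin_weight b s * g (\<mu> * of_real s) \<partial>lborel)" for \<mu>
  have gd: "(g has_field_derivative deriv g z) (at z)" for z
    by (rule holomorphic_derivI[OF g]) auto
  have gc: "isCont g z" for z using gd by (rule DERIV_isCont)
  have g'c: "isCont (deriv g) z" for z
    by (rule DERIV_isCont, rule holomorphic_derivI[OF holomorphic_deriv[OF g]]) auto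
  have "((\<lambda>\<mu>. \<mu> powr b * I \<mu>) has_field_derivative 0) (at \<mu>)" if \<mu>: "\<mu> \<in> \<Omega>" for \<mu>
  proof -
    obtain r c C where r: "r > 0" "c > 0" "cball \<mu> r \<subseteq> \<Omega>"
      and C: "\<And>\<nu> s. \<nu> \<in> cball \<mu> r \<Longrightarrow> s > 0 \<Longrightarrow> cmod (g (\<nu> * of_real s)) \<le> C * exp (- c * s)"
      using bound[OF \<mu>] by metis
    let ?f = "\<lambda>\<mu> s. mellin_weight b s * g (\<mu> * of_real s)"
    let ?g = "\<lambda>s. cmod (of_real C * (mellin_weight b s * of_real (exp (- c * s))))"
    have ch: "((\<lambda>w. g (w * of_real s)) has_field_derivative deriv g (w * of_real s) * of_real s) (at w)" for s w
      by (rule DERIV_chain2[OF gd]) (auto intro!: derivative_eq_intros)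
    have der: "deriv (\<lambda>w. ?f w s) \<mu> = mellin_weight (b + 1) s * deriv g (\<mu> * of_real s)" for s
      by (rule DERIV_imp_deriv, rule DERIV_cong[OF DERIV_cmult[OF ch]]) (simp add: mellin_weight_Suc)
    have hol: "(\<lambda>w. ?f w s) holomorphic_on UNIV" for s
      using DERIV_cmult[OF ch] by (auto simp: holomorphic_on_def field_differentiable_def)
    have meas: "?f w \<in> borel_measurable lborel" for w
    proof -
      have "(\<lambda>s. g (w * of_real s)) \<in> borel_measurable borel"
        by (intro borel_measurable_continuous_onI continuous_at_imp_continuous_on ballI
              isCont_o2[OF _ gc] continuous_intros)
      then show ?thesis by measurable
    qed
    have int_g: "integrable lborel ?g"
      using mellin_integrable_exp[OF b r(2)] by (intro integrable_norm integrable_mult_right) auto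
    have dom: "cmod (?f w s) \<le> ?g s" if "w \<in> cball \<mu> r" for w s
    proof (cases "s > 0")
      case True
      have "cmod (?f w s) \<le> cmod (mellin_weight b s) * (\<bar>C\<bar> * exp (- c * s))"
        unfolding norm_mult
        by (intro mult_left_mono order.trans[OF C[OF that True]]) (auto intro: mult_right_mono)
      then show ?thesis by (simp add: norm_mult mult_ac)
    qed (simp add: mellin_weight_def)
    note * = has_field_derivative_lebesgue_integral[of r UNIV \<mu> lborel ?f ?g, OF r(1) open_UNIV _ hol meas int_g dom]
    have i1: "integrable lborel (?f \<mu>)" and
      i2: "integrable lborel (\<lambda>s. mellin_weight (b + 1) s * deriv g (\<mu> * of_real s))" and
      dI: "(I has_field_derivative (\<integral>s. mellin_weight (b + 1) s * deriv g (\<mu> * of_real s) \<partial>lborel)) (at \<mu>)"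
      using * unfolding der I_def[abs_def] by simp_all
    \<comment> \<open>Integration by parts in s yields b I + \<mu> I' = 0, which says that
      \<open>\<mu> powr b * I \<mu>\<close> is stationary.\<close>
    have "b * I \<mu> + (\<integral>s. mellin_weight (b + 1) s * (\<mu> * deriv g (\<mu> * of_real s)) \<partial>lborel) = 0"
      unfolding I_def
    proof (rule mellin_by_parts[OF b r(2)])
      show "((\<lambda>s. g (\<mu> * of_real s)) has_vector_derivative \<mu> * deriv g (\<mu> * of_real s)) (at s)" for s
      proof -
        have "((\<lambda>z. g (\<mu> * z)) has_field_derivative deriv g (\<mu> * of_real s) * \<mu>) (at (of_real s))"
          by (rule DERIV_chain2[OF gd]) (auto intro!: derivative_eq_intros)
        from has_vector_derivative_real_field[OF this] show ?thesis by (simp add: mult.commute)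
      qed
      show "isCont (\<lambda>s. \<mu> * deriv g (\<mu> * of_real s)) s" for s
        by (intro continuous_intros isCont_o2[OF _ g'c])
      show "cmod (g (\<mu> * of_real s)) \<le> C * exp (- c * s)" if "s > 0" for s
        using C[OF _ that] r by simp
      show "integrable lborel (\<lambda>s. mellin_weight (b + 1) s * (\<mu> * deriv g (\<mu> * of_real s)))"
        using integrable_mult_right[OF i2, of \<mu>] by (simp add: mult_ac)
    qed (rule i1)
    moreover have "(\<integral>s. mellin_weight (b + 1) s * (\<mu> * deriv g (\<mu> * of_real s)) \<partial>lborel) =
        \<mu> * (\<integral>s. mellin_weight (b + 1) s * deriv g (\<mu> * of_real s) \<partial>lborel)"
      by (subst integral_mult_right_zero[symmetric]) (simp add: mult_ac)
    ultimately have z: "b * I \<mu> + \<mu> * (\<integral>s. mellin_weight (b + 1) s * deriv g (\<mu> * of_real s) \<partial>lborel) = 0"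
      by simp
    have nz: "\<mu> \<noteq> 0" "\<mu> \<notin> \<real>\<^sub>\<le>\<^sub>0" using \<mu> \<Omega>(3) by auto
    have p: "\<mu> powr (b - 1) * \<mu> = \<mu> powr b" using nz by (simp add: powr_diff)
    have "((\<lambda>\<mu>. \<mu> powr b * I \<mu>) has_field_derivative
        b * \<mu> powr (b - 1) * I \<mu> + (\<integral>s. mellin_weight (b + 1) s * deriv g (\<mu> * of_real s) \<partial>lborel) * \<mu> powr b) (at \<mu>)"
      by (intro DERIV_mult dI has_field_derivative_powr nz)
    moreover have "b * \<mu> powr (b - 1) * I \<mu> + (\<integral>s. mellin_weight (b + 1) s * deriv g (\<mu> * of_real s) \<partial>lborel) * \<mu> powr b = 0"
      using z unfolding p[symmetric] by algebra
    ultimately show ?thesis by simp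
  qed
  then have "\<exists>k. \<forall>\<mu>\<in>\<Omega>. \<mu> powr b * I \<mu> = k"
    by (intro has_field_derivative_zero_constant[OF \<Omega>(2)]) (auto intro: has_field_derivative_at_within)
  then show ?thesis using \<mu> unfolding I_def by metis
qed

text \<open>The rotation is carried out for exp (- w) in the right half plane, where it ends at the
  ordinary Gamma integral.\<close>

lemma mellin_exp_rotate:
  assumes b: "Re b > 0" and l: "Re l > 0"
  shows "l powr b * (\<integral>s. mellin_weight b s * exp (- (l * of_real s)) \<partial>lborel) = Gamma b"
proof -
  have "l powr b * (\<integral>s. mellin_weight b s * exp (- (l * of_real s)) \<partial>lborel) =
    1 powr b * (\<integral>s. mellin_weight b s * exp (- (1 * of_real s)) \<partial>lborel)"
  proof (rule mellin_rotate[of b "{z. Re z > 0}" "\<lambda>w. exp (- w)" l 1])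
    show "open {z. Re z > 0}" by (rule open_halfspace_Re_gt)
    show "convex {z. Re z > 0}" by (rule convex_halfspace_Re_gt)
    show "{z. Re z > 0} \<subseteq> - \<real>\<^sub>\<le>\<^sub>0" by (auto simp: complex_nonpos_Reals_iff)
    show "\<exists>r>0. \<exists>c>0. \<exists>C. cball \<mu> r \<subseteq> {z. Re z > 0} \<and>
      (\<forall>\<nu>\<in>cball \<mu> r. \<forall>s>0. cmod (exp (- (\<nu> * of_real s))) \<le> C * exp (- c * s))"
      if "\<mu> \<in> {z. Re z > 0}" for \<mu>
    proof -
      have *: "Re \<nu> \<ge> Re \<mu> / 2" if "\<nu> \<in> cball \<mu> (Re \<mu> / 2)" for \<nu>
        using that abs_Re_le_cmod[of "\<mu> - \<nu>"] by (auto simp: dist_norm)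
      have "cmod (exp (- (\<nu> * of_real s))) \<le> 1 * exp (- (Re \<mu> / 2) * s)"
        if "\<nu> \<in> cball \<mu> (Re \<mu> / 2)" "s > 0" for \<nu> s
        using *[OF that(1)] that(2) mult_right_mono[of "Re \<mu> / 2" "Re \<nu>" s] by simp
      moreover have "cball \<mu> (Re \<mu> / 2) \<subseteq> {z. Re z > 0}" using * that by force
      moreover have "Re \<mu> / 2 > 0" using that by simp
      ultimately show ?thesis by blast
    qed
  qed (use b l in \<open>auto intro!: holomorphic_intros\<close>)
  also have "\<dots> = Gamma b"
    using mellin_Gamma[OF b] by (simp add: exp_of_real[symmetric])
  finally show ?thesis .
qed

section \<open>The integral representing U\<close>

definition pcf_J :: "complex \<Rightarrow> complex \<Rightarrow> complex" where
  "pcf_J b z = (\<integral>t. mellin_weight b t * exp (- (of_real t)\<^sup>2 / 2 - z * of_real t) \<partial>lborel)"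

text \<open>Completing the square; it trades Gaussian decay for the exponential decay that the
  Mellin lemmas ask for.\<close>

lemma quadratic_exponent_bound:
  fixes k M s :: real
  assumes "k > 0"
  shows "- k * s\<^sup>2 + M * s \<le> (M + 1)\<^sup>2 / (4 * k) - s"
proof -
  have "0 \<le> k * (s - (M + 1) / (2 * k))\<^sup>2" using assms by simp
  also have "\<dots> = k * s\<^sup>2 - (M + 1) * s + (M + 1)\<^sup>2 / (4 * k)"
    using assms by (simp add: field_simps power2_eq_square)
  finally show ?thesis by (simp add: algebra_simps)
qed

lemma pcf_J_bound:
  assumes "cmod z \<le> M" "t > 0"
  shows "cmod (exp (- (of_real t)\<^sup>2 / 2 - z * of_real t)) \<le> exp ((M + 1)\<^sup>2 / 2) * exp (- 1 * t)"
proof -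
  have "- Re z * t \<le> M * t"
    using assms abs_Re_le_cmod[of z] by (intro mult_right_mono) auto
  then have "- t\<^sup>2 / 2 - Re z * t \<le> (M + 1)\<^sup>2 / 2 - t"
    using quadratic_exponent_bound[of "1/2" t M] by simp
  then show ?thesis
    by (simp add: norm_exp_eq_Re power2_eq_square flip: exp_add)
qed

text \<open>Differentiating in z multiplies the integrand by - t, which shifts b by one.\<close>

lemma has_field_derivative_pcf_J:
  assumes b: "Re b > 0"
  shows "(pcf_J b has_field_derivative - pcf_J (b + 1) z) (at z)"
    and "integrable lborel (\<lambda>t. mellin_weight b t * exp (- (of_real t)\<^sup>2 / 2 - z * of_real t))"
proof -
  let ?f = "\<lambda>z t. mellin_weight b t * exp (- (of_real t)\<^sup>2 / 2 - z * of_real t)"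
  let ?g = "\<lambda>t. cmod (of_real (exp ((cmod z + 1 + 1)\<^sup>2 / 2)) * (mellin_weight b t * of_real (exp (- 1 * t))))"
  have der: "(\<lambda>t. deriv (\<lambda>w. ?f w t) z) =
      (\<lambda>t. - (mellin_weight (b + 1) t * exp (- (of_real t)\<^sup>2 / 2 - z * of_real t)))"
    by (intro ext DERIV_imp_deriv) (auto intro!: derivative_eq_intros simp: mellin_weight_Suc)
  have int_g: "integrable lborel ?g"
    using mellin_integrable_exp[OF b, of 1] by (intro integrable_norm integrable_mult_right) auto
  have dom: "cmod (?f w t) \<le> ?g t" if w: "w \<in> cball z 1" for w t
  proof (cases "t > 0")
    case True
    have "cmod w \<le> cmod z + 1"
      using w norm_triangle_ineq2[of w z] by (simp add: dist_norm norm_minus_commute)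
    then show ?thesis
      unfolding norm_mult using mult_left_mono[OF pcf_J_bound[OF _ True], of w "cmod z + 1" "cmod (mellin_weight b t)"]
      by (simp add: mult_ac)
  qed (simp add: mellin_weight_def)
  have hol: "(\<lambda>w. ?f w t) holomorphic_on UNIV" for t by (intro holomorphic_intros)
  have meas: "?f w \<in> borel_measurable lborel" for w by measurable
  note * = has_field_derivative_lebesgue_integral[of 1 UNIV z lborel ?f ?g, OF _ open_UNIV _ hol meas int_g dom]
  show "(pcf_J b has_field_derivative - pcf_J (b + 1) z) (at z)"
    using *(1) unfolding der pcf_J_def[abs_def] by simp
  show "integrable lborel (?f z)" using *(3) by simp
qed

text \<open>Since J' = - \<open>pcf_J (b + 1)\<close> and J'' = \<open>pcf_J (b + 2)\<close>, this
  is the equation J'' - z J' - b J = 0, that is, Weber's equation without its factor exp (-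
  z^2/4).\<close>

lemma pcf_J_recurrence:
  assumes b: "Re b > 0"
  shows "pcf_J (b + 2) z + z * pcf_J (b + 1) z = b * pcf_J b z"
proof -
  let ?G = "\<lambda>t. exp (- (of_real t)\<^sup>2 / 2 - z * of_real t)"
  have b1: "Re (b + 1) > 0" "Re (b + 1 + 1) > 0" using b by auto
  note i0 = has_field_derivative_pcf_J(2)[OF b, of z]
  note i1 = has_field_derivative_pcf_J(2)[OF b1(1), of z]
  note i2 = has_field_derivative_pcf_J(2)[OF b1(2), of z]
  have eq: "mellin_weight (b + 1) t * ((- of_real t - z) * ?G t) =
      - (mellin_weight (b + 1 + 1) t * ?G t) - z * (mellin_weight (b + 1) t * ?G t)" for t
    unfolding mellin_weight_Suc[of "b + 1"] by (simp add: algebra_simps)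
  have "b * (\<integral>t. mellin_weight b t * ?G t \<partial>lborel) +
      (\<integral>t. mellin_weight (b + 1) t * ((- of_real t - z) * ?G t) \<partial>lborel) = 0"
  proof (rule mellin_by_parts[OF b zero_less_one])
    show "(?G has_vector_derivative (- of_real t - z) * ?G t) (at t)" for t
    proof -
      have "((\<lambda>w. exp (- w\<^sup>2 / 2 - z * w)) has_field_derivative
          (- of_real t - z) * ?G t) (at (of_real t))"
        by (auto intro!: derivative_eq_intros)
      from has_vector_derivative_real_field[OF this] show ?thesis .
    qed
    show "isCont (\<lambda>t. (- of_real t - z) * ?G t) t" for t by (intro continuous_intros) auto
    show "cmod (?G t) \<le> exp ((cmod z + 1)\<^sup>2 / 2) * exp (- 1 * t)" if "t > 0" for t
      using pcf_J_bound[of z "cmod z" t] that by simp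
    show "integrable lborel (\<lambda>t. mellin_weight (b + 1) t * ((- of_real t - z) * ?G t))"
      unfolding eq using i1 i2 by simp
  qed (rule i0)
  also have "(\<integral>t. mellin_weight (b + 1) t * ((- of_real t - z) * ?G t) \<partial>lborel) =
      - pcf_J (b + 1 + 1) z - z * pcf_J (b + 1) z"
    unfolding eq pcf_J_def using i1 i2 by simp
  finally show ?thesis by (simp add: pcf_J_def[of b] add.assoc algebra_simps)
qed

section \<open>The parabolic cylinder function\<close>

lemma norm_exp_minus_1_le:
  fixes w :: complex
  assumes "Re w \<ge> 0"
  shows "cmod (exp (- w) - 1) \<le> cmod w"
proof -
  have "cmod (exp (- w) - exp (- 0)) \<le> 1 * cmod (w - 0)"
  proof (rule field_differentiable_bound)
    show "convex {z. Re z \<ge> 0}" by (rule convex_halfspace_Re_ge)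
    show "((\<lambda>w. exp (- w)) has_field_derivative - exp (- z)) (at z within {z. Re z \<ge> 0})" for z
      by (auto intro!: derivative_eq_intros)
  qed (use assms in auto)
  then show ?thesis by simp
qed

text \<open>The cone is where Re (\<mu>^2) > 0, so that the Gaussian factor still decays along the
  rotated line.\<close>

lemma pcf_J_rotate:
  assumes b: "Re b > 0" and \<mu>: "\<bar>Im \<mu>\<bar> < Re \<mu>"
  shows "pcf_J b z = \<mu> powr b *
    (\<integral>s. mellin_weight b s * exp (- (\<mu> * of_real s)\<^sup>2 / 2 - z * (\<mu> * of_real s)) \<partial>lborel)"
proof -
  let ?\<Omega> = "{\<mu>. \<bar>Im \<mu>\<bar> < Re \<mu>}"
  have eq: "?\<Omega> = {\<mu>. Re \<mu> - Im \<mu> > 0} \<inter> {\<mu>. Re \<mu> + Im \<mu> > 0}" by auto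
  have "1 powr b * (\<integral>s. mellin_weight b s * exp (- (1 * of_real s)\<^sup>2 / 2 - z * (1 * of_real s)) \<partial>lborel)
    = \<mu> powr b * (\<integral>s. mellin_weight b s * exp (- (\<mu> * of_real s)\<^sup>2 / 2 - z * (\<mu> * of_real s)) \<partial>lborel)"
  proof (rule mellin_rotate[of b ?\<Omega> "\<lambda>w. exp (- w\<^sup>2 / 2 - z * w)" 1 \<mu>])
    show "open ?\<Omega>"
      by (intro open_Collect_less continuous_intros)
    show "convex ?\<Omega>"
    proof (rule convexI)
      fix x y and u v :: real assume xy: "x \<in> ?\<Omega>" "y \<in> ?\<Omega>" and uv: "0 \<le> u" "0 \<le> v" "u + v = 1"
      have "\<bar>u * Im x + v * Im y\<bar> \<le> u * \<bar>Im x\<bar> + v * \<bar>Im y\<bar>"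
        using uv by (intro order.trans[OF abs_triangle_ineq]) (auto simp: abs_mult)
      also have "\<dots> < u * Re x + v * Re y"
      proof (cases "u = 0")
        case True then show ?thesis using xy uv by simp
      next
        case False
        then show ?thesis using xy uv by (intro add_less_le_mono mult_strict_left_mono mult_left_mono) auto
      qed
      finally show "u *\<^sub>R x + v *\<^sub>R y \<in> ?\<Omega>" by simp
    qed
    show "?\<Omega> \<subseteq> - \<real>\<^sub>\<le>\<^sub>0" by (auto simp: complex_nonpos_Reals_iff)
    show "(\<lambda>w. exp (- w\<^sup>2 / 2 - z * w)) holomorphic_on UNIV" by (intro holomorphic_intros) auto
    show "\<exists>r>0. \<exists>c>0. \<exists>C. cball m r \<subseteq> ?\<Omega> \<and>
      (\<forall>\<nu>\<in>cball m r. \<forall>s>0. cmod (exp (- (\<nu> * of_real s)\<^sup>2 / 2 - z * (\<nu> * of_real s))) \<le> C * exp (- c * s))"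
      if m: "m \<in> ?\<Omega>" for m
    proof -
      \<comment> \<open>d measures the distance to the edge of the cone. On the disc of radius d/4
        both Re and |Im| move by at most d/4, so Re \<nu> - |Im \<nu>| >= d/2 and Re (\<nu>^2) >=
        d^2/4.\<close>
      define d where "d = Re m - \<bar>Im m\<bar>"
      have d: "d > 0" using m by (simp add: d_def)
      define M where "M = cmod z * (cmod m + d / 4)"
      have n: "Re \<nu> - \<bar>Im \<nu>\<bar> \<ge> d / 2" "cmod \<nu> \<le> cmod m + d / 4" if "\<nu> \<in> cball m (d / 4)" for \<nu>
      proof -
        have "cmod (m - \<nu>) \<le> d / 4" using that by (simp add: dist_norm)
        moreover have "\<bar>Re m - Re \<nu>\<bar> \<le> cmod (m - \<nu>)" "\<bar>Im m - Im \<nu>\<bar> \<le> cmod (m - \<nu>)"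
          using abs_Re_le_cmod[of "m - \<nu>"] abs_Im_le_cmod[of "m - \<nu>"] by simp_all
        moreover have "cmod \<nu> \<le> cmod m + cmod (m - \<nu>)"
          by (metis norm_minus_commute norm_triangle_sub)
        ultimately show "Re \<nu> - \<bar>Im \<nu>\<bar> \<ge> d / 2" "cmod \<nu> \<le> cmod m + d / 4"
          using d_def by linarith+
      qed
      have "cmod (exp (- (\<nu> * of_real s)\<^sup>2 / 2 - z * (\<nu> * of_real s))) \<le>
          exp ((M + 1)\<^sup>2 / (4 * (d\<^sup>2 / 8))) * exp (- 1 * s)"
        if \<nu>: "\<nu> \<in> cball m (d / 4)" and s: "s > 0" for \<nu> s
      proof -
        have "d / 2 * (d / 2) \<le> (Re \<nu> - \<bar>Im \<nu>\<bar>) * (Re \<nu> + \<bar>Im \<nu>\<bar>)"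
          using n(1)[OF \<nu>] d by (intro mult_mono) auto
        also have "\<dots> = Re (\<nu>\<^sup>2)" by (simp add: algebra_simps power2_eq_square)
        finally have "d\<^sup>2 / 4 * s\<^sup>2 \<le> Re (\<nu>\<^sup>2) * s\<^sup>2"
          by (intro mult_right_mono) (auto simp: power2_eq_square)
        moreover have "- Re (z * \<nu>) \<le> M"
          using abs_Re_le_cmod[of "z * \<nu>"] mult_left_mono[OF n(2)[OF \<nu>], of "cmod z"]
          by (simp add: M_def norm_mult)
        then have "- Re (z * \<nu>) * s \<le> M * s" using s by (intro mult_right_mono) auto
        ultimately have "- Re (\<nu>\<^sup>2) * s\<^sup>2 / 2 - Re (z * \<nu>) * s \<le> - (d\<^sup>2 / 8) * s\<^sup>2 + M * s"
          by linarith
        also have "\<dots> \<le> (M + 1)\<^sup>2 / (4 * (d\<^sup>2 / 8)) - s"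
          by (rule quadratic_exponent_bound) (use d in simp)
        also have "- Re (\<nu>\<^sup>2) * s\<^sup>2 / 2 - Re (z * \<nu>) * s = Re (- (\<nu> * of_real s)\<^sup>2 / 2 - z * (\<nu> * of_real s))"
          by (simp add: power2_eq_square field_simps)
        finally show ?thesis by (simp add: norm_exp_eq_Re flip: exp_add)
      qed
      moreover have "cball m (d / 4) \<subseteq> ?\<Omega>" using n(1) d by fastforce
      ultimately show ?thesis
        using d by (intro exI[of _ "d / 4"] conjI exI[of _ "1 :: real"] exI[of _ "exp ((M + 1)\<^sup>2 / (4 * (d\<^sup>2 / 8)))"])
          auto
    qed
  qed (use b \<mu> in auto)
  then show ?thesis by (simp add: pcf_J_def)
qed

lemma abs_sin_less_cos:
  assumes "\<bar>x\<bar> < pi / 4" shows "\<bar>sin x\<bar> < cos x"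
proof -
  have "cos (pi / 2 - \<bar>x\<bar>) < cos \<bar>x\<bar>"
    using assms by (intro cos_monotone_0_pi) (auto simp: field_simps)
  moreover have "cos (pi / 2 - \<bar>x\<bar>) = sin \<bar>x\<bar>" by (simp add: cos_diff)
  moreover have "sin \<bar>x\<bar> = \<bar>sin x\<bar>"
    using assms sin_ge_zero[of x] sin_ge_zero[of "-x"] pi_gt_zero
    by (cases "x \<ge> 0") auto
  ultimately show ?thesis by simp
qed

text \<open>With \<theta> = arg z the line is rotated by - \<theta>/3 and rescaled by 1/|z|. The
  Gaussian tolerates rotations below \<pi>/4, and exp (- l s), where l = z \<mu> has argument 2
  \<theta>/3, decays while that is below \<pi>/2; both limits are reached together at |\<theta>| = 3
  \<pi>/4. After rescaling the Gaussian differs from 1 by a term of order s^2 / |z|^2, and a Gamma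
  integral remains.\<close>

lemma pcf_J_asymptotics:
  assumes b: "Re b > 0" and \<delta>: "\<delta> > 0"
  shows "((\<lambda>z. z powr b * pcf_J b z) \<longlongrightarrow> Gamma b)
    (inf at_infinity (principal {z. \<bar>Arg z\<bar> \<le> 3 / 4 * pi - \<delta>}))"
proof -
  \<comment> \<open>\<kappa> = cos (\<pi>/2 - 2 \<delta>/3) is the lower bound of Re l and hence a
    guaranteed rate of decay. In \<open>K\<close> the exponential bounds \<open>l powr b\<close>,
    and the integral collects the deviation of the Gaussian from 1.\<close>
  define \<kappa> where "\<kappa> = sin (2 * \<delta> / 3)"
  define K where "K = exp (pi * \<bar>Im b\<bar>) *
    (\<integral>s. cmod (mellin_weight (b + 2) s * of_real (exp (- \<kappa> * s))) / 2 \<partial>lborel)"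
  have main: "cmod (z powr b * pcf_J b z - Gamma b) \<le> K * inverse (cmod z) ^ 2"
    if z: "z \<noteq> 0" "\<bar>Arg z\<bar> \<le> 3 / 4 * pi - \<delta>" for z
  proof -
    define L where "L = Ln z"
    have L: "exp L = z" "Im L = Arg z" "Re L = ln (cmod z)"
      using z by (auto simp: L_def Arg_eq_Im_Ln)
    define l where "l = exp (\<i> * of_real (2 / 3 * Im L))"
    define \<mu> where "\<mu> = exp (- of_real (Re L) - \<i> * of_real (Im L / 3))"
    have d: "\<delta> \<le> 3 / 4 * pi" using z(2) by linarith
    have \<kappa>: "\<kappa> > 0" unfolding \<kappa>_def using d \<delta> by (intro sin_gt_zero) (auto simp: field_simps)
    have Lnl: "Ln l = \<i> * of_real (2 / 3 * Im L)" unfolding l_def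
      using z L(2) \<delta> by (intro Ln_exp) (auto simp: field_simps abs_le_iff)
    have Ln\<mu>: "Ln \<mu> = - of_real (Re L) - \<i> * of_real (Im L / 3)" unfolding \<mu>_def
      using z L(2) \<delta> by (intro Ln_exp) (auto simp: field_simps abs_le_iff)
    \<comment> \<open>The arguments \<theta>, - \<theta>/3 and 2 \<theta>/3 all lie within the
      principal strip, so the logarithms add without a jump and the powers multiply.\<close>
    have sum: "L + Ln \<mu> = Ln l"
      unfolding Lnl Ln\<mu> by (simp add: complex_eq_iff)
    have l: "l = z * \<mu>"
    proof -
      have "z * \<mu> = exp (L + Ln \<mu>)" by (simp add: exp_add L(1)) (simp add: \<mu>_def)
      also have "\<dots> = l" unfolding sum by (simp add: l_def)
      finally show ?thesis ..
    qed
    have powr: "z powr b * \<mu> powr b = l powr b"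
      using z sum by (simp add: powr_def L_def \<mu>_def l_def flip: exp_add distrib_left)
    have Rel: "Re l \<ge> \<kappa>"
    proof -
      have "cos (pi / 2 - 2 * \<delta> / 3) \<le> cos \<bar>2 / 3 * Im L\<bar>"
        using z L(2) \<delta> d by (intro cos_monotone_0_pi_le) (auto simp: field_simps)
      moreover have "cos (pi / 2 - 2 * \<delta> / 3) = \<kappa>" by (simp add: cos_diff \<kappa>_def)
      moreover have "Re l = cos (2 / 3 * Im L)" unfolding l_def by (simp add: Re_exp)
      ultimately show ?thesis by (metis cos_abs_real)
    qed
    have nl: "cmod (l powr b) \<le> exp (pi * \<bar>Im b\<bar>)"
    proof -
      have "\<bar>2 / 3 * Im L\<bar> \<le> pi" using z L(2) \<delta> by (auto simp: abs_if)
      then have "\<bar>Im b * (2 / 3 * Im L)\<bar> \<le> \<bar>Im b\<bar> * pi" unfolding abs_mult by (intro mult_left_mono) (auto simp: abs_mult)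
      then have "- (Im b * (2 / 3 * Im L)) \<le> pi * \<bar>Im b\<bar>" by (simp add: abs_le_iff mult.commute)
      then show ?thesis unfolding powr_def Lnl by (simp add: l_def algebra_simps)
    qed
    have \<mu>cone: "\<bar>Im \<mu>\<bar> < Re \<mu>"
    proof -
      have "\<bar>sin (- Im L / 3)\<bar> < cos (- Im L / 3)"
        using z L(2) \<delta> by (intro abs_sin_less_cos) (auto simp: field_simps abs_if split: if_splits)
      then show ?thesis unfolding \<mu>_def by (simp add: Re_exp Im_exp abs_mult)
    qed
    have \<mu>sq: "Re (\<mu>\<^sup>2) \<ge> 0"
      using \<mu>cone by (simp add: Re_power2 power2_le_iff_abs_le flip: abs_le_square_iff)
    have cm: "cmod \<mu> = inverse (cmod z)"
      using z by (simp add: \<mu>_def L(3) exp_minus)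
    let ?A = "\<lambda>s. mellin_weight b s * exp (- (\<mu> * of_real s)\<^sup>2 / 2 - z * (\<mu> * of_real s))"
    let ?B = "\<lambda>s. mellin_weight b s * exp (- (l * of_real s))"
    have Bb: "cmod (exp (- (l * of_real s))) \<le> 1 * exp (- \<kappa> * s)" if "s > 0" for s
      using that Rel by (simp add: mult_right_mono)
    have Aeq: "exp (- (\<mu> * of_real s)\<^sup>2 / 2 - z * (\<mu> * of_real s)) =
        exp (- ((\<mu> * of_real s)\<^sup>2 / 2)) * exp (- (l * of_real s))" for s
      unfolding mult_exp_exp l by (rule arg_cong[where f = exp]) (simp add: algebra_simps)
    have Re0: "Re ((\<mu> * of_real s)\<^sup>2 / 2) \<ge> 0" for s
      using mult_nonneg_nonneg[OF \<mu>sq, of "s\<^sup>2"] by (simp add: power_mult_distrib flip: of_real_power)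
    have iA: "integrable lborel ?A"
    proof (rule mellin_integrable[OF b \<kappa>])
      show "cmod (exp (- (\<mu> * of_real s)\<^sup>2 / 2 - z * (\<mu> * of_real s))) \<le> 1 * exp (- \<kappa> * s)" if "s > 0" for s
        unfolding Aeq norm_mult
        using mult_mono[OF _ Bb[OF that], of "cmod (exp (- ((\<mu> * of_real s)\<^sup>2 / 2)))" 1] Re0[of s] by simp
    qed measurable
    have iB: "integrable lborel ?B"
      by (rule mellin_integrable[OF b \<kappa> _ Bb]) measurable
    have "cmod (?A s - ?B s) \<le> inverse (cmod z) ^ 2 * (cmod (mellin_weight (b + 2) s * of_real (exp (- \<kappa> * s))) / 2)" for s
    proof (cases "s > 0")
      case True
      have "?A s - ?B s = mellin_weight b s * (exp (- ((\<mu> * of_real s)\<^sup>2 / 2)) - 1) * exp (- (l * of_real s))"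
        unfolding Aeq by (simp add: algebra_simps)
      also have "cmod \<dots> \<le> cmod (mellin_weight b s) * cmod ((\<mu> * of_real s)\<^sup>2 / 2) * (1 * exp (- \<kappa> * s))"
        unfolding norm_mult[of "_ * _" "exp _"] norm_mult[of "mellin_weight b s"]
        by (intro mult_mono norm_exp_minus_1_le Re0 Bb True) auto
      also have "cmod ((\<mu> * of_real s)\<^sup>2 / 2) = inverse (cmod z) ^ 2 * (s\<^sup>2 / 2)"
        by (simp add: norm_mult norm_power norm_divide power_mult_distrib cm)
      also have "cmod (mellin_weight b s) * (inverse (cmod z) ^ 2 * (s\<^sup>2 / 2)) * (1 * exp (- \<kappa> * s)) =
          inverse (cmod z) ^ 2 * (cmod (mellin_weight (b + 2) s * of_real (exp (- \<kappa> * s))) / 2)"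
      proof -
        have "mellin_weight (b + 2) s = of_real s * (of_real s * mellin_weight b s)"
          using mellin_weight_Suc[of "b + 1" s] mellin_weight_Suc[of b s] by (simp add: add.assoc)
        then show ?thesis using True by (simp add: norm_mult power2_eq_square)
      qed
      finally show ?thesis .
    qed (simp add: mellin_weight_def)
    then have "cmod (\<integral>s. ?A s - ?B s \<partial>lborel) \<le> (\<integral>s. inverse (cmod z) ^ 2 *
        (cmod (mellin_weight (b + 2) s * of_real (exp (- \<kappa> * s))) / 2) \<partial>lborel)"
      using iA iB mellin_integrable_exp[of "b + 2" \<kappa>] b \<kappa>
      by (intro Bochner_Integration.integral_norm_bound_integral integrable_mult_right
          integrable_norm Bochner_Integration.integrable_diff) auto
    then have diff: "cmod ((\<integral>s. ?A s \<partial>lborel) - (\<integral>s. ?B s \<partial>lborel)) \<le> inverse (cmod z) ^ 2 *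
        (\<integral>s. cmod (mellin_weight (b + 2) s * of_real (exp (- \<kappa> * s))) / 2 \<partial>lborel)"
      using iA iB by simp
    have "z powr b * pcf_J b z = z powr b * \<mu> powr b * (\<integral>s. ?A s \<partial>lborel)"
      unfolding pcf_J_rotate[OF b \<mu>cone, of z] by (simp add: mult.assoc)
    moreover have "Gamma b = l powr b * (\<integral>s. ?B s \<partial>lborel)"
      using mellin_exp_rotate[OF b, of l] Rel \<kappa> by simp
    ultimately have "z powr b * pcf_J b z - Gamma b = l powr b * ((\<integral>s. ?A s \<partial>lborel) - (\<integral>s. ?B s \<partial>lborel))"
      unfolding powr by (simp add: algebra_simps)
    then have "cmod (z powr b * pcf_J b z - Gamma b) =
        cmod (l powr b) * cmod ((\<integral>s. ?A s \<partial>lborel) - (\<integral>s. ?B s \<partial>lborel))"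
      by (simp only: norm_mult)
    also have "\<dots> \<le> exp (pi * \<bar>Im b\<bar>) * (inverse (cmod z) ^ 2 *
        (\<integral>s. cmod (mellin_weight (b + 2) s * of_real (exp (- \<kappa> * s))) / 2 \<partial>lborel))"
      by (rule mult_mono[OF nl diff]) auto
    finally show ?thesis by (simp add: K_def mult_ac)
  qed
  have "((\<lambda>z :: complex. K * inverse (cmod z) ^ 2) \<longlongrightarrow> K * 0 ^ 2) at_infinity"
    by (intro tendsto_intros tendsto_inverse_0_at_top filterlim_norm_at_top)
  then have lim: "((\<lambda>z :: complex. K * inverse (cmod z) ^ 2) \<longlongrightarrow> 0)
      (inf at_infinity (principal {z. \<bar>Arg z\<bar> \<le> 3 / 4 * pi - \<delta>}))"
    by (auto intro: tendsto_mono[rotated])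
  have "\<forall>\<^sub>F z in inf at_infinity (principal {z. \<bar>Arg z\<bar> \<le> 3 / 4 * pi - \<delta>}).
      cmod (z powr b * pcf_J b z - Gamma b) \<le> K * inverse (cmod z) ^ 2"
    unfolding eventually_inf_principal
    by (rule eventually_mono[OF eventually_not_equal_at_infinity[of 0]]) (use main in auto)
  from Lim_null_comparison[OF this lim] show ?thesis
    by (rule LIM_zero_cancel)
qed

definition pcf_solution :: "complex \<Rightarrow> complex \<Rightarrow> complex" where
  "pcf_solution a z = exp (- z\<^sup>2 / 4) * pcf_J (a + 1 / 2) z / Gamma (a + 1 / 2)"

text \<open>The equation is \<open>pcf_J_recurrence\<close> in disguise. The asymptotic form is that
  of \<open>pcf_J\<close> divided by Gamma b, which is nonzero since Re b > 0.\<close>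

lemma is_parabolic_cylinder_pcf_solution:
  assumes a: "Re a > - 1 / 2"
  shows "is_parabolic_cylinder_U a (pcf_solution a)"
proof -
  define b where "b = a + 1 / 2"
  have b0: "Re b > 0" using a by (simp add: b_def)
  then have b: "Re b > 0" "Re (b + 1) > 0" "Gamma b \<noteq> 0" "a = b - 1 / 2"
    by (auto simp: Gamma_eq_zero_iff elim!: nonpos_Ints_cases) (simp add: b_def)
  note J = has_field_derivative_pcf_J(1)[OF b(1)] has_field_derivative_pcf_J(1)[OF b(2)]
  define y1 where "y1 z = exp (- z\<^sup>2 / 4) * (- z / 2 * pcf_J b z - pcf_J (b + 1) z) / Gamma b" for z
  have ex: "((\<lambda>z. exp (- z\<^sup>2 / 4)) has_field_derivative - z / 2 * exp (- z\<^sup>2 / 4)) (at z)" for z :: complex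
    by (auto intro!: derivative_eq_intros)
  have d1: "(pcf_solution a has_field_derivative y1 z) (at z)" for z
    unfolding pcf_solution_def[abs_def] b_def[symmetric] y1_def
    by (rule DERIV_cong[OF DERIV_cdivide[OF DERIV_mult[OF ex J(1)]]]) (simp add: algebra_simps)
  have d2: "(y1 has_field_derivative (z\<^sup>2 / 4 + a) * pcf_solution a z) (at z)" for z
  proof -
    have lin: "((\<lambda>z. - z / 2) has_field_derivative - 1 / 2) (at z)" for z :: complex
      by (auto intro!: derivative_eq_intros)
    have r: "pcf_J (b + 1 + 1) z = b * pcf_J b z - z * pcf_J (b + 1) z"
      using pcf_J_recurrence[OF b(1), of z] by (simp add: add.assoc algebra_simps)
    show ?thesis
      unfolding y1_def[abs_def] pcf_solution_def b_def[symmetric]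
      by (rule DERIV_cong[OF DERIV_cdivide[OF DERIV_mult[OF ex DERIV_diff[OF DERIV_mult[OF lin J(1)] J(2)]]]])
        (unfold r, simp add: b(3,4) field_simps power2_eq_square)
  qed
  have deriv: "deriv (pcf_solution a) = y1" "deriv y1 = (\<lambda>z. (z\<^sup>2 / 4 + a) * pcf_solution a z)"
    using d1 d2 by (auto intro!: DERIV_imp_deriv)
  have "pcf_solution a \<sim>[inf at_infinity (principal {z. \<bar>Arg z\<bar> \<le> 3 / 4 * pi - \<delta>})]
        (\<lambda>z. z powr (- a - 1 / 2) * exp (- (z\<^sup>2) / 4))" if \<delta>: "\<delta> > 0" for \<delta>
  proof -
    let ?F = "inf at_infinity (principal {z :: complex. \<bar>Arg z\<bar> \<le> 3 / 4 * pi - \<delta>})"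
    have "((\<lambda>z. z powr b * pcf_J b z / Gamma b) \<longlongrightarrow> Gamma b / Gamma b) ?F"
      by (intro tendsto_divide pcf_J_asymptotics b \<delta> tendsto_const)
    then have lim: "((\<lambda>z. z powr b * pcf_J b z / Gamma b) \<longlongrightarrow> 1) ?F" using b by simp
    have "\<forall>\<^sub>F z in ?F. z \<noteq> 0"
      by (rule filter_leD[OF inf_le1]) (rule eventually_not_equal_at_infinity)
    then have ev: "\<forall>\<^sub>F z in ?F. z powr b * pcf_J b z / Gamma b =
        pcf_solution a z / (z powr (- a - 1 / 2) * exp (- (z\<^sup>2) / 4))"
    proof eventually_elim
      case (elim z)
      have mb: "- a - 1 / 2 = - b" by (simp add: b_def)
      show ?case using elim unfolding pcf_solution_def b_def[symmetric] mb
        by (simp add: powr_minus field_simps)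
    qed
    have "((\<lambda>z. pcf_solution a z / (z powr (- a - 1 / 2) * exp (- (z\<^sup>2) / 4))) \<longlongrightarrow> 1) ?F"
      by (rule Lim_transform_eventually[OF lim ev])
    then show ?thesis
      by (rule asymp_equivI')
  qed
  moreover have "pcf_solution a holomorphic_on UNIV"
    using d1 by (auto simp: holomorphic_on_def field_differentiable_def)
  ultimately show ?thesis
    unfolding is_parabolic_cylinder_U_def by (simp add: numeral_2_eq_2 deriv)
qed

text \<open>The description of U is silent about its derivative. On the disc of radius 1/x about x
  the quantity w^2 moves by a bounded amount, so Cauchy's inequality transfers the decay to the
  derivative.\<close>

lemma parabolic_cylinder_decay:
  assumes "is_parabolic_cylinder_U a y"
  shows "\<exists>K k. k \<ge> 0 \<and> (\<forall>\<^sub>F x in at_top.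
     cmod (y (of_real x)) \<le> K * (x powr k * exp (- x\<^sup>2 / 4)) \<and>
     cmod (deriv y (of_real x)) \<le> K * (x powr k * exp (- x\<^sup>2 / 4)))"
proof -
  define b where "b = a + 1 / 2"
  let ?f = "\<lambda>z. z powr (- a - 1 / 2) * exp (- (z\<^sup>2) / 4)"
  let ?F = "inf at_infinity (principal {z. \<bar>Arg z\<bar> \<le> 3 / 4 * pi - pi / 4})"
  have y: "y holomorphic_on UNIV" "y \<sim>[?F] ?f"
    using assms unfolding is_parabolic_cylinder_U_def by (auto dest!: spec[of _ "pi / 4"])
  have "\<forall>\<^sub>F z in ?F. cmod (y z) \<le> 2 * cmod (?f z)"
  proof -
    have "((\<lambda>z. if y z = 0 \<and> ?f z = 0 then 1 else y z / ?f z) \<longlongrightarrow> 1) ?F"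
      using y(2) unfolding asymp_equiv_def .
    then have "\<forall>\<^sub>F z in ?F. dist (if y z = 0 \<and> ?f z = 0 then 1 else y z / ?f z) 1 < 1"
      by (rule tendstoD) simp
    then show ?thesis
    proof eventually_elim
      case (elim z)
      show ?case
      proof (cases "?f z = 0")
        case True
        then show ?thesis using elim by (auto split: if_splits)
      next
        case False
        then have "cmod (y z / ?f z - 1) < 1" using elim by (auto simp: dist_norm)
        then have "cmod (y z / ?f z) < 2"
          using norm_triangle_ineq2[of "y z / ?f z" 1] by simp
        then show ?thesis using False by (simp add: norm_divide divide_less_eq split: if_splits)
      qed
    qed
  qed
  then obtain R where R: "\<And>z. R \<le> cmod z \<Longrightarrow> \<bar>Arg z\<bar> \<le> pi / 2 \<Longrightarrow> cmod (y z) \<le> 2 * cmod (?f z)"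
    unfolding eventually_inf_principal eventually_at_infinity by (auto simp: field_simps)
  \<comment> \<open>The 2 comes from the asymptotic equivalence, the next two factors from |Ln w| <=
    ln (2 x) + \<pi>, and exp (3/4) from Re (w^2) >= x^2 - 3.\<close>
  define K where "K = 2 * (exp (pi * cmod b) * 2 powr cmod b * exp (3 / 4))"
  have near: "cmod (y w) \<le> K * (x powr cmod b * exp (- x\<^sup>2 / 4))"
    if x: "x \<ge> max 2 (R + 1)" and w: "w \<in> cball (of_real x) (1 / x)" for x w
  proof -
    have x0: "x \<ge> 2" "x > 0" using x by auto
    have d: "cmod (of_real x - w) \<le> 1 / x" using w by (simp add: dist_norm)
    have x1: "1 / x \<le> 1 / 2" using x0 by (simp add: field_simps)
    have re: "\<bar>x - Re w\<bar> \<le> 1 / x" "\<bar>Im w\<bar> \<le> 1 / x"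
      using d abs_Re_le_cmod[of "of_real x - w"] abs_Im_le_cmod[of "of_real x - w"] by auto
    have "cmod w - x \<le> 1 / x" and cw2: "x - cmod w \<le> 1 / x"
      using d x0 norm_triangle_ineq2[of w "of_real x"] norm_triangle_ineq2[of "of_real x" w]
      by (simp_all add: norm_minus_commute)
    then have cw: "cmod w \<le> 2 * x" "cmod w \<ge> x - 1 / x"
      using x0 x1 by linarith+
    have Rew: "Re w > 0" using re x0 x1 by linarith
    have w1: "cmod w \<ge> 1" "cmod w \<ge> R" using cw(2) x x0 x1 by linarith+
    have wn: "w \<noteq> 0" using Rew by auto
    have Arg: "\<bar>Arg w\<bar> \<le> pi / 2" using Rew Arg_Re_pos[of w] by auto
    have p: "cmod (w powr (- b)) \<le> exp (pi * cmod b) * 2 powr cmod b * x powr cmod b"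
    proof -
      have "Re (- b * Ln w) \<le> cmod b * cmod (Ln w)"
        by (metis complex_Re_le_cmod norm_minus_cancel norm_mult)
      also have "cmod (Ln w) \<le> ln (2 * x) + pi"
      proof -
        have "cmod (Ln w) \<le> \<bar>Re (Ln w)\<bar> + \<bar>Im (Ln w)\<bar>" by (rule cmod_le)
        also have "\<bar>Im (Ln w)\<bar> \<le> pi" using Arg wn pi_gt_zero by (simp add: Arg_eq_Im_Ln)
        also have "\<bar>Re (Ln w)\<bar> = ln (cmod w)" using w1 wn by simp
        also have "ln (cmod w) \<le> ln (2 * x)" by (rule ln_mono) (use cw(1) wn in auto)
        finally show ?thesis by simp
      qed
      then have "cmod b * cmod (Ln w) \<le> cmod b * (ln (2 * x) + pi)" by (intro mult_left_mono) auto
      finally have "cmod (w powr (- b)) \<le> exp (cmod b * (ln (2 * x) + pi))"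
        using wn by (simp add: powr_def norm_exp_eq_Re)
      also have "\<dots> = exp (pi * cmod b) * (2 * x) powr cmod b"
        using x0 by (simp add: powr_def ring_distribs exp_add mult_ac)
      finally show ?thesis using x0 by (simp add: powr_mult mult_ac)
    qed
    have e: "cmod (exp (- (w\<^sup>2) / 4)) \<le> exp (3 / 4) * exp (- x\<^sup>2 / 4)"
    proof -
      have 1: "x\<^sup>2 - 2 \<le> (Re w)\<^sup>2"
      proof -
        have "(x - 1 / x)\<^sup>2 \<le> (Re w)\<^sup>2"
          by (rule power_mono) (use re x1 x0 in linarith)+
        moreover have "(x - 1 / x)\<^sup>2 = x\<^sup>2 - 2 + (1 / x)\<^sup>2"
          using x0 by (simp add: power2_eq_square field_simps)
        ultimately show ?thesis by (smt (verit) zero_le_power2)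
      qed
      have 2: "(Im w)\<^sup>2 \<le> 1"
        using re(2) x1 by (simp add: abs_square_le_1)
      have "x\<^sup>2 - 3 \<le> Re (w\<^sup>2)" using 1 2 by (simp add: Re_power2)
      then show ?thesis by (simp add: norm_exp_eq_Re flip: exp_add)
    qed
    have mb: "- a - 1 / 2 = - b" by (simp add: b_def)
    have "cmod (y w) \<le> 2 * (cmod (w powr (- b)) * cmod (exp (- (w\<^sup>2) / 4)))"
      using R[OF w1(2) Arg] unfolding mb norm_mult by simp
    also have "\<dots> \<le> 2 * ((exp (pi * cmod b) * 2 powr cmod b * x powr cmod b) * (exp (3 / 4) * exp (- x\<^sup>2 / 4)))"
      by (intro mult_left_mono mult_mono p e) auto
    finally show ?thesis by (simp add: K_def mult_ac)
  qed
  have "cmod (y (of_real x)) \<le> K * (x powr (cmod b + 1) * exp (- x\<^sup>2 / 4)) \<and>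
     cmod (deriv y (of_real x)) \<le> K * (x powr (cmod b + 1) * exp (- x\<^sup>2 / 4))"
    if x: "x \<ge> max 2 (R + 1)" for x
  proof
    have x0: "x \<ge> 2" using x by simp
    have K0: "K \<ge> 0" by (simp add: K_def)
    have "cmod (y (of_real x)) \<le> K * (x powr cmod b * exp (- x\<^sup>2 / 4))"
      using near[OF x] x0 by simp
    also have "\<dots> \<le> K * (x powr (cmod b + 1) * exp (- x\<^sup>2 / 4))"
      using x0 K0 by (intro mult_left_mono mult_right_mono powr_mono) auto
    finally show "cmod (y (of_real x)) \<le> K * (x powr (cmod b + 1) * exp (- x\<^sup>2 / 4))" .
    \<comment> \<open>The radius 1/x costs a factor x, whence the exponent
      \<open>cmod b + 1\<close>.\<close>
    have "cmod ((deriv ^^ 1) y (of_real x)) \<le> fact 1 * (K * (x powr cmod b * exp (- x\<^sup>2 / 4))) / (1 / x) ^ 1"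
      by (rule Cauchy_inequality)
        (use x0 near[OF x] y(1) in \<open>auto intro: holomorphic_on_subset
          intro!: holomorphic_on_imp_continuous_on simp: dist_norm\<close>)
    also have "\<dots> = K * (x powr (cmod b + 1) * exp (- x\<^sup>2 / 4))"
      using x0 by (simp add: powr_add mult_ac)
    finally show "cmod (deriv y (of_real x)) \<le> K * (x powr (cmod b + 1) * exp (- x\<^sup>2 / 4))" by simp
  qed
  then show ?thesis
    by (intro exI[of _ K] exI[of _ "cmod b + 1"] conjI)
      (auto intro!: eventually_mono[OF eventually_ge_at_top[of "max 2 (R + 1)"]])
qed

text \<open>Once the Wronskian vanishes, y / w is constant where w has no zeros. The common
  asymptotic form keeps w free of zeros far to the right and makes the constant 1; the identity
  theorem does the rest.\<close>

lemma is_parabolic_cylinder_U_unique: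
  assumes y: "is_parabolic_cylinder_U a y" and w: "is_parabolic_cylinder_U a w"
  shows "y = w"
proof -
  have hol: "y holomorphic_on UNIV" "w holomorphic_on UNIV"
    using y w by (auto simp: is_parabolic_cylinder_U_def)
  note hol' = hol[THEN holomorphic_deriv, OF open_UNIV]
  have d: "(y has_field_derivative deriv y z) (at z)" "(w has_field_derivative deriv w z) (at z)" for z
    by (rule holomorphic_derivI[OF hol(1)] holomorphic_derivI[OF hol(2)]; simp)+
  have d2: "(deriv y has_field_derivative (z\<^sup>2 / 4 + a) * y z) (at z)"
    "(deriv w has_field_derivative (z\<^sup>2 / 4 + a) * w z) (at z)" for z
  proof -
    have "deriv (deriv y) z = (z\<^sup>2 / 4 + a) * y z" "deriv (deriv w) z = (z\<^sup>2 / 4 + a) * w z"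
      using y w by (simp_all add: is_parabolic_cylinder_U_def numeral_2_eq_2)
    then show "(deriv y has_field_derivative (z\<^sup>2 / 4 + a) * y z) (at z)"
      "(deriv w has_field_derivative (z\<^sup>2 / 4 + a) * w z) (at z)"
      using holomorphic_derivI[OF hol'(1) open_UNIV, of z] holomorphic_derivI[OF hol'(2) open_UNIV, of z] by simp_all
  qed
  define W where "W z = y z * deriv w z - deriv y z * w z" for z
  have "(W has_field_derivative 0) (at z)" for z
    unfolding W_def[abs_def]
    by (rule DERIV_cong[OF DERIV_diff[OF DERIV_mult[OF d(1) d2(2)] DERIV_mult[OF d2(1) d(2)]]])
      (simp add: algebra_simps)
  then obtain c where c: "\<And>z. W z = c"
    using has_field_derivative_zero_constant[of UNIV W] by auto
  obtain K k where K: "\<forall>\<^sub>F x in at_top. cmod (y (of_real x)) \<le> K * (x powr k * exp (- x\<^sup>2 / 4)) \<and>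
     cmod (deriv y (of_real x)) \<le> K * (x powr k * exp (- x\<^sup>2 / 4))" "k \<ge> 0"
    using parabolic_cylinder_decay[OF y] by blast
  obtain K' k' where K': "\<forall>\<^sub>F x in at_top. cmod (w (of_real x)) \<le> K' * (x powr k' * exp (- x\<^sup>2 / 4)) \<and>
     cmod (deriv w (of_real x)) \<le> K' * (x powr k' * exp (- x\<^sup>2 / 4))" "k' \<ge> 0"
    using parabolic_cylinder_decay[OF w] by blast
  have "\<forall>\<^sub>F x in at_top. cmod c \<le> 2 * (K * (x powr k * exp (- x\<^sup>2 / 4)) * (K' * (x powr k' * exp (- x\<^sup>2 / 4))))"
    using K(1) K'(1)
  proof eventually_elim
    case (elim x)
    have "cmod c \<le> cmod (y x) * cmod (deriv w x) + cmod (deriv y x) * cmod (w x)"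
      unfolding c[of "of_real x", symmetric] W_def norm_mult[symmetric] by (rule norm_triangle_ineq4)
    also have "\<dots> \<le> (K * (x powr k * exp (- x\<^sup>2 / 4)) * (K' * (x powr k' * exp (- x\<^sup>2 / 4)))) +
       (K * (x powr k * exp (- x\<^sup>2 / 4)) * (K' * (x powr k' * exp (- x\<^sup>2 / 4))))"
      using elim by (intro add_mono mult_mono) (auto intro: order.trans[OF norm_ge_zero])
    finally show ?case by (simp only: mult_2)
  qed
  moreover have "((\<lambda>x. 2 * (K * (x powr k * exp (- x\<^sup>2 / 4)) * (K' * (x powr k' * exp (- x\<^sup>2 / 4))))) \<longlongrightarrow> 0) at_top"
    using K(2) K'(2) by real_asymp
  ultimately have "cmod c \<le> 0"
    by (intro tendsto_lowerbound[of _ 0 at_top]) auto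
  then have W0: "y z * deriv w z = deriv y z * w z" for z
    using c[of z] by (simp add: W_def)
  let ?f = "\<lambda>z. z powr (- a - 1 / 2) * exp (- (z\<^sup>2) / 4)"
  let ?F = "inf at_infinity (principal {z. \<bar>Arg z\<bar> \<le> 3 / 4 * pi - pi / 4})"
  have eq: "y \<sim>[?F] ?f" "w \<sim>[?F] ?f"
    using y w unfolding is_parabolic_cylinder_U_def by (auto dest!: spec[of _ "pi / 4"])
  have "\<forall>\<^sub>F z in ?F. z \<noteq> 0"
    by (rule filter_leD[OF inf_le1]) (rule eventually_not_equal_at_infinity)
  then have fnz: "\<forall>\<^sub>F z in ?F. ?f z \<noteq> 0" by eventually_elim auto
  have "\<forall>\<^sub>F z in ?F. w z \<noteq> 0"
    using asymp_equiv_eventually_zeros[OF eq(2)] fnz by eventually_elim auto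
  then obtain R where R: "\<And>z. R \<le> cmod z \<Longrightarrow> \<bar>Arg z\<bar> \<le> pi / 2 \<Longrightarrow> w z \<noteq> 0"
    unfolding eventually_inf_principal eventually_at_infinity by (auto simp: field_simps)
  \<comment> \<open>For Re z > 0 the argument is below \<pi>/2, so this half plane lies in the
    zero-free part of the sector; being convex, it admits only one constant.\<close>
  define H where "H = {z. Re z > max R 0}"
  have wH: "w z \<noteq> 0" if "z \<in> H" for z
    using that complex_Re_le_cmod[of z] Arg_Re_pos[of z] by (intro R) (auto simp: H_def)
  have "\<exists>k. \<forall>z\<in>H. y z / w z = k"
  proof (rule has_field_derivative_zero_constant)
    show "convex H" unfolding H_def by (rule convex_halfspace_Re_gt)
    show "((\<lambda>z. y z / w z) has_field_derivative 0) (at z within H)" if "z \<in> H" for z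
      by (rule has_field_derivative_at_within, rule DERIV_cong[OF DERIV_divide[OF d(1) d(2) wH[OF that]]])
        (use W0[of z] in \<open>simp add: mult.commute\<close>)
  qed
  then obtain k where k: "\<And>z. z \<in> H \<Longrightarrow> y z / w z = k" by blast
  have lim: "((\<lambda>z. y z / w z) \<longlongrightarrow> 1) ?F"
  proof (rule asymp_equivD_strong)
    show "y \<sim>[?F] w" using eq by (rule asymp_equiv_trans[OF _ asymp_equiv_symI])
    show "\<forall>\<^sub>F z in ?F. y z \<noteq> 0 \<or> w z \<noteq> 0"
      using \<open>\<forall>\<^sub>F z in ?F. w z \<noteq> 0\<close> by eventually_elim simp
  qed
  have "filterlim (\<lambda>x. of_real x :: complex) ?F at_top"
    unfolding filterlim_inf filterlim_principal
  proof
    show "filterlim (\<lambda>x. of_real x :: complex) at_infinity at_top"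
      by (rule filterlim_of_real_at_infinity)
    show "\<forall>\<^sub>F x in at_top. complex_of_real x \<in> {z. \<bar>Arg z\<bar> \<le> 3 / 4 * pi - pi / 4}"
      by (rule eventually_mono[OF eventually_gt_at_top[of 0]]) (auto simp: Arg_of_real)
  qed
  from filterlim_compose[OF lim this]
  have "((\<lambda>x. y (of_real x) / w (of_real x)) \<longlongrightarrow> 1) at_top" .
  moreover have "((\<lambda>x. y (of_real x) / w (of_real x)) \<longlongrightarrow> k) at_top"
    by (rule tendsto_eventually, rule eventually_mono[OF eventually_gt_at_top[of "max R 0"]])
      (auto intro!: k simp: H_def)
  ultimately have "k = 1"
    by (intro tendsto_unique[OF trivial_limit_at_top_linorder])
  then have eqH: "y z = w z" if "z \<in> H" for z
    using k[OF that] wH[OF that] by simp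
  show ?thesis
  proof
    fix z
    have "open H" unfolding H_def by (rule open_halfspace_Re_gt)
    moreover have "of_real (max R 0 + 1) \<in> H" by (auto simp: H_def max_def)
    ultimately show "y z = w z"
      using analytic_continuation_open[OF _ open_UNIV _ connected_UNIV subset_UNIV hol eqH UNIV_I, of H z]
      by blast
  qed
qed

lemma is_parabolic_cylinder_parabolic_cylinder_U:
  assumes "Re a > - 1 / 2"
  shows "is_parabolic_cylinder_U a (parabolic_cylinder_U a)"
  unfolding parabolic_cylinder_U_def
  by (rule theI'[of "is_parabolic_cylinder_U a"])
    (use is_parabolic_cylinder_pcf_solution[OF assms] is_parabolic_cylinder_U_unique in blast)

section \<open>Behaviour at infinity\<close>

text \<open>Up to a positive factor, \<open>z * LG_rot e\<close> is the argument of \<open>U\<close> in \<open>W\<^sub>j\<close>, so the direction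
  \<open>exp (\<i>e\<pi>/4)\<close> of recession becomes the positive real axis.\<close>

definition LG_rot :: "real \<Rightarrow> complex" where
  "LG_rot e = exp (- of_real (e * pi / 4) * \<i>)"

text \<open>Apart from 0, the points within angle arccos k of the direction of recession; a larger k
  means a narrower sector. For k = 4/5 > 1 / sqrt 2 the half-angle is below \<pi>/4, which keeps the
  sector in the right half plane.\<close>

definition LG_sector :: "real \<Rightarrow> real \<Rightarrow> complex set" where
  "LG_sector e k = {z. k * cmod z \<le> Re (z * LG_rot e)}"

definition LG_at :: "real \<Rightarrow> real \<Rightarrow> complex filter" where
  "LG_at e k = inf at_infinity (principal (LG_sector e k))"

lemma norm_LG_rot [simp]: "cmod (LG_rot e) = 1"
  by (simp add: LG_rot_def norm_exp_eq_Re)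

lemma eventually_LG_at:
  "eventually P (LG_at e k) \<longleftrightarrow> (\<exists>R. \<forall>z\<in>LG_sector e k. R \<le> cmod z \<longrightarrow> P z)"
  unfolding LG_at_def eventually_inf_principal eventually_at_infinity by blast

lemma LG_at_mono: "k \<le> k' \<Longrightarrow> LG_at e k' \<le> LG_at e k"
  unfolding LG_at_def LG_sector_def
  by (intro inf_mono) (auto intro: order.trans[OF mult_right_mono])

lemma LG_rot_expand:
  assumes "e \<in> {1, -1}"
  shows "LG_rot e = (1 - of_real e * \<i>) / of_real (sqrt 2)"
proof -
  have s: "1 / sqrt 2 = sqrt 2 / 2" by (simp add: field_simps)
  show ?thesis
    using assms by (auto simp: LG_rot_def complex_eq_iff Re_exp Im_exp cos_45 sin_45 s)
qed

lemma LG_rot_sq: "e \<in> {1, -1} \<Longrightarrow> (LG_rot e)\<^sup>2 = - \<i> * of_real e"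
  by (auto simp: LG_rot_expand power_divide power2_eq_square complex_eq_iff)

lemma LG_sector_Re_pos:
  assumes e: "e \<in> {1, -1}" and z: "z \<in> LG_sector e (4 / 5)" "z \<noteq> 0"
  shows "Re z > 0" "Re (z * LG_rot e) > 0"
proof -
  define w where "w = z * LG_rot e"
  have cw: "cmod w = cmod z" by (simp add: w_def norm_mult)
  have pos: "0 < cmod w" using z by (simp add: cw)
  have Rw: "4 / 5 * cmod w \<le> Re w" using z by (simp add: LG_sector_def w_def cw[unfolded w_def])
  then have Rw0: "Re w > 0" using pos by linarith
  then show "Re (z * LG_rot e) > 0" by (simp only: w_def)
  have sq: "(cmod w)\<^sup>2 = (Re w)\<^sup>2 + (Im w)\<^sup>2" by (rule cmod_power2)
  have "(4 / 5 * cmod w)\<^sup>2 \<le> (Re w)\<^sup>2" using Rw pos by (intro power_mono) auto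
  then have "16 / 25 * ((Re w)\<^sup>2 + (Im w)\<^sup>2) \<le> (Re w)\<^sup>2"
    by (simp add: power_mult_distrib power_divide sq)
  moreover have "(Re w)\<^sup>2 > 0" using Rw0 by simp
  ultimately have "(Im w)\<^sup>2 < (Re w)\<^sup>2" unfolding distrib_left using zero_le_power2[of "Im w"] by linarith
  then have "\<bar>Im w\<bar> < \<bar>Re w\<bar>" by (metis abs_le_square_iff not_le)
  then have *: "\<bar>Im w\<bar> < Re w" using Rw pos by linarith
  have inv: "LG_rot e * ((1 + of_real e * \<i>) / of_real (sqrt 2)) = 1"
    using e unfolding LG_rot_expand[OF e]
    by (auto simp: complex_eq_iff field_simps real_div_sqrt)
  have "z = w * ((1 + of_real e * \<i>) / of_real (sqrt 2))"
    unfolding w_def mult.assoc inv by simp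
  then have "Re z = (Re w - e * Im w) / sqrt 2"
    by (simp add: complex_eq_iff diff_divide_distrib)
  moreover have "Re w - e * Im w > 0" using * e by auto
  ultimately show "Re z > 0" by simp
qed

section \<open>Asymptotics of the Liouville-Green variables\<close>

lemma filterlim_LG_at_infinity: "filterlim (\<lambda>z. z) at_infinity (LG_at e k)"
  unfolding LG_at_def by (rule filterlim_mono[OF filterlim_ident order_refl inf_le1])

lemma eventually_LG_at_Re_pos:
  assumes e: "e \<in> {1, -1}"
  shows "\<forall>\<^sub>F z in LG_at e (4 / 5). 0 < Re z \<and> 0 < Re (z * LG_rot e)"
  unfolding eventually_LG_at
proof (intro exI[of _ 1] ballI impI conjI)
  fix z assume z: "z \<in> LG_sector e (4 / 5)" "1 \<le> cmod z"
  then have "z \<noteq> 0" by auto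
  from LG_sector_Re_pos[OF e z(1) this] show "0 < Re z" "0 < Re (z * LG_rot e)" .
qed

text \<open>With v the root on the right, z v squares to z^2 + 1, so only the sign of Re (z v) is in
  question. Multiplied by Re v, it becomes an expression in Re v Im v = Im (v^2) / 2, which has the
  opposite sign of Re z Im z.\<close>

lemma csqrt_factor:
  assumes z: "Re z > 0"
  shows "csqrt (z\<^sup>2 + 1) = z * csqrt (1 + 1 / z\<^sup>2)" and "Re (csqrt (1 + 1 / z\<^sup>2)) > 0"
proof -
  have nz: "z \<noteq> 0" using z by auto
  define v where "v = csqrt (1 + 1 / z\<^sup>2)"
  define D where "D = (Re (z\<^sup>2))\<^sup>2 + (Im (z\<^sup>2))\<^sup>2"
  have v: "v\<^sup>2 = 1 + 1 / z\<^sup>2" by (simp add: v_def)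
  have D: "D > 0" using nz unfolding D_def
    by (metis complex_neq_0 power_not_zero)
  have "Im (v\<^sup>2) = - Im (z\<^sup>2) / D"
    unfolding v by (simp add: Im_divide D_def)
  then have im: "Re v * Im v = - (Re z * Im z) / D" by (simp add: Im_power2)
  have v0: "Re v \<noteq> 0"
  proof
    assume r: "Re v = 0"
    then have "Im z = 0" using im D z by simp
    then have "1 + 1 / z\<^sup>2 = of_real (1 + 1 / (Re z)\<^sup>2)" by (simp add: complex_eq_iff Re_divide Im_divide)
    then have "Re (v\<^sup>2) = 1 + 1 / (Re z)\<^sup>2" unfolding v by simp
    then have "- (Im v)\<^sup>2 = 1 + 1 / (Re z)\<^sup>2" using r by (simp add: Re_power2)
    moreover have "1 / (Re z)\<^sup>2 \<ge> 0" by simp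
    ultimately show False by (smt (verit) zero_le_power2)
  qed
  then show rv: "Re (csqrt (1 + 1 / z\<^sup>2)) > 0"
    using Re_csqrt[of "1 + 1 / z\<^sup>2"] by (simp add: v_def)
  then have Rv: "Re v > 0" by (simp add: v_def)
  have "Re v * Re (z * v) = Re z * (Re v)\<^sup>2 - Im z * (Re v * Im v)"
    by (simp add: algebra_simps power2_eq_square)
  also have "\<dots> = Re z * ((Re v)\<^sup>2 + (Im z)\<^sup>2 / D)"
    unfolding im by (simp add: algebra_simps power2_eq_square)
  also have "\<dots> > 0"
    using z Rv D by (intro mult_pos_pos add_pos_nonneg) auto
  finally have "Re (z * v) > 0" using Rv by (simp add: zero_less_mult_iff)
  moreover have "(z * v)\<^sup>2 = z\<^sup>2 + 1" using v nz by (simp add: power_mult_distrib field_simps)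
  ultimately show "csqrt (z\<^sup>2 + 1) = z * csqrt (1 + 1 / z\<^sup>2)"
    unfolding v_def by (intro csqrt_unique) auto
qed

lemma tendsto_csqrt_factor: "((\<lambda>z. csqrt (1 + 1 / z\<^sup>2)) \<longlongrightarrow> 1) (LG_at e k)"
proof -
  have "((\<lambda>z :: complex. 1 / z\<^sup>2) \<longlongrightarrow> 0) at_infinity"
    by (intro tendsto_divide_0[OF tendsto_const] filterlim_power_at_infinity filterlim_ident) auto
  then have "((\<lambda>z :: complex. 1 + 1 / z\<^sup>2) \<longlongrightarrow> 1 + 0) (LG_at e k)"
    unfolding LG_at_def by (intro tendsto_add tendsto_const) (auto intro: tendsto_mono[rotated])
  then have "((\<lambda>z :: complex. csqrt (1 + 1 / z\<^sup>2)) \<longlongrightarrow> csqrt (1 + 0)) (LG_at e k)"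
    by (rule isCont_tendsto_compose[OF continuous_at_csqrt, rotated]) simp
  then show ?thesis by simp
qed

lemma tendsto_beta_bar:
  assumes e: "e \<in> {1, -1}"
  shows "(beta_bar \<longlongrightarrow> 1) (LG_at e (4 / 5))"
proof (rule Lim_transform_eventually)
  show "((\<lambda>z. 1 / csqrt (1 + 1 / z\<^sup>2)) \<longlongrightarrow> 1) (LG_at e (4 / 5))"
    using tendsto_divide[OF tendsto_const tendsto_csqrt_factor, of 1] by simp
  show "\<forall>\<^sub>F z in LG_at e (4 / 5). 1 / csqrt (1 + 1 / z\<^sup>2) = beta_bar z"
    using eventually_LG_at_Re_pos[OF e]
    by eventually_elim (auto simp: beta_bar_def csqrt_factor(1))
qed

text \<open>Writing the root as z v with v tending to 1, z^2 (v - 1) = 1 / (v + 1) produces 1/4 and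
  Ln (1 + v) produces the logarithm of 2. Together with the scale factor sqrt (2 u) this constant is
  the origin of ln (2 e / u) in the phase, e being Euler's number there.\<close>

lemma tendsto_xi_bar:
  assumes e: "e \<in> {1, -1}"
  shows "((\<lambda>z. xi_bar z - z\<^sup>2 / 2 - Ln z / 2) \<longlongrightarrow> of_real (1 / 4 + ln 2 / 2)) (LG_at e (4 / 5))"
proof (rule Lim_transform_eventually)
  let ?v = "\<lambda>z. csqrt (1 + 1 / z\<^sup>2)"
  have "((\<lambda>z. 1 / (2 * (?v z + 1)) + Ln (1 + ?v z) / 2) \<longlongrightarrow> 1 / (2 * (1 + 1)) + Ln (1 + 1) / 2) (LG_at e (4 / 5))"
    by (intro tendsto_intros tendsto_csqrt_factor) auto
  moreover have "Ln (1 + 1) = of_real (ln 2)" using Ln_of_real[of 2] by simp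
  ultimately show "((\<lambda>z. 1 / (2 * (?v z + 1)) + Ln (1 + ?v z) / 2) \<longlongrightarrow> of_real (1 / 4 + ln 2 / 2)) (LG_at e (4 / 5))"
    by simp
  show "\<forall>\<^sub>F z in LG_at e (4 / 5). 1 / (2 * (?v z + 1)) + Ln (1 + ?v z) / 2 = xi_bar z - z\<^sup>2 / 2 - Ln z / 2"
    using eventually_LG_at_Re_pos[OF e]
  proof eventually_elim
    case (elim z)
    define v where "v = ?v z"
    have z: "Re z > 0" "z \<noteq> 0" using elim by auto
    have q: "csqrt (z\<^sup>2 + 1) = z * v" and v: "Re v > 0"
      using csqrt_factor[OF z(1)] by (simp_all add: v_def)
    have v1: "1 + v \<noteq> 0" "Re (1 + v) > 0" using v by (auto simp: complex_eq_iff)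
    have "Ln (z + z * v) = Ln (z * (1 + v))" by (simp add: algebra_simps)
    also have "\<dots> = Ln z + Ln (1 + v)"
      using Re_Ln_pos_lt_imp[OF z(1)] Re_Ln_pos_lt_imp[OF v1(2)] z v1
      by (intro Ln_times_simple) auto
    finally have L: "Ln (z + z * v) = Ln z + Ln (1 + v)" .
    have "v\<^sup>2 * z\<^sup>2 = z\<^sup>2 + 1" using z by (simp add: v_def field_simps)
    then have "(z\<^sup>2 * v - z\<^sup>2) * (v + 1) = 1" by algebra
    then have "z\<^sup>2 * v - z\<^sup>2 = 1 / (v + 1)" using v1 by (simp add: field_simps)
    then have "z\<^sup>2 * v / 2 - z\<^sup>2 / 2 = 1 / (2 * (v + 1))" by (simp add: diff_divide_distrib[symmetric])
    moreover have zz: "z * (z * v) = z\<^sup>2 * v" by (simp add: power2_eq_square mult.assoc)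
    ultimately show ?case
      unfolding xi_bar_eq_closed[OF Re_pos_imp_cut_plane[OF z(1)]] xi_closed_def q L v_def[symmetric] zz
      by (simp add: add_divide_distrib)
  qed
qed

text \<open>A disc of radius proportional to |z| about a point of the narrower sector stays in the
  wider one, so Cauchy's inequality makes h' small compared with 1/|z|. Division by the root does no
  harm, its modulus being at least 1 there.\<close>

lemma xi_deriv_tendsto_0:
  assumes e: "e \<in> {1, -1}" and h: "h holomorphic_on cut_plane" "(h \<longlongrightarrow> L) (LG_at e k)"
    and k: "4 / 5 \<le> k" "k < k'" "k' \<le> 1"
  shows "(xi_deriv h \<longlongrightarrow> 0) (LG_at e k')"
proof (rule tendstoI)
  \<comment> \<open>This choice gives k (1 + c) <= k' - c, the price in the sector condition of a
    displacement by c |z|.\<close>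
  define c where "c = (k' - k) / 4"
  have c: "c > 0" "c \<le> 1 / 20" using k by (auto simp: c_def)
  have kc: "k * (1 + c) \<le> k' - c"
  proof -
    have "k * c \<le> 1 * c" using k c by (intro mult_right_mono) auto
    moreover have "k' = k + 4 * c" by (simp add: c_def field_simps)
    ultimately show ?thesis using c by (simp add: distrib_left)
  qed
  fix \<epsilon> :: real assume \<epsilon>: "\<epsilon> > 0"
  have "\<forall>\<^sub>F z in LG_at e k. dist (h z) L < \<epsilon> * c"
    using h(2) by (rule tendstoD) (use \<epsilon> c in simp)
  then obtain R where R: "\<And>z. z \<in> LG_sector e k \<Longrightarrow> R \<le> cmod z \<Longrightarrow> dist (h z) L < \<epsilon> * c"
    unfolding eventually_LG_at by blast
  show "\<forall>\<^sub>F z in LG_at e k'. dist (xi_deriv h z) 0 < \<epsilon>"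
    unfolding eventually_LG_at
  proof (intro exI[of _ "max 2 (2 * R)"] ballI impI)
    fix z assume z: "z \<in> LG_sector e k'" "max 2 (2 * R) \<le> cmod z"
    define r where "r = c * cmod z"
    have "cmod z > 0" using z(2) max.cobounded1[of 2 "2 * R"] by linarith
    then have r: "r > 0" "cmod z \<ge> 2" "cmod z \<ge> 2 * R" using z c by (simp_all add: r_def)
    have sec: "w \<in> LG_sector e k \<and> R \<le> cmod w \<and> w \<in> cut_plane" if w: "w \<in> cball z r" for w
    proof -
      have d: "cmod (z - w) \<le> c * cmod z" using w by (simp add: dist_norm r_def)
      have a: "cmod w \<le> cmod z + c * cmod z" "cmod z - c * cmod z \<le> cmod w"
        using d norm_triangle_ineq2[of w z] norm_triangle_ineq2[of z w] by (simp_all add: norm_minus_commute)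
      have "Re ((z - w) * LG_rot e) \<le> cmod (z - w)"
        using complex_Re_le_cmod[of "(z - w) * LG_rot e"] by (simp only: norm_mult norm_LG_rot mult_1_right)
      then have "Re (z * LG_rot e) - Re (w * LG_rot e) \<le> c * cmod z"
        using d unfolding left_diff_distrib minus_complex.sel by linarith
      moreover have "k * cmod w \<le> (k' - c) * cmod z"
      proof -
        have "k * cmod w \<le> k * ((1 + c) * cmod z)"
          using a(1) k by (intro mult_left_mono) (auto simp: algebra_simps)
        also have "\<dots> \<le> (k' - c) * cmod z"
          unfolding mult.assoc[symmetric] by (intro mult_right_mono kc) auto
        finally show ?thesis .
      qed
      ultimately have s: "w \<in> LG_sector e k"
        using z(1) unfolding LG_sector_def mem_Collect_eq left_diff_distrib by linarith
      have "4 / 5 * cmod w \<le> k * cmod w" using k by (intro mult_right_mono) auto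
      with s have s': "w \<in> LG_sector e (4 / 5)" unfolding LG_sector_def mem_Collect_eq by linarith
      have "c * cmod z \<le> 1 / 20 * cmod z" using c by (intro mult_right_mono) auto
      then have "R \<le> cmod w" "cmod w > 0" using a r by linarith+
      then show ?thesis using s LG_sector_Re_pos(1)[OF e s'] Re_pos_imp_cut_plane by auto
    qed
    have holw: "h holomorphic_on ball z r" "continuous_on (cball z r) h"
      using h(1) sec by (auto intro!: holomorphic_on_imp_continuous_on intro: holomorphic_on_subset)
    have zc: "z \<in> cut_plane" using sec[of z] r by simp
    have "cmod ((deriv ^^ 1) (\<lambda>w. h w - L) z) \<le> fact 1 * (\<epsilon> * c) / r ^ 1"
    proof (rule Cauchy_inequality)
      show "cmod (h x - L) \<le> \<epsilon> * c" if "cmod (z - x) = r" for x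
        using R[of x] sec[of x] that by (auto simp: dist_norm intro: less_imp_le)
    qed (use holw r in \<open>auto intro!: holomorphic_intros continuous_intros\<close>)
    moreover have "deriv (\<lambda>w. h w - L) z = deriv h z"
      using holomorphic_derivI[OF h(1) open_cut_plane zc]
      by (intro DERIV_imp_deriv) (auto intro!: derivative_eq_intros)
    ultimately have "cmod (deriv h z) \<le> \<epsilon> / cmod z" using c by (simp add: r_def)
    also have "\<dots> \<le> \<epsilon> / 2" using r \<epsilon> by (intro divide_left_mono) auto
    finally have 1: "cmod (deriv h z) \<le> \<epsilon> / 2" .
    have "(cmod (csqrt (z\<^sup>2 + 1)))\<^sup>2 = cmod (z\<^sup>2 + 1)" by (metis norm_power power2_csqrt)
    moreover have "cmod (z\<^sup>2 + 1) \<ge> (cmod z)\<^sup>2 - 1"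
      using norm_diff_ineq[of "z\<^sup>2" 1] by (simp add: norm_power)
    moreover have "(cmod z)\<^sup>2 \<ge> 2\<^sup>2" using r by (intro power_mono) auto
    ultimately have "1\<^sup>2 \<le> (cmod (csqrt (z\<^sup>2 + 1)))\<^sup>2" by simp
    then have "1 \<le> cmod (csqrt (z\<^sup>2 + 1))" by (rule power2_le_imp_le) simp
    then have "cmod (xi_deriv h z) \<le> cmod (deriv h z)"
      unfolding xi_deriv_def norm_divide by (simp add: divide_le_eq mult_le_cancel_left1)
    then show "dist (xi_deriv h z) 0 < \<epsilon>" using 1 \<epsilon> by simp
  qed
qed

section \<open>The error factors\<close>

text \<open>The facts about an error factor on which all bounds rest, shared by both expansions;
  \<open>\<i> * of_real e * of_real u\<close> is 1/x. The aperture 9/10 is the one available for w',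
  which loses one Cauchy estimate against 4/5.\<close>

definition LG_solution :: "(nat \<Rightarrow> complex \<Rightarrow> complex) \<Rightarrow> nat \<Rightarrow> real \<Rightarrow> real \<Rightarrow> (complex \<Rightarrow> complex) \<Rightarrow> bool" where
  "LG_solution E n e u h \<longleftrightarrow> h holomorphic_on cut_plane \<and>
     (\<forall>z\<in>cut_plane. xi_deriv (xi_deriv h) z =
        - 2 * (\<i> * of_real e * of_real u + LG_T E n (- \<i> * of_real e / of_real u) (beta_bar z)) * xi_deriv h z -
        LG_R E n (- \<i> * of_real e / of_real u) (beta_bar z) * h z) \<and>
     (h \<longlongrightarrow> 1) (LG_at e (9 / 10))"

definition LG_S :: "(nat \<Rightarrow> complex \<Rightarrow> complex) \<Rightarrow> nat \<Rightarrow> complex \<Rightarrow> complex \<Rightarrow> complex" where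
  "LG_S E n x b = (\<Sum>s = 1..n - 1. x ^ s * E s b)"

lemma has_field_derivative_LG_S:
  assumes "LG_sequence E"
  shows "(LG_S E n x has_field_derivative (\<Sum>s = 1..n - 1. x ^ s * deriv (E s) b)) (at b)"
  unfolding LG_S_def[abs_def]
  by (intro DERIV_sum DERIV_cmult holomorphic_derivI[of _ UNIV]) (use assms in \<open>auto simp: LG_sequence_def\<close>)

lemma LG_T_eq: "LG_T E n x b = (1 - b\<^sup>2)\<^sup>2 * (\<Sum>s = 1..n - 1. x ^ s * deriv (E s) b)"
  by (simp add: LG_T_def LG_F_def sum_distrib_left mult_ac)

text \<open>Even powers of x = - e i / u are real with alternating signs, odd ones carry one factor
  - e i. With n = 2 m + 2 the sum ends at the odd index 2 m + 1.\<close>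

lemma LG_S_even_odd:
  assumes e: "e \<in> {1, -1}" and u: "u > 0"
  shows "LG_S E (2 * m + 2) (- \<i> * of_real e / of_real u) b =
    (\<Sum>s = 1..m. (-1) ^ s * E (2 * s) b / of_real u ^ (2 * s)) -
    of_real e * \<i> * (\<Sum>s = 0..m. (-1) ^ s * E (2 * s + 1) b / of_real u ^ (2 * s + 1))"
proof -
  define x where "x = - \<i> * of_real e / complex_of_real u"
  have x2: "x\<^sup>2 = - 1 / of_real u ^ 2" using e by (auto simp: x_def power_divide)
  have even: "x ^ (2 * s) = (-1) ^ s / of_real u ^ (2 * s)" for s
    unfolding power_mult x2 power_divide by simp
  have odd: "x ^ (2 * s + 1) = - (of_real e * \<i>) * ((-1) ^ s / of_real u ^ (2 * s + 1))" for s
    unfolding power_add even by (simp add: x_def field_simps)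
  have "(\<Sum>s = Suc 0..Suc (2 * m). x ^ s * E s b) =
    (\<Sum>s = 1..m. (-1) ^ s * E (2 * s) b / of_real u ^ (2 * s)) -
    of_real e * \<i> * (\<Sum>s = 0..m. (-1) ^ s * E (2 * s + 1) b / of_real u ^ (2 * s + 1))"
  proof (induction m)
    case 0
    then show ?case using odd[of 0] by simp
  next
    case (Suc m)
    have "(\<Sum>s = Suc 0..Suc (2 * Suc m). x ^ s * E s b) = (\<Sum>s = Suc 0..Suc (2 * m). x ^ s * E s b) +
        x ^ (2 * Suc m) * E (2 * Suc m) b + x ^ (2 * Suc m + 1) * E (2 * Suc m + 1) b"
      by simp
    also have "\<dots> = (\<Sum>s = 1..Suc m. (-1) ^ s * E (2 * s) b / of_real u ^ (2 * s)) -
      of_real e * \<i> * (\<Sum>s = 0..Suc m. (-1) ^ s * E (2 * s + 1) b / of_real u ^ (2 * s + 1))"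
      unfolding Suc even odd by (simp del: power_Suc mult_Suc_right add: algebra_simps)
    finally show ?case .
  qed
  then show ?thesis by (simp add: LG_S_def x_def)
qed

text \<open>The even coefficients vanish at 1, so the odd sum inside the phase is all of
  \<open>LG_S\<close> at 1.\<close>

lemma LG_chi_eq:
  assumes E: "LG_sequence E" and e: "e \<in> {1, -1}" and u: "u > 0"
  shows "of_real e * \<i> * LG_chi E m u =
    of_real e * \<i> * of_real (u / 4 * ln (2 * exp 1 / u)) + LG_S E (2 * m + 2) (- \<i> * of_real e / of_real u) 1"
proof -
  have "(\<Sum>s = 1..m. (-1) ^ s * E (2 * s) 1 / of_real u ^ (2 * s)) = 0"
    using E by (intro sum.neutral) (auto simp: LG_sequence_def)
  then show ?thesis
    unfolding LG_S_even_odd[OF e u] LG_chi_def by (simp add: algebra_simps)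
qed

text \<open>For j = 3 the factor (- i)^3 = i turns exp (- \<pi> i / 4) into its conjugate, so both
  indices differ only by the sign e.\<close>

lemma pcf_W_eq:
  assumes "(j, e) \<in> {(0 :: nat, 1 :: real), (3, -1)}"
  shows "pcf_W j (- (1 / 2) * of_real u) = (\<lambda>z. parabolic_cylinder_U (- \<i> * of_real e * of_real u / 2) (z * LG_rot e))"
proof -
  have "exp (\<i> * of_real pi / 4) = \<i> * exp (- (of_real pi * \<i> / 4))"
  proof -
    have "\<i> * exp (- (of_real pi * \<i> / 4)) = exp (\<i> * of_real (pi / 2)) * exp (- (of_real pi * \<i> / 4))"
      by (metis cis_conv_exp cis_pi_half)
    also have "\<dots> = exp (\<i> * of_real (pi / 2) - of_real pi * \<i> / 4)"
      by (simp only: mult_exp_exp diff_conv_add_uminus)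
    also have "\<i> * of_real (pi / 2) - of_real pi * \<i> / 4 = \<i> * of_real pi / 4"
      by (simp add: complex_eq_iff)
    finally show ?thesis ..
  qed
  then show ?thesis
    using assms by (auto simp: pcf_W_def LG_rot_def fun_eq_iff eval_nat_numeral mult_ac)
qed

text \<open>The reciprocal of the claimed expansion: \<open>f\<close> holds the constants and the
  power of 1 + z^2, and subtracting \<open>LG_S\<close> at 1 accounts for the coefficients in the
  phase.\<close>

definition LG_G :: "(nat \<Rightarrow> complex \<Rightarrow> complex) \<Rightarrow> nat \<Rightarrow> complex \<Rightarrow> (complex \<Rightarrow> complex) \<Rightarrow> complex \<Rightarrow> complex" where
  "LG_G E n x f z = f z * exp (- (xi_bar z / x + LG_S E n x (beta_bar z) - LG_S E n x 1))"

lemma has_field_derivative_LG_G: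
  assumes E: "LG_sequence E" and z: "z \<in> cut_plane"
    and f: "(f has_field_derivative f z * (\<sigma> * beta_bar z * (1 - (beta_bar z)\<^sup>2) / 2 * csqrt (z\<^sup>2 + 1))) (at z)"
  shows "(LG_G E n x f has_field_derivative
       LG_G E n x f z * ((\<sigma> * beta_bar z * (1 - (beta_bar z)\<^sup>2) / 2 - 1 / x - LG_T E n x (beta_bar z)) *
         csqrt (z\<^sup>2 + 1))) (at z)"
proof -
  let ?q = "csqrt (z\<^sup>2 + 1)" and ?b = "beta_bar z"
  have S: "((\<lambda>z. LG_S E n x (beta_bar z)) has_field_derivative LG_T E n x ?b * ?q) (at z)"
    using DERIV_chain2[OF has_field_derivative_LG_S[OF E] has_field_derivative_beta_bar[OF z]]
    by (simp add: LG_T_eq mult_ac)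
  have "((\<lambda>z. exp (- (xi_bar z / x + LG_S E n x (beta_bar z) - LG_S E n x 1))) has_field_derivative
      exp (- (xi_bar z / x + LG_S E n x ?b - LG_S E n x 1)) * (- (?q / x + LG_T E n x ?b * ?q - 0))) (at z)"
    by (intro DERIV_chain2[OF DERIV_exp] DERIV_minus DERIV_diff DERIV_add DERIV_cdivide DERIV_const S
        has_field_derivative_xi_bar z)
  from DERIV_mult[OF f this] show ?thesis
    unfolding LG_G_def[abs_def] by (rule DERIV_cong) (simp add: algebra_simps)
qed

section \<open>The differential equations of w and w'\<close>

locale pcf_LG =
  fixes e u :: real
  assumes e: "e \<in> {1, -1}" and u: "u > 0"
begin

definition "a = - \<i> * of_real e * of_real u / 2"
definition "c = of_real (sqrt (2 * u)) * LG_rot e"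
definition "x = - \<i> * of_real e / complex_of_real u"
definition "w z = parabolic_cylinder_U a (c * z)"
text \<open>This is W_j' at sqrt (2 u) z, the derivative in the second argument; the z-derivative of
  \<open>w\<close> is sqrt (2 u) times it.\<close>

definition "v z = LG_rot e * deriv (parabolic_cylinder_U a) (c * z)"

lemma ee: "complex_of_real e * of_real e = 1" using e by auto

lemma x: "x \<noteq> 0" "1 / x = \<i> * of_real e * of_real u" "1 / x\<^sup>2 = - (of_real u)\<^sup>2"
  using e u by (auto simp: x_def power_divide field_simps)

lemma div_x_sq: "y / x\<^sup>2 = - (of_real u)\<^sup>2 * y"
proof -
  have "y / x\<^sup>2 = y * (1 / x\<^sup>2)" by simp
  then show ?thesis unfolding x(3) by simp
qed

lemmas rot_sq = LG_rot_sq[OF e]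

lemma sqrt_sq: "(complex_of_real (sqrt (2 * u)))\<^sup>2 = 2 * of_real u"
  using u by (simp flip: of_real_power)

lemma c_sq: "c\<^sup>2 = - 2 * \<i> * of_real e * of_real u"
  unfolding c_def power_mult_distrib rot_sq sqrt_sq by simp

lemma pcf: "is_parabolic_cylinder_U a (parabolic_cylinder_U a)"
  by (rule is_parabolic_cylinder_parabolic_cylinder_U) (simp add: a_def)

lemma U_hol: "parabolic_cylinder_U a holomorphic_on UNIV"
  using pcf by (simp add: is_parabolic_cylinder_U_def)

lemma has_field_derivative_w: "(w has_field_derivative of_real (sqrt (2 * u)) * v z) (at z)"
proof -
  have "((\<lambda>z. parabolic_cylinder_U a (c * z)) has_field_derivative deriv (parabolic_cylinder_U a) (c * z) * c) (at z)"
    by (intro DERIV_chain2[OF holomorphic_derivI[OF U_hol]]) (auto intro!: derivative_eq_intros)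
  then show ?thesis unfolding w_def[abs_def] by (simp add: v_def c_def mult_ac)
qed

lemma has_field_derivative_v:
  "(v has_field_derivative - (of_real (sqrt (2 * u)) * of_real u / 2 * (z\<^sup>2 + 1) * w z)) (at z)"
proof -
  have "deriv (deriv (parabolic_cylinder_U a)) (c * z) = ((c * z)\<^sup>2 / 4 + a) * w z"
    using pcf unfolding is_parabolic_cylinder_U_def w_def by (simp add: numeral_2_eq_2)
  then have "((\<lambda>z. LG_rot e * deriv (parabolic_cylinder_U a) (c * z)) has_field_derivative
      LG_rot e * (((c * z)\<^sup>2 / 4 + a) * w z * c)) (at z)"
    using DERIV_cmult[OF DERIV_chain2[OF holomorphic_derivI[OF holomorphic_deriv[OF U_hol open_UNIV] open_UNIV UNIV_I]
          DERIV_cmult_Id[of c]], of "LG_rot e" z] by simp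
  moreover have "LG_rot e * (((c * z)\<^sup>2 / 4 + a) * w z * c) =
      - (of_real (sqrt (2 * u)) * of_real u / 2 * (z\<^sup>2 + 1) * w z)"
  proof -
    have "(c * z)\<^sup>2 / 4 + a = - \<i> * of_real e * of_real u / 2 * (z\<^sup>2 + 1)"
      unfolding power_mult_distrib c_sq a_def by (simp add: algebra_simps)
    then have "LG_rot e * (((c * z)\<^sup>2 / 4 + a) * w z * c) =
        (LG_rot e)\<^sup>2 * of_real (sqrt (2 * u)) * (- \<i> * of_real e * of_real u / 2 * (z\<^sup>2 + 1)) * w z"
      by (simp add: c_def power2_eq_square mult_ac)
    also have "\<dots> = - (of_real e * of_real e) * (of_real (sqrt (2 * u)) * of_real u / 2 * (z\<^sup>2 + 1) * w z)"
      unfolding rot_sq by (simp add: algebra_simps)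
    finally show ?thesis unfolding ee by simp
  qed
  ultimately show ?thesis unfolding v_def[abs_def] by simp
qed

lemma w_hol: "w holomorphic_on A" and v_hol: "v holomorphic_on A"
  using has_field_derivative_w has_field_derivative_v
  by (auto simp: holomorphic_on_def field_differentiable_def intro: has_field_derivative_at_within)

lemma xi_deriv_w: "z \<in> cut_plane \<Longrightarrow> xi_deriv w z = of_real (sqrt (2 * u)) * v z / csqrt (z\<^sup>2 + 1)"
  unfolding xi_deriv_def DERIV_imp_deriv[OF has_field_derivative_w] by simp

lemma xi_deriv_v:
  assumes "z \<in> cut_plane"
  shows "xi_deriv v z = - (of_real (sqrt (2 * u)) * of_real u / 2 * csqrt (z\<^sup>2 + 1) * w z)"
proof -
  have "z\<^sup>2 + 1 = csqrt (z\<^sup>2 + 1) * csqrt (z\<^sup>2 + 1)" by (metis power2_csqrt power2_eq_square)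
  moreover have "- (k * (q * q) * y) / q = - (k * q * y)" if "q \<noteq> 0" for k q y :: complex
    using that by simp
  ultimately show ?thesis
    unfolding xi_deriv_def DERIV_imp_deriv[OF has_field_derivative_v]
    using cut_plane_csqrt_nonzero[OF assms] by metis
qed

lemma beta_term:
  assumes "z \<in> cut_plane"
  shows "beta_bar z * (1 - (beta_bar z)\<^sup>2) = z / csqrt (z\<^sup>2 + 1) ^ 3"
proof -
  define q where "q = csqrt (z\<^sup>2 + 1)"
  have "z\<^sup>2 + 1 = q * q" by (simp add: q_def flip: power2_eq_square)
  then have "1 - (beta_bar z)\<^sup>2 = 1 / (q * q)"
    using one_minus_beta_bar_sq[OF assms] by simp
  then show ?thesis
    by (simp only:) (simp add: beta_bar_def q_def power3_eq_cube)
qed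

text \<open>With D the xi-derivative, q the root and k = sqrt (2 u), the system is D w = k v / q and
  D v = - (k u / 2) q w, where k^2 u / 2 = u^2. Eliminating v differentiates 1/q, eliminating w
  differentiates q; hence the opposite signs of the first order term here and in
  \<open>ode_v\<close>.\<close>

lemma ode_w:
  assumes z: "z \<in> cut_plane"
  shows "xi_deriv (xi_deriv w) z = w z / x\<^sup>2 - 1 * beta_bar z * (1 - (beta_bar z)\<^sup>2) * xi_deriv w z"
proof -
  let ?q = "csqrt (z\<^sup>2 + 1)" and ?k = "complex_of_real (sqrt (2 * u))"
  have q: "?q \<noteq> 0" "?q * ?q = z\<^sup>2 + 1" using cut_plane_csqrt_nonzero[OF z] by (auto simp flip: power2_eq_square)
  have "xi_deriv (xi_deriv w) z = xi_deriv (\<lambda>z. ?k * v z / csqrt (z\<^sup>2 + 1)) z"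
    by (rule xi_deriv_cong[OF z xi_deriv_w])
  also have "\<dots> = (?k * - (?k * of_real u / 2 * (z\<^sup>2 + 1) * w z) * ?q - ?k * v z * (z / ?q)) / (?q * ?q) / ?q"
    unfolding xi_deriv_def
    by (intro arg_cong2[where f = "(/)"] DERIV_imp_deriv DERIV_divide DERIV_cmult has_field_derivative_v
        has_field_derivative_csqrt_cut_plane z q refl)
  also have "\<dots> = - (?k\<^sup>2 * of_real u / 2) * w z - z / ?q ^ 3 * (?k * v z / ?q)"
  proof -
    have "(k * - (k * u / 2 * (q * q) * w) * q - k * v * (z / q)) / (q * q) / q =
        - (k\<^sup>2 * u / 2) * w - z / q ^ 3 * (k * v / q)" if "q \<noteq> 0" for k u q w v z :: complex
      using that by (simp add: field_simps power2_eq_square power3_eq_cube)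
    from this[OF q(1)] show ?thesis unfolding q(2) .
  qed
  also have "?k\<^sup>2 * of_real u / 2 = (of_real u)\<^sup>2" unfolding sqrt_sq by (simp add: power2_eq_square)
  finally show ?thesis
    unfolding xi_deriv_w[OF z] mult_1 beta_term[OF z] div_x_sq by simp
qed

lemma ode_v:
  assumes z: "z \<in> cut_plane"
  shows "xi_deriv (xi_deriv v) z = v z / x\<^sup>2 - (- 1) * beta_bar z * (1 - (beta_bar z)\<^sup>2) * xi_deriv v z"
proof -
  let ?q = "csqrt (z\<^sup>2 + 1)" and ?k = "complex_of_real (sqrt (2 * u))"
  have q: "?q \<noteq> 0" "?q * ?q = z\<^sup>2 + 1" using cut_plane_csqrt_nonzero[OF z] by (auto simp flip: power2_eq_square)
  have "xi_deriv (xi_deriv v) z = xi_deriv (\<lambda>z. - (?k * of_real u / 2 * csqrt (z\<^sup>2 + 1) * w z)) z"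
    by (rule xi_deriv_cong[OF z xi_deriv_v])
  also have "\<dots> = - ((?k * of_real u / 2 * (z / ?q)) * w z + (?k * v z) * (?k * of_real u / 2 * ?q)) / ?q"
    unfolding xi_deriv_def
    by (intro arg_cong2[where f = "(/)"] DERIV_imp_deriv DERIV_minus DERIV_mult DERIV_cmult has_field_derivative_w
        has_field_derivative_csqrt_cut_plane z refl)
  also have "\<dots> = - (?k\<^sup>2 * of_real u / 2) * v z + z / ?q ^ 3 * - (?k * of_real u / 2 * ?q * w z)"
  proof -
    have "- ((k * u / 2 * (z / q)) * w + (k * v) * (k * u / 2 * q)) / q =
        - (k\<^sup>2 * u / 2) * v + z / q ^ 3 * - (k * u / 2 * q * w)" if "q \<noteq> 0" for k u q w v z :: complex
      using that by (simp add: field_simps power2_eq_square power3_eq_cube)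
    from this[OF q(1)] show ?thesis .
  qed
  also have "?k\<^sup>2 * of_real u / 2 = (of_real u)\<^sup>2" unfolding sqrt_sq by (simp add: power2_eq_square)
  finally show ?thesis
    unfolding xi_deriv_v[OF z] mult_minus_left mult_1 beta_term[OF z] div_x_sq by simp
qed

end

section \<open>Normalisation of the error factors at infinity\<close>

context pcf_LG
begin

text \<open>Logarithms of the constant prefactors of the two expansions, without the coefficients at
  1, so that matching at infinity becomes addition of exponents. The ln 2 in \<open>k1\<close> is
  the factor 1/2.\<close>

definition "k0 = - \<i> * of_real e * of_real (u / 4 * ln (2 * exp 1 / u) - pi / 8) + of_real (pi * u / 8 - ln (2 * u) / 4)"
definition "k1 = - \<i> * of_real e * of_real (u / 4 * ln (2 * exp 1 / u) - 5 / 8 * pi) +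
  of_real (pi * u / 8 + ln (2 * u) / 4 - ln 2)"
definition "f_bar z = exp (- k0) * (1 + z\<^sup>2) powr (1 / 4)"
definition "f_tilde z = exp (- k1) * inverse ((1 + z\<^sup>2) powr (1 / 4))"

lemma exp_half_ln: "exp (ln (2 * u) / 2) = sqrt (2 * u)"
proof -
  have "ln (2 * u) / 2 = ln (sqrt (2 * u))" using u by (simp add: ln_sqrt)
  also have "exp (ln (sqrt (2 * u))) = sqrt (2 * u)" using u by (intro exp_ln) simp
  finally show ?thesis .
qed

lemma has_field_derivative_f_bar:
  assumes "z \<in> cut_plane"
  shows "(f_bar has_field_derivative f_bar z * (1 * beta_bar z * (1 - (beta_bar z)\<^sup>2) / 2 * csqrt (z\<^sup>2 + 1))) (at z)"
  unfolding f_bar_def[abs_def]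
  by (rule DERIV_cong[OF DERIV_cmult[OF has_field_derivative_powr_quarter[OF assms]]]) simp

lemma has_field_derivative_f_tilde:
  assumes "z \<in> cut_plane"
  shows "(f_tilde has_field_derivative f_tilde z * ((- 1) * beta_bar z * (1 - (beta_bar z)\<^sup>2) / 2 * csqrt (z\<^sup>2 + 1))) (at z)"
proof -
  have nz: "(1 + z\<^sup>2) powr (1 / 4) \<noteq> 0" using cut_plane_nonzero[OF assms] by (simp add: add.commute)
  show ?thesis
    unfolding f_tilde_def[abs_def]
    by (rule DERIV_cong[OF DERIV_cmult[OF DERIV_inverse_fun[OF has_field_derivative_powr_quarter[OF assms] nz]]])
      (use nz in \<open>simp add: field_simps\<close>)
qed

lemma tendsto_LG_S:
  assumes "LG_sequence E"
  shows "((\<lambda>z. LG_S E n y (beta_bar z)) \<longlongrightarrow> LG_S E n y 1) (LG_at e (4 / 5))"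
  by (rule isCont_tendsto_compose[OF DERIV_isCont[OF has_field_derivative_LG_S[OF assms]] tendsto_beta_bar[OF e]])

lemma Ln_c_mult:
  assumes "Re z > 0" "Re (z * LG_rot e) > 0"
  shows "Ln (c * z) = of_real (ln (2 * u) / 2) + Ln z - \<i> * of_real e * of_real (pi / 4)"
proof (rule Ln_unique)
  have nz: "z \<noteq> 0" using assms by auto
  have "exp (of_real (ln (2 * u) / 2) + Ln z - \<i> * of_real e * of_real (pi / 4)) =
      exp (of_real (ln (2 * u) / 2)) * z * LG_rot e"
  proof -
    have "of_real (ln (2 * u) / 2) + Ln z - \<i> * of_real e * of_real (pi / 4) =
        of_real (ln (2 * u) / 2) + Ln z + (- of_real (e * pi / 4) * \<i>)" by simp
    then show ?thesis by (simp only: exp_add LG_rot_def exp_Ln[OF nz])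
  qed
  also have "exp (complex_of_real (ln (2 * u) / 2)) = of_real (sqrt (2 * u))"
    unfolding exp_of_real exp_half_ln ..
  finally show "exp (of_real (ln (2 * u) / 2) + Ln z - \<i> * of_real e * of_real (pi / 4)) = c * z"
    by (simp add: c_def mult_ac)
  have "\<bar>Im (Ln z)\<bar> < pi / 2" using assms(1) by (rule Re_Ln_pos_lt_imp)
  moreover have "\<bar>e * (pi / 4)\<bar> = pi / 4" using e by auto
  ultimately have "\<bar>Im (Ln z) - e * (pi / 4)\<bar> < pi" using pi_gt_zero by linarith
  then show "- pi < Im (of_real (ln (2 * u) / 2) + Ln z - \<i> * of_real e * of_real (pi / 4))"
    "Im (of_real (ln (2 * u) / 2) + Ln z - \<i> * of_real e * of_real (pi / 4)) \<le> pi"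
    by auto
qed

text \<open>On the sector \<open>c * z\<close> has positive real part, so the instance \<delta> =
  \<pi>/4 of the asymptotic form, valid for |arg| <= \<pi>/2, applies.\<close>

lemma tendsto_w:
  "((\<lambda>z. w z / ((c * z) powr (- a - 1 / 2) * exp (- ((c * z)\<^sup>2) / 4))) \<longlongrightarrow> 1) (LG_at e (4 / 5))"
proof -
  let ?F = "inf at_infinity (principal {z. \<bar>Arg z\<bar> \<le> 3 / 4 * pi - pi / 4})"
  have eq: "parabolic_cylinder_U a \<sim>[?F] (\<lambda>z. z powr (- a - 1 / 2) * exp (- (z\<^sup>2) / 4))"
    using pcf unfolding is_parabolic_cylinder_U_def by (auto dest!: spec[of _ "pi / 4"])
  have "\<forall>\<^sub>F z in ?F. z \<noteq> 0"
    by (rule filter_leD[OF inf_le1]) (rule eventually_not_equal_at_infinity)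
  then have "((\<lambda>z. parabolic_cylinder_U a z / (z powr (- a - 1 / 2) * exp (- (z\<^sup>2) / 4))) \<longlongrightarrow> 1) ?F"
    by (intro asymp_equivD_strong[OF eq]) (auto elim: eventually_mono)
  moreover have "filterlim (\<lambda>z. c * z) ?F (LG_at e (4 / 5))"
    unfolding filterlim_inf filterlim_principal
  proof
    have "c \<noteq> 0" using u by (simp add: c_def LG_rot_def)
    then show "filterlim (\<lambda>z. c * z) at_infinity (LG_at e (4 / 5))"
      by (intro tendsto_mult_filterlim_at_infinity[OF tendsto_const] filterlim_LG_at_infinity)
    show "\<forall>\<^sub>F z in LG_at e (4 / 5). c * z \<in> {z. \<bar>Arg z\<bar> \<le> 3 / 4 * pi - pi / 4}"
      using eventually_LG_at_Re_pos[OF e]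
    proof eventually_elim
      case (elim z)
      have "c * z = of_real (sqrt (2 * u)) * (z * LG_rot e)" by (simp add: c_def mult_ac)
      moreover have "Re (of_real r * y) = r * Re y" for r y by simp
      ultimately have "Re (c * z) > 0" using elim u by (metis mult_pos_pos real_sqrt_gt_zero zero_less_numeral)
      then have "\<bar>Arg (c * z)\<bar> < pi / 2" using Arg_Re_pos[of "c * z"] by blast
      then show ?case by simp
    qed
  qed
  ultimately show ?thesis
    unfolding w_def by (rule filterlim_compose)
qed

text \<open>The leading form of U times \<open>LG_G\<close> is exactly exp (D z), where
  \<open>D\<close> is arranged as a sum of terms each tending to 0. This cancellation is what
  dictates \<open>k0\<close>.\<close>

lemma tendsto_w_G:
  assumes E: "LG_sequence E"
  shows "((\<lambda>z. w z * LG_G E n x f_bar z) \<longlongrightarrow> 1) (LG_at e (4 / 5))"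
proof -
  let ?m = "\<lambda>z. (c * z) powr (- a - 1 / 2) * exp (- ((c * z)\<^sup>2) / 4)"
  let ?v = "\<lambda>z. csqrt (1 + 1 / z\<^sup>2)"
  define D where "D z = - (\<i> * of_real e * of_real u) *
      (xi_bar z - z\<^sup>2 / 2 - Ln z / 2 - of_real (1 / 4 + ln 2 / 2)) + Ln (?v z) / 2 -
      (LG_S E n x (beta_bar z) - LG_S E n x 1)" for z
  have "((\<lambda>z. exp (D z)) \<longlongrightarrow> exp (- (\<i> * of_real e * of_real u) *
      (of_real (1 / 4 + ln 2 / 2) - of_real (1 / 4 + ln 2 / 2)) + Ln 1 / 2 -
      (LG_S E n x 1 - LG_S E n x 1))) (LG_at e (4 / 5))"
    unfolding D_def
    by (intro tendsto_exp tendsto_diff tendsto_add tendsto_mult tendsto_const tendsto_xi_bar e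
        tendsto_divide tendsto_Ln tendsto_csqrt_factor tendsto_LG_S E) auto
  then have "((\<lambda>z. exp (D z)) \<longlongrightarrow> 1) (LG_at e (4 / 5))" by simp
  from tendsto_mult[OF tendsto_w this]
  have "((\<lambda>z. w z / ?m z * exp (D z)) \<longlongrightarrow> 1) (LG_at e (4 / 5))" by simp
  moreover have "\<forall>\<^sub>F z in LG_at e (4 / 5). w z / ?m z * exp (D z) = w z * LG_G E n x f_bar z"
    using eventually_LG_at_Re_pos[OF e]
  proof eventually_elim
    case (elim z)
    have z: "Re z > 0" "z \<noteq> 0" "z \<in> cut_plane" using elim Re_pos_imp_cut_plane by auto
    have cz: "c * z \<noteq> 0" using z u by (simp add: c_def LG_rot_def)
    have v: "Re (?v z) > 0" and q: "csqrt (z\<^sup>2 + 1) = z * ?v z"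
      using csqrt_factor[OF z(1)] by auto
    have v0: "?v z \<noteq> 0" using v by (metis less_irrefl zero_complex.sel(1))
    have Lq: "Ln (z * ?v z) = Ln z + Ln (?v z)"
      using Re_Ln_pos_lt_imp[OF z(1)] Re_Ln_pos_lt_imp[OF v] z v0
      by (intro Ln_times_simple) auto
    have g: "(1 + z\<^sup>2) powr (1 / 4) = exp (Ln z / 2 + Ln (?v z) / 2)"
      unfolding powr_quarter_eq[OF z(3)] unfolding csqrt_exp_Ln[OF cut_plane_csqrt_nonzero[OF z(3)]]
      unfolding q Lq
      by (simp add: add_divide_distrib)
    have m: "?m z = exp ((- a - 1 / 2) * Ln (c * z) - (c * z)\<^sup>2 / 4)"
      using cz by (simp add: powr_def mult_exp_exp)
    have lnu: "ln (2 * exp 1 / u) = ln 2 + 1 - ln u" "ln (2 * u) = ln 2 + ln u"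
      using u by (simp_all add: ln_div ln_mult)
    \<comment> \<open>The sign e enters only through I, with I * I = - 1, so one polynomial identity
      serves both j = 0 and j = 3.\<close>
    define I where "I = \<i> * complex_of_real e"
    have I2: "I * I = - 1" unfolding I_def using ee by (simp add: algebra_simps)
    define U where "U = complex_of_real u"
    have E: "((- a - 1 / 2) * Ln (c * z) - (c * z)\<^sup>2 / 4) +
        (- k0 + (Ln z / 2 + Ln (?v z) / 2) - (xi_bar z / x + LG_S E n x (beta_bar z) - LG_S E n x 1)) = D z"
    proof -
      have A: "- a - 1 / 2 = I * U * (1 / 2) - 1 / 2" by (simp add: a_def I_def U_def)
      have B: "(c * z)\<^sup>2 / 4 = - I * U * (1 / 2) * z\<^sup>2"
        unfolding power_mult_distrib c_sq by (simp add: I_def U_def)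
      have C: "xi_bar z / x = I * U * xi_bar z"
        using x(2) by (metis I_def U_def mult.commute mult.right_neutral times_divide_eq_right)
      have L: "Ln (c * z) = (of_real (ln 2) + of_real (ln u)) * (1 / 2) + Ln z - I * of_real pi * (1 / 4)"
        unfolding Ln_c_mult[OF z(1) conjunct2[OF elim]] lnu by (simp add: I_def)
      have K: "k0 = - I * (U * (1 / 4) * (of_real (ln 2) + 1 - of_real (ln u)) - of_real pi * (1 / 8)) +
          (of_real pi * U * (1 / 8) - (of_real (ln 2) + of_real (ln u)) * (1 / 4))"
        unfolding k0_def lnu by (simp add: I_def U_def)
      have D: "D z = - (I * U) * (xi_bar z - z\<^sup>2 * (1 / 2) - Ln z * (1 / 2) - (1 / 4 + of_real (ln 2) * (1 / 2))) +
          Ln (?v z) * (1 / 2) - (LG_S E n x (beta_bar z) - LG_S E n x 1)"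
        unfolding D_def by (simp add: I_def U_def)
      have H: "Ln z / 2 + Ln (?v z) / 2 = Ln z * (1 / 2) + Ln (?v z) * (1 / 2)" by simp
      have "(I * U * (1 / 2) - 1 / 2) * ((l2 + lu) * (1 / 2) + Lz - I * p * (1 / 4)) - - I * U * (1 / 2) * zz +
        (- (- I * (U * (1 / 4) * (l2 + 1 - lu) - p * (1 / 8)) +
          (p * U * (1 / 8) - (l2 + lu) * (1 / 4))) + (Lz * (1 / 2) + Lv * (1 / 2)) - (I * U * xi + S - S1)) =
        - (I * U) * (xi - zz * (1 / 2) - Lz * (1 / 2) - (1 / 4 + l2 * (1 / 2))) + Lv * (1 / 2) - (S - S1)"
        for l2 lu Lz Lv p zz xi S S1 :: complex
        using I2 by algebra
      then show ?thesis unfolding A B C L K D H .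
    qed
    have mG: "?m z * LG_G E n x f_bar z = exp (D z)"
      unfolding LG_G_def f_bar_def g m E[symmetric] by (simp add: mult_exp_exp algebra_simps)
    have "y / M * (M * G) = y * G" if "M \<noteq> 0" for y M G :: complex
      using that by simp
    moreover have "?m z \<noteq> 0" using cz by auto
    ultimately show ?case unfolding mG[symmetric] by blast
  qed
  ultimately show ?thesis by (rule Lim_transform_eventually)
qed

lemma LG_solution_transform:
  assumes E: "LG_sequence E" and n: "n \<ge> 2" and y: "y holomorphic_on cut_plane"
    and ode: "\<And>z. z \<in> cut_plane \<Longrightarrow> xi_deriv (xi_deriv y) z =
      y z / x\<^sup>2 - \<sigma> * beta_bar z * (1 - (beta_bar z)\<^sup>2) * xi_deriv y z"
    and F1: "\<And>b. 2 * LG_F E 1 b = (1 - b\<^sup>2)\<^sup>2 * (\<sigma>\<^sup>2 * b\<^sup>2 / 4 + \<sigma> * (1 - 3 * b\<^sup>2) / 2)"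
    and f: "\<And>z. z \<in> cut_plane \<Longrightarrow>
      (f has_field_derivative f z * (\<sigma> * beta_bar z * (1 - (beta_bar z)\<^sup>2) / 2 * csqrt (z\<^sup>2 + 1))) (at z)"
    and lim: "((\<lambda>z. y z * LG_G E n x f z) \<longlongrightarrow> 1) (LG_at e (9 / 10))"
  shows "LG_solution E n e u (\<lambda>z. y z * LG_G E n x f z)"
  unfolding LG_solution_def x_def[symmetric]
proof (intro conjI ballI lim)
  note G = has_field_derivative_LG_G[OF E _ f]
  have "LG_G E n x f holomorphic_on cut_plane"
    using G by (auto simp: holomorphic_on_open[OF open_cut_plane])
  then show "(\<lambda>z. y z * LG_G E n x f z) holomorphic_on cut_plane"
    by (intro holomorphic_on_mult y)
  fix z assume z: "z \<in> cut_plane"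
  show "xi_deriv (xi_deriv (\<lambda>z. y z * LG_G E n x f z)) z =
      - 2 * (\<i> * of_real e * of_real u + LG_T E n x (beta_bar z)) * xi_deriv (\<lambda>z. y z * LG_G E n x f z) z -
      LG_R E n x (beta_bar z) * (y z * LG_G E n x f z)"
    using LG_transform[OF E n x(1) z y ode F1 G] unfolding x(2) by blast
qed

lemma LG_solution_bar:
  assumes n: "n \<ge> 2"
  shows "LG_solution E_bar n e u (\<lambda>z. w z * LG_G E_bar n x f_bar z)"
proof (rule LG_solution_transform[OF LG_sequence_E_bar n w_hol ode_w _ has_field_derivative_f_bar])
  show "2 * LG_F E_bar 1 b = (1 - b\<^sup>2)\<^sup>2 * (1\<^sup>2 * b\<^sup>2 / 4 + 1 * (1 - 3 * b\<^sup>2) / 2)" for b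
    unfolding LG_F_def deriv_E_bar_1 by (simp add: field_simps)
  show "((\<lambda>z. w z * LG_G E_bar n x f_bar z) \<longlongrightarrow> 1) (LG_at e (9 / 10))"
    by (rule tendsto_mono[OF LG_at_mono tendsto_w_G[OF LG_sequence_E_bar]]) simp
qed

text \<open>The leading behaviour of \<open>w'\<close> is read off from \<open>w\<close>: the \<open>xi\<close>-derivative of the error
  factor of \<open>w\<close> tends to \<open>0\<close>.\<close>
lemma tendsto_v_G:
  assumes E: "LG_sequence E"
  shows "((\<lambda>z. v z * LG_G E n x f_tilde z) \<longlongrightarrow> 1) (LG_at e (9 / 10))"
proof -
  let ?h = "\<lambda>z. w z * LG_G E n x f_bar z"
  define \<rho> where "\<rho> z = 1 * beta_bar z * (1 - (beta_bar z)\<^sup>2) / 2 - 1 / x - LG_T E n x (beta_bar z)" for z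
  note G = has_field_derivative_LG_G[OF E _ has_field_derivative_f_bar]
  have "LG_G E n x f_bar holomorphic_on cut_plane"
    using G by (auto simp: holomorphic_on_open[OF open_cut_plane])
  then have hol: "?h holomorphic_on cut_plane" by (intro holomorphic_on_mult w_hol)
  have h1: "(?h \<longlongrightarrow> 1) (LG_at e (9 / 10))"
    by (rule tendsto_mono[OF LG_at_mono tendsto_w_G[OF E]]) simp
  have b1: "(beta_bar \<longlongrightarrow> 1) (LG_at e (9 / 10))"
    by (rule tendsto_mono[OF LG_at_mono tendsto_beta_bar[OF e]]) simp
  have "isCont (LG_T E n x) 1"
    unfolding LG_T_def[abs_def]
    by (intro continuous_intros DERIV_isCont[OF holomorphic_derivI[OF holomorphic_LG_F[OF E] open_UNIV UNIV_I]])
  from isCont_tendsto_compose[OF this b1]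
  have T: "((\<lambda>z. LG_T E n x (beta_bar z)) \<longlongrightarrow> 0) (LG_at e (9 / 10))"
    by (simp add: LG_T_eq)
  have "(\<rho> \<longlongrightarrow> 1 * 1 * (1 - 1\<^sup>2) / 2 - 1 / x - 0) (LG_at e (9 / 10))"
    unfolding \<rho>_def by (intro tendsto_diff tendsto_divide tendsto_mult tendsto_power tendsto_const b1 T) auto
  then have \<rho>: "(\<rho> \<longlongrightarrow> - 1 / x) (LG_at e (9 / 10))" by simp
  have S: "((\<lambda>z. LG_S E n y (beta_bar z)) \<longlongrightarrow> LG_S E n y 1) (LG_at e (9 / 10))" for y
    by (rule tendsto_mono[OF LG_at_mono tendsto_LG_S[OF E]]) simp
  \<comment> \<open>With D the xi-derivative, D h = (D w) G + h \<rho>. Hence x (D h - h \<rho>) = x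
    (D w) G, which is the error factor of w' up to a comparison of constants, and its limit follows
    from D h -> 0 and \<rho> -> - 1/x.\<close>
  have "((\<lambda>z. x * (xi_deriv ?h z - ?h z * \<rho> z)) \<longlongrightarrow> x * (0 - 1 * (- 1 / x))) (LG_at e (9 / 10))"
    by (intro tendsto_intros h1 \<rho> xi_deriv_tendsto_0[OF e hol tendsto_w_G[OF E]]) auto
  then have lim: "((\<lambda>z. x * (xi_deriv ?h z - ?h z * \<rho> z)) \<longlongrightarrow> 1) (LG_at e (9 / 10))"
    using x(1) by simp
  have "\<forall>\<^sub>F z in LG_at e (9 / 10). 0 < Re z \<and> 0 < Re (z * LG_rot e)"
    using eventually_LG_at_Re_pos[OF e] LG_at_mono[of "4 / 5" "9 / 10"] by (auto simp: le_filter_def)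
  then have "\<forall>\<^sub>F z in LG_at e (9 / 10). x * (xi_deriv ?h z - ?h z * \<rho> z) = v z * LG_G E n x f_tilde z"
  proof eventually_elim
    case (elim z)
    then have z: "z \<in> cut_plane" using Re_pos_imp_cut_plane by blast
    define q where "q = csqrt (z\<^sup>2 + 1)"
    define k where "k = complex_of_real (sqrt (2 * u))"
    define g where "g = (1 + z\<^sup>2) powr (1 / 4)"
    have q: "q \<noteq> 0" using cut_plane_csqrt_nonzero[OF z] by (simp add: q_def)
    have gq: "g * g = q" "g \<noteq> 0"
      using power2_csqrt[of q] q unfolding g_def powr_quarter_eq[OF z] q_def[symmetric]
      by (auto simp: power2_eq_square)
    have "xi_deriv ?h z = xi_deriv w z * LG_G E n x f_bar z + w z * (LG_G E n x f_bar z * \<rho> z)"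
      by (rule xi_derivI[OF _ z], rule DERIV_cong[OF DERIV_mult[OF has_field_derivative_xi_deriv[OF w_hol z] G[OF z z]]])
        (simp add: \<rho>_def algebra_simps)
    then have 1: "x * (xi_deriv ?h z - ?h z * \<rho> z) = x * xi_deriv w z * LG_G E n x f_bar z"
      by (simp add: algebra_simps)
    have k: "k \<noteq> 0" "k = exp (of_real (ln (2 * u) / 2))"
    proof -
      show "k = exp (of_real (ln (2 * u) / 2))" unfolding k_def exp_of_real exp_half_ln ..
      then show "k \<noteq> 0" by simp
    qed
    \<comment> \<open>The constants differ by exp (k1 - k0) = e i k / 2, with phase 5 \<pi>/8 -
      \<pi>/8 = \<pi>/2, and k * k = 2 u turns x k times this into 1.\<close>
    have "x * k * exp (- k0) = exp (- k1)"
    proof -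
      have "k1 - k0 = \<i> * of_real e * of_real (pi / 2) + of_real (ln (2 * u) / 2) - of_real (ln 2)"
        unfolding k0_def k1_def by (simp add: field_simps)
      then have "exp (k1 - k0) = exp (\<i> * of_real e * of_real (pi / 2)) * k / 2"
        by (simp add: exp_add exp_diff k(2) exp_of_real)
      also have "exp (\<i> * of_real e * of_real (pi / 2)) = \<i> * of_real e"
        using e cis_pi_half cis_conv_exp[of "pi / 2"] cis_conv_exp[of "- (pi / 2)"]
        by (auto simp: complex_eq_iff Re_exp Im_exp)
      finally have "exp (k1 - k0) = \<i> * of_real e * k / 2" .
      moreover have "x * k * (\<i> * of_real e * k / 2) = 1"
      proof -
        have "k * k = 2 * of_real u" using sqrt_sq by (simp add: k_def power2_eq_square)
        then have "x * k * (\<i> * of_real e * k / 2) = x * (\<i> * of_real e * of_real u)"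
          by (simp add: algebra_simps)
        then show ?thesis using x(1) unfolding x(2)[symmetric] by simp
      qed
      ultimately have "x * k * exp (k1 - k0) = 1" by (simp only:)
      then have "x * k * exp (k1 - k0) * exp (- k1) = exp (- k1)" by simp
      then show ?thesis by (simp add: mult.assoc mult_exp_exp)
    qed
    then show ?case
      unfolding 1 unfolding xi_deriv_w[OF z] LG_G_def f_bar_def f_tilde_def q_def[symmetric] g_def[symmetric] k_def[symmetric]
      using gq q by (auto simp: field_simps)
  qed
  with lim show ?thesis by (rule Lim_transform_eventually)
qed

lemma LG_solution_tilde:
  assumes n: "n \<ge> 2"
  shows "LG_solution E_tilde n e u (\<lambda>z. v z * LG_G E_tilde n x f_tilde z)"
proof (rule LG_solution_transform[OF LG_sequence_E_tilde n v_hol ode_v _ has_field_derivative_f_tilde])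
  show "2 * LG_F E_tilde 1 b = (1 - b\<^sup>2)\<^sup>2 * ((- 1)\<^sup>2 * b\<^sup>2 / 4 + (- 1) * (1 - 3 * b\<^sup>2) / 2)" for b
    unfolding LG_F_def deriv_E_tilde_1 by (simp add: field_simps)
  show "((\<lambda>z. v z * LG_G E_tilde n x f_tilde z) \<longlongrightarrow> 1) (LG_at e (9 / 10))"
    by (rule tendsto_v_G[OF LG_sequence_E_tilde])
qed

end

section \<open>Error bounds along admissible paths\<close>

definition LG_T_bound :: "(nat \<Rightarrow> complex \<Rightarrow> complex) \<Rightarrow> nat \<Rightarrow> real \<Rightarrow> complex \<Rightarrow> real" where
  "LG_T_bound E n u b = (\<Sum>s = 1..n - 1. 1 / u ^ s * cmod (LG_F E s b))"

text \<open>Moduli are taken outside the inner sums over k, as in \<open>LG_omega\<close>, so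
  cancellation inside them is kept.\<close>

definition LG_R_bound :: "(nat \<Rightarrow> complex \<Rightarrow> complex) \<Rightarrow> nat \<Rightarrow> real \<Rightarrow> complex \<Rightarrow> real" where
  "LG_R_bound E n u b = 2 / u ^ (n - 1) * cmod (LG_F E n b) +
     (\<Sum>s = 1..n - 1. 1 / u ^ (n - 1 + s) *
        cmod (\<Sum>k = s..n - 1. LG_F E k b * LG_F E (s + n - k - 1) b))"

lemma LG_T_R_le:
  assumes e: "e \<in> {1, -1}" and u: "u > 0"
  shows "cmod (LG_T E n (- \<i> * of_real e / of_real u) b) \<le> LG_T_bound E n u b"
    and "cmod (LG_R E n (- \<i> * of_real e / of_real u) b) \<le> LG_R_bound E n u b"
proof -
  define x where "x = - \<i> * of_real e / complex_of_real u"
  have x: "cmod (x ^ k) = 1 / u ^ k" for k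
    using e u by (auto simp: x_def norm_power norm_divide power_divide)
  show "cmod (LG_T E n (- \<i> * of_real e / of_real u) b) \<le> LG_T_bound E n u b"
    unfolding LG_T_def LG_T_bound_def x_def[symmetric]
    by (rule order.trans[OF norm_sum]) (simp add: norm_mult x)
  show "cmod (LG_R E n (- \<i> * of_real e / of_real u) b) \<le> LG_R_bound E n u b"
    unfolding LG_R_def LG_R_bound_def x_def[symmetric]
    by (rule order.trans[OF norm_triangle_ineq], rule add_mono)
      (auto simp: norm_mult x intro!: order.trans[OF norm_sum])
qed

lemma continuous_LG_bounds:
  assumes E: "LG_sequence E" and f: "continuous_on S f"
  shows "continuous_on S (\<lambda>t. LG_T_bound E n u (f t))" "continuous_on S (\<lambda>t. LG_R_bound E n u (f t))"
proof -
  have F: "continuous_on S (\<lambda>t. LG_F E s (f t))" for s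
    by (rule continuous_on_compose2[OF holomorphic_on_imp_continuous_on[OF holomorphic_LG_F[OF E]] f]) auto
  show "continuous_on S (\<lambda>t. LG_T_bound E n u (f t))" "continuous_on S (\<lambda>t. LG_R_bound E n u (f t))"
    unfolding LG_T_bound_def LG_R_bound_def by (intro continuous_intros F)+
qed

text \<open>The larger modulus of the Gronwall pair, with 1/x = e i u.\<close>

definition LG_err :: "real \<Rightarrow> real \<Rightarrow> (complex \<Rightarrow> complex) \<Rightarrow> complex \<Rightarrow> real" where
  "LG_err e u h z = max (cmod (xi_deriv h z)) (cmod (2 * (\<i> * of_real e * of_real u) * (h z - 1) + xi_deriv h z))"

lemma LG_err_nonneg: "0 \<le> LG_err e u h z"
  by (simp add: LG_err_def le_max_iff_disj)

lemma LG_err_ge: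
  assumes e: "e \<in> {1, -1}" and u: "u > 0"
  shows "u * cmod (h z - 1) \<le> LG_err e u h z"
proof -
  let ?c = "\<i> * complex_of_real e * of_real u"
  have "2 * (u * cmod (h z - 1)) = cmod ((2 * ?c * (h z - 1) + xi_deriv h z) - xi_deriv h z)"
    using e u by (auto simp: norm_mult)
  also have "\<dots> \<le> cmod (2 * ?c * (h z - 1) + xi_deriv h z) + cmod (xi_deriv h z)" by (rule norm_triangle_ineq4)
  also have "\<dots> \<le> 2 * LG_err e u h z" unfolding LG_err_def by simp
  finally show ?thesis by simp
qed

lemma tendsto_LG_err:
  assumes e: "e \<in> {1, -1}" and h: "LG_solution E n e u h"
  shows "(LG_err e u h \<longlongrightarrow> 0) (LG_at e (19 / 20))"
proof -
  have h': "h holomorphic_on cut_plane" "(h \<longlongrightarrow> 1) (LG_at e (9 / 10))"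
    using h by (auto simp: LG_solution_def)
  have 1: "(xi_deriv h \<longlongrightarrow> 0) (LG_at e (19 / 20))"
    by (rule xi_deriv_tendsto_0[OF e h']) auto
  have 2: "(h \<longlongrightarrow> 1) (LG_at e (19 / 20))"
    by (rule tendsto_mono[OF LG_at_mono h'(2)]) simp
  have "(LG_err e u h \<longlongrightarrow> max (cmod 0) (cmod (2 * (\<i> * of_real e * of_real u) * (1 - 1) + 0))) (LG_at e (19 / 20))"
    unfolding LG_err_def[abs_def] by (intro tendsto_intros 1 2)
  then show ?thesis by simp
qed

text \<open>\<open>LG_arc_estimate\<close> for an arc in the z plane, with c = 1/x. As Re (c xi) = -
  e u Im xi, the exponential does not decrease exactly when e Im xi does not increase.\<close>

lemma LG_segment_estimate:
  assumes e: "e \<in> {1, -1}" and u: "u > 0" and E: "LG_sequence E" and h: "LG_solution E n e u h"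
    and st: "s \<le> t"
    and \<gamma>: "\<And>r. r \<in> {s..t} \<Longrightarrow> (\<gamma> has_vector_derivative \<gamma>' r) (at r within {s..t})"
    and cont: "continuous_on {s..t} \<gamma>'"
    and cut: "\<And>r. r \<in> {s..t} \<Longrightarrow> \<gamma> r \<in> cut_plane"
    and mono: "\<And>r r'. s \<le> r \<Longrightarrow> r \<le> r' \<Longrightarrow> r' \<le> t \<Longrightarrow> e * Im (xi_bar (\<gamma> r')) \<le> e * Im (xi_bar (\<gamma> r))"
  defines "d \<equiv> \<lambda>r. cmod (csqrt ((\<gamma> r)\<^sup>2 + 1) * \<gamma>' r)"
  shows "LG_err e u h (\<gamma> t) \<le>
    (LG_err e u h (\<gamma> s) + integral {s..t} (\<lambda>r. LG_R_bound E n u (beta_bar (\<gamma> r)) * d r)) *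
    exp (integral {s..t} (\<lambda>r. 2 * (LG_T_bound E n u (beta_bar (\<gamma> r)) * d r) +
      1 / u * (LG_R_bound E n u (beta_bar (\<gamma> r)) * d r)))"
proof -
  define c where "c = \<i> * complex_of_real e * of_real u"
  define x where "x = - \<i> * of_real e / complex_of_real u"
  have cn: "cmod c = u" "c \<noteq> 0" using e u by (auto simp: c_def norm_mult)
  have hh: "h holomorphic_on cut_plane" using h by (simp add: LG_solution_def)
  have chain: "((\<lambda>r. f (\<gamma> r)) has_vector_derivative xi_deriv f (\<gamma> r) * (csqrt ((\<gamma> r)\<^sup>2 + 1) * \<gamma>' r)) (at r within {s..t})"
    if "f holomorphic_on cut_plane" "r \<in> {s..t}" for f r
    using field_vector_diff_chain_within[OF \<gamma>[OF that(2)]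
        has_field_derivative_at_within[OF has_field_derivative_xi_deriv[OF that(1) cut[OF that(2)]]]]
    by (simp add: o_def mult_ac)
  have c\<gamma>: "continuous_on {s..t} \<gamma>"
    unfolding continuous_on_eq_continuous_within using has_vector_derivative_continuous[OF \<gamma>] by blast
  have cb: "continuous_on {s..t} (\<lambda>r. beta_bar (\<gamma> r))"
    and cq: "continuous_on {s..t} (\<lambda>r. csqrt ((\<gamma> r)\<^sup>2 + 1))"
    using holomorphic_on_cut_plane(1,2)[THEN holomorphic_on_imp_continuous_on] cut
    by (auto intro!: continuous_on_compose2[OF _ c\<gamma>])
  have cd: "continuous_on {s..t} d" unfolding d_def by (intro continuous_intros cont cq)
  let ?R = "\<lambda>r. LG_R_bound E n u (beta_bar (\<gamma> r)) * d r"
  let ?K = "\<lambda>r. 2 * (LG_T_bound E n u (beta_bar (\<gamma> r)) * d r) + 1 / u * ?R r"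
  have cR: "continuous_on {s..t} ?R" and cK: "continuous_on {s..t} ?K"
    by (intro continuous_intros cd continuous_LG_bounds[OF E cb])+
  note est = LG_arc_estimate[of s t c "\<lambda>r. xi_bar (\<gamma> r)" "\<lambda>r. csqrt ((\<gamma> r)\<^sup>2 + 1) * \<gamma>' r"
      "\<lambda>r. h (\<gamma> r) - 1" "\<lambda>r. xi_deriv h (\<gamma> r)" "\<lambda>r. LG_T E n x (beta_bar (\<gamma> r))"
      "\<lambda>r. LG_R E n x (beta_bar (\<gamma> r))" ?K ?R "LG_err e u h (\<gamma> s)", OF st cn(2) _ _ _ _ cK cR]
  have X: "((\<lambda>r. xi_bar (\<gamma> r)) has_vector_derivative csqrt ((\<gamma> r)\<^sup>2 + 1) * \<gamma>' r) (at r within {s..t})"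
    if "r \<in> {s..t}" for r
    using field_vector_diff_chain_within[OF \<gamma>[OF that]
        has_field_derivative_at_within[OF has_field_derivative_xi_bar[OF cut[OF that]]]]
    by (simp add: o_def mult_ac)
  have A: "((\<lambda>r. h (\<gamma> r) - 1) has_vector_derivative xi_deriv h (\<gamma> r) * (csqrt ((\<gamma> r)\<^sup>2 + 1) * \<gamma>' r)) (at r within {s..t})"
    if "r \<in> {s..t}" for r
    using has_vector_derivative_diff_const[THEN iffD2, OF chain[OF hh that]] by simp
  have P: "((\<lambda>r. xi_deriv h (\<gamma> r)) has_vector_derivative (- 2 * (c + LG_T E n x (beta_bar (\<gamma> r))) * xi_deriv h (\<gamma> r) -
      LG_R E n x (beta_bar (\<gamma> r)) * (1 + (h (\<gamma> r) - 1))) * (csqrt ((\<gamma> r)\<^sup>2 + 1) * \<gamma>' r)) (at r within {s..t})"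
    if "r \<in> {s..t}" for r
  proof -
    have "xi_deriv (xi_deriv h) (\<gamma> r) = - 2 * (c + LG_T E n x (beta_bar (\<gamma> r))) * xi_deriv h (\<gamma> r) -
      LG_R E n x (beta_bar (\<gamma> r)) * (1 + (h (\<gamma> r) - 1))"
      using h cut[OF that] unfolding LG_solution_def c_def x_def by simp
    with chain[OF holomorphic_xi_deriv[OF hh] that] show ?thesis by simp
  qed
  have M: "Re (c * xi_bar (\<gamma> r)) \<le> Re (c * xi_bar (\<gamma> r'))" if "s \<le> r" "r \<le> r'" "r' \<le> t" for r r'
    using mult_left_mono[OF mono[OF that], of u] u by (simp add: c_def algebra_simps)
  have K: "(2 * cmod (LG_T E n x (beta_bar (\<gamma> r))) + cmod (LG_R E n x (beta_bar (\<gamma> r))) / cmod c) *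
      cmod (csqrt ((\<gamma> r)\<^sup>2 + 1) * \<gamma>' r) \<le> ?K r" for r
  proof -
    have "(2 * cmod (LG_T E n x (beta_bar (\<gamma> r))) + cmod (LG_R E n x (beta_bar (\<gamma> r))) / cmod c) *
      cmod (csqrt ((\<gamma> r)\<^sup>2 + 1) * \<gamma>' r) \<le>
      (2 * LG_T_bound E n u (beta_bar (\<gamma> r)) + LG_R_bound E n u (beta_bar (\<gamma> r)) / u) * d r"
      unfolding d_def cn x_def using LG_T_R_le[OF e u, of E n "beta_bar (\<gamma> r)"] u
      by (intro mult_right_mono add_mono divide_right_mono mult_left_mono) auto
    then show ?thesis by (simp add: algebra_simps)
  qed
  have R: "cmod (LG_R E n x (beta_bar (\<gamma> r))) * cmod (csqrt ((\<gamma> r)\<^sup>2 + 1) * \<gamma>' r) \<le> ?R r" for r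
    unfolding d_def x_def using LG_T_R_le[OF e u, of E n "beta_bar (\<gamma> r)"]
    by (intro mult_right_mono) auto
  have I: "cmod (xi_deriv h (\<gamma> s)) \<le> LG_err e u h (\<gamma> s)"
    "cmod (2 * c * (h (\<gamma> s) - 1) + xi_deriv h (\<gamma> s)) \<le> LG_err e u h (\<gamma> s)"
    by (simp_all add: LG_err_def c_def)
  show ?thesis
    using est[OF X A P M K R I] unfolding LG_err_def[of e u h "\<gamma> t"] c_def by simp
qed

text \<open>The term z^2 / 2 dominates. With y = z * \<open>LG_rot e\<close>, e Im (z^2) = Re (y^2)
  = 2 (Re y)^2 - |y|^2, at least (2 * 0.81 - 1) |z|^2 in this sector.\<close>

lemma filterlim_Im_xi_bar:
  assumes e: "e \<in> {1, -1}"
  shows "filterlim (\<lambda>z. e * Im (xi_bar z)) at_top (LG_at e (9 / 10))"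
  unfolding filterlim_at_top
proof
  fix Z :: real
  define L where "L = complex_of_real (1 / 4 + ln 2 / 2)"
  define K where "K = cmod L + 1 + pi"
  have "((\<lambda>z. xi_bar z - z\<^sup>2 / 2 - Ln z / 2) \<longlongrightarrow> L) (LG_at e (9 / 10))"
    unfolding L_def by (rule tendsto_mono[OF LG_at_mono tendsto_xi_bar[OF e]]) simp
  then have ev: "\<forall>\<^sub>F z in LG_at e (9 / 10). dist (xi_bar z - z\<^sup>2 / 2 - Ln z / 2) L < 1"
    by (rule tendstoD) simp
  \<comment> \<open>31/100 is half of 62/100 = 2 (9/10)^2 - 1, the half coming from z^2 / 2;
    \<open>K\<close> bounds everything else.\<close>
  have sec: "\<forall>\<^sub>F z in LG_at e (9 / 10). z \<in> LG_sector e (9 / 10) \<and> 1 \<le> cmod z \<and> Z + K \<le> 31 / 100 * cmod z"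
    unfolding eventually_LG_at by (rule exI[of _ "max 1 ((Z + K) * 100 / 31)"]) (auto simp: field_simps)
  from ev sec show "\<forall>\<^sub>F z in LG_at e (9 / 10). Z \<le> e * Im (xi_bar z)"
  proof eventually_elim
    case (elim z)
    have z: "z \<noteq> 0" using elim by auto
    define d where "d = xi_bar z - z\<^sup>2 / 2 - Ln z / 2 - L"
    define y where "y = z * LG_rot e"
    have d: "cmod d \<le> 1" using elim by (simp add: d_def dist_norm)
    have "xi_bar z = z\<^sup>2 / 2 + Ln z / 2 + L + d" by (simp add: d_def)
    then have "e * Im (xi_bar z) = e * Im (z\<^sup>2) / 2 + e * (Im (Ln z) / 2 + Im (L + d))"
      by (simp add: algebra_simps)
    moreover have "\<bar>e * (Im (Ln z) / 2 + Im (L + d))\<bar> \<le> K"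
    proof -
      have "\<bar>Im (Ln z)\<bar> \<le> pi" using mpi_less_Im_Ln[OF z] Im_Ln_le_pi[OF z] by simp
      moreover have "\<bar>Im (L + d)\<bar> \<le> cmod L + 1"
        using abs_Im_le_cmod[of "L + d"] norm_triangle_ineq[of L d] d by linarith
      ultimately have "\<bar>Im (Ln z) / 2 + Im (L + d)\<bar> \<le> K" unfolding K_def using pi_gt_zero by linarith
      then show ?thesis using e by (auto simp: abs_mult)
    qed
    moreover have "e * Im (z\<^sup>2) \<ge> 62 / 100 * (cmod z)\<^sup>2"
    proof -
      have cy: "cmod y = cmod z" by (simp add: y_def norm_mult)
      have "y\<^sup>2 = z\<^sup>2 * (- \<i> * of_real e)" by (simp only: y_def power_mult_distrib LG_rot_sq[OF e])
      then have "e * Im (z\<^sup>2) = Re (y\<^sup>2)" by (simp del: power2_eq_square)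
      also have "\<dots> = 2 * (Re y)\<^sup>2 - (cmod y)\<^sup>2" by (simp add: Re_power2 cmod_power2)
      also have "\<dots> \<ge> 62 / 100 * (cmod z)\<^sup>2"
      proof -
        have "9 / 10 * cmod z \<le> Re y" using elim by (simp add: LG_sector_def y_def)
        then have "(9 / 10 * cmod z)\<^sup>2 \<le> (Re y)\<^sup>2" by (intro power_mono) auto
        then show ?thesis unfolding cy by (simp add: power_mult_distrib power_divide)
      qed
      finally show ?thesis .
    qed
    moreover have "(cmod z)\<^sup>2 \<ge> cmod z" using elim by (simp add: power2_eq_square mult_le_cancel_left1)
    moreover have "Z \<le> X" if "X = Q / 2 + P" "\<bar>P\<bar> \<le> K" "62 / 100 * c2 \<le> Q" "c \<le> c2"
      "Z + K \<le> 31 / 100 * c" for X Q P c c2 :: real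
      using that by simp
    ultimately show ?case using elim by blast
  qed
qed

lemma filterlim_path_LG_at:
  assumes e: "e \<in> {1, -1}" and k: "k < 1"
    and inf: "filterlim \<gamma> at_infinity F" and arg: "((\<lambda>t. Arg (\<gamma> t)) \<longlongrightarrow> e * pi / 4) F"
  shows "filterlim \<gamma> (LG_at e k) F"
  unfolding LG_at_def filterlim_inf filterlim_principal
proof (intro conjI inf)
  have "((\<lambda>t. cos (Arg (\<gamma> t) - e * pi / 4)) \<longlongrightarrow> cos (e * pi / 4 - e * pi / 4)) F"
    by (rule isCont_tendsto_compose[OF _ tendsto_diff[OF arg tendsto_const]]) simp
  then have "\<forall>\<^sub>F t in F. k < cos (Arg (\<gamma> t) - e * pi / 4)"
    by (rule order_tendstoD) (use k in simp)
  moreover have "\<forall>\<^sub>F t in F. \<gamma> t \<noteq> 0"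
    using inf by (simp add: filterlim_at_infinity_imp_eventually_ne)
  ultimately show "\<forall>\<^sub>F t in F. \<gamma> t \<in> LG_sector e k"
  proof eventually_elim
    case (elim t)
    have "\<gamma> t = of_real (cmod (\<gamma> t)) * exp (\<i> * of_real (Arg (\<gamma> t)))"
      using Arg_eq[OF elim(2)] .
    then have "\<gamma> t * LG_rot e = of_real (cmod (\<gamma> t)) * (exp (\<i> * of_real (Arg (\<gamma> t))) * LG_rot e)"
      by (metis mult.assoc)
    also have "exp (\<i> * of_real (Arg (\<gamma> t))) * LG_rot e = exp (\<i> * of_real (Arg (\<gamma> t) - e * pi / 4))"
      unfolding LG_rot_def mult_exp_exp by (rule arg_cong[where f = exp]) (simp add: algebra_simps)
    finally have "\<gamma> t * LG_rot e = of_real (cmod (\<gamma> t)) * exp (\<i> * of_real (Arg (\<gamma> t) - e * pi / 4))" .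
    moreover have "Re (of_real r * exp (\<i> * of_real y)) = r * cos y" for r y by (simp add: Re_exp)
    ultimately have "Re (\<gamma> t * LG_rot e) = cmod (\<gamma> t) * cos (Arg (\<gamma> t) - e * pi / 4)"
      by (simp only:)
    moreover have "cmod (\<gamma> t) * k \<le> cmod (\<gamma> t) * cos (Arg (\<gamma> t) - e * pi / 4)"
      using elim by (intro mult_left_mono) auto
    ultimately show ?case by (simp only: LG_sector_def mem_Collect_eq mult.commute)
  qed
qed

text \<open>\<open>LG_path\<close> leaves the sense of monotonicity open. At the start e Im xi tends
  to infinity, so somewhere it exceeds its value at z, which only the nonincreasing alternative
  allows.\<close>

lemma LG_path_properties:
  assumes e: "e \<in> {1, -1}" and path: "LG_path (e * pi / 4) z \<gamma>"
  shows "k < 1 \<Longrightarrow> filterlim \<gamma> (LG_at e k) at_bot"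
    and "r \<le> r' \<Longrightarrow> r' \<le> 0 \<Longrightarrow> e * Im (xi_bar (\<gamma> r')) \<le> e * Im (xi_bar (\<gamma> r))"
proof -
  show lim: "filterlim \<gamma> (LG_at e k) at_bot" if "k < 1" for k
    using path that unfolding LG_path_def by (intro filterlim_path_LG_at[OF e]) auto
  let ?f = "\<lambda>t. Im (xi_bar (\<gamma> t))"
  have "filterlim (\<lambda>t. e * ?f t) at_top at_bot"
    by (rule filterlim_compose[OF filterlim_Im_xi_bar[OF e] lim]) simp
  then have "\<forall>\<^sub>F t in at_bot. e * ?f 0 + 1 \<le> e * ?f t"
    by (simp add: filterlim_at_top)
  with eventually_le_at_bot[of 0] have "\<forall>\<^sub>F t in at_bot. t \<le> 0 \<and> e * ?f 0 + 1 \<le> e * ?f t"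
    by eventually_elim auto
  then obtain t where t: "t \<le> 0" "e * ?f 0 < e * ?f t"
    using eventually_happens[of _ "at_bot :: real filter"] by (fastforce simp: trivial_limit_at_bot_linorder)
  assume r: "r \<le> r'" "r' \<le> 0"
  from path consider "monotone_on {..0} (\<le>) (\<le>) ?f" | "monotone_on {..0} (\<le>) (\<ge>) ?f"
    unfolding LG_path_def by blast
  then show "e * ?f r' \<le> e * ?f r"
  proof cases
    case 1
    then have "?f t \<le> ?f 0" "?f r \<le> ?f r'" using t r by (auto simp: monotone_on_def)
    with t e show ?thesis by auto
  next
    case 2
    then have "?f 0 \<le> ?f t" "?f r' \<le> ?f r" using t r by (auto simp: monotone_on_def)
    with t e show ?thesis by auto
  qed
qed

text \<open>Only a finite piece of the path is covered, hence an inequality. The arcs bring their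
  own derivatives; these agree with the \<open>vector_derivative\<close> of the whole path except
  possibly at the breakpoints, which form a null set.\<close>

lemma beta_abs_integral_ge:
  fixes \<sigma> :: "nat \<Rightarrow> real"
  assumes \<sigma>: "\<And>i. i < K \<Longrightarrow> \<sigma> i < \<sigma> (Suc i)" "\<sigma> K = 0"
    and \<gamma>: "\<And>i r. i < K \<Longrightarrow> r \<in> {\<sigma> i..\<sigma> (Suc i)} \<Longrightarrow> (\<gamma> has_vector_derivative \<gamma>' i r) (at r within {\<sigma> i..\<sigma> (Suc i)})"
    and cont: "\<And>i. i < K \<Longrightarrow> continuous_on {\<sigma> i..\<sigma> (Suc i)} (\<gamma>' i)"
    and cut: "\<And>r. r \<le> 0 \<Longrightarrow> \<gamma> r \<in> cut_plane"
    and g: "continuous_on UNIV g"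
  shows "ennreal (\<Sum>i<K. integral {\<sigma> i..\<sigma> (Suc i)} (\<lambda>t. cmod (g (beta_bar (\<gamma> t)) *
     ((1 - (beta_bar (\<gamma> t))\<^sup>2)\<^sup>2 * (csqrt ((\<gamma> t)\<^sup>2 + 1) * \<gamma>' i t))))) \<le> beta_abs_integral \<gamma> g"
proof -
  define f where "f i t = cmod (g (beta_bar (\<gamma> t)) *
     ((1 - (beta_bar (\<gamma> t))\<^sup>2)\<^sup>2 * (csqrt ((\<gamma> t)\<^sup>2 + 1) * \<gamma>' i t)))" for i t
  define \<phi> where "\<phi> t = ennreal (cmod (g (beta_bar (\<gamma> t)) *
        vector_derivative (\<lambda>r. beta_bar (\<gamma> r)) (at t)))" for t
  have \<sigma>mono: "\<sigma> i \<le> \<sigma> j" if "i \<le> j" "j \<le> K" for i j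
    using that
  proof (induction rule: dec_induct)
    case (step j)
    then show ?case using \<sigma>(1)[of j] by simp
  qed simp
  have sub: "{\<sigma> i..\<sigma> (Suc i)} \<subseteq> {..0}" if "i < K" for i
    using \<sigma>mono[of "Suc i" K] that \<sigma>(2) by auto
  have cf: "continuous_on {\<sigma> i..\<sigma> (Suc i)} (f i)" if i: "i < K" for i
  proof -
    have c\<gamma>: "continuous_on {\<sigma> i..\<sigma> (Suc i)} \<gamma>"
      unfolding continuous_on_eq_continuous_within using has_vector_derivative_continuous[OF \<gamma>[OF i]] by blast
    have cb: "continuous_on {\<sigma> i..\<sigma> (Suc i)} (\<lambda>r. beta_bar (\<gamma> r))"
      and cq: "continuous_on {\<sigma> i..\<sigma> (Suc i)} (\<lambda>r. csqrt ((\<gamma> r)\<^sup>2 + 1))"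
      using holomorphic_on_cut_plane(1,2)[THEN holomorphic_on_imp_continuous_on] cut sub[OF i]
      by (auto intro!: continuous_on_compose2[OF _ c\<gamma>])
    show ?thesis
      unfolding f_def
      by (intro continuous_intros cb cq cont i continuous_on_compose2[OF g cb]) auto
  qed
  have int: "ennreal (integral {\<sigma> i..\<sigma> (Suc i)} (f i)) =
      (\<integral>\<^sup>+t. ennreal (f i t) * indicator {\<sigma> i..\<sigma> (Suc i)} t \<partial>lborel)" if i: "i < K" for i
  proof -
    note si = borel_integrable_atLeastAtMost'[OF cf[OF i]]
    have "(\<integral>\<^sup>+t. ennreal (f i t) * indicator {\<sigma> i..\<sigma> (Suc i)} t \<partial>lborel) =
        (\<integral>\<^sup>+t. ennreal (indicator {\<sigma> i..\<sigma> (Suc i)} t *\<^sub>R f i t) \<partial>lborel)"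
      by (intro nn_integral_cong) (auto simp: indicator_def)
    also have "\<dots> = ennreal (LINT t : {\<sigma> i..\<sigma> (Suc i)} | lborel. f i t)"
      using si unfolding set_lebesgue_integral_def set_integrable_def
      by (intro nn_integral_eq_integral) (auto simp: f_def)
    finally show ?thesis using set_borel_integral_eq_integral(2)[OF si] by simp
  qed
  have meas: "(\<lambda>t. ennreal (f i t) * indicator {\<sigma> i..\<sigma> (Suc i)} t) \<in> borel_measurable lborel" if i: "i < K" for i
  proof -
    have "(\<lambda>t. indicator {\<sigma> i..\<sigma> (Suc i)} t *\<^sub>R f i t) \<in> borel_measurable borel"
      by (rule borel_measurable_continuous_on_indicator[OF _ cf[OF i]]) simp
    then have "(\<lambda>t. ennreal (indicator {\<sigma> i..\<sigma> (Suc i)} t *\<^sub>R f i t)) \<in> borel_measurable lborel" by simp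
    also have "(\<lambda>t. ennreal (indicator {\<sigma> i..\<sigma> (Suc i)} t *\<^sub>R f i t)) =
        (\<lambda>t. ennreal (f i t) * indicator {\<sigma> i..\<sigma> (Suc i)} t)"
      by (auto simp: fun_eq_iff indicator_def)
    finally show ?thesis .
  qed
  \<comment> \<open>Away from the breakpoints at most one arc contains t, so the sum has at most one
    nonzero term.\<close>
  have le: "(\<Sum>i<K. ennreal (f i t) * indicator {\<sigma> i..\<sigma> (Suc i)} t) \<le> \<phi> t * indicator {..0} t"
    if t: "t \<notin> \<sigma> ` {..K}" for t
  proof (cases "\<exists>i<K. t \<in> {\<sigma> i..\<sigma> (Suc i)}")
    case True
    then obtain i where i: "i < K" "t \<in> {\<sigma> i..\<sigma> (Suc i)}" by blast
    have "t \<noteq> \<sigma> i" "t \<noteq> \<sigma> (Suc i)" using t i by auto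
    then have ti: "\<sigma> i < t" "t < \<sigma> (Suc i)" using i by auto
    have only: "t \<notin> {\<sigma> j..\<sigma> (Suc j)}" if "j < K" "j \<noteq> i" for j
      using \<sigma>mono[of "Suc i" j] \<sigma>mono[of "Suc j" i] ti that i by (cases "i < j") auto
    have "(\<Sum>i<K. ennreal (f i t) * indicator {\<sigma> i..\<sigma> (Suc i)} t) =
        (\<Sum>j<K. if j = i then ennreal (f i t) else 0)"
      using only i by (intro sum.cong) auto
    also have "\<dots> = ennreal (f i t)" using i by simp
    also have "\<dots> = \<phi> t"
    proof -
      have "(\<gamma> has_vector_derivative \<gamma>' i t) (at t)"
        using \<gamma>[OF i] ti at_within_Icc_at[of "\<sigma> i" t "\<sigma> (Suc i)"] by simp
      from field_vector_diff_chain_at[OF this has_field_derivative_beta_bar] cut sub[OF i(1)] i(2)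
      have "((\<lambda>r. beta_bar (\<gamma> r)) has_vector_derivative
          \<gamma>' i t * ((1 - (beta_bar (\<gamma> t))\<^sup>2)\<^sup>2 * csqrt ((\<gamma> t)\<^sup>2 + 1))) (at t)"
        by (auto simp: o_def)
      from vector_derivative_at[OF this] show ?thesis
        by (simp add: f_def \<phi>_def mult_ac)
    qed
    finally show ?thesis using sub[OF i(1)] i(2) by auto
  qed auto
  have "ennreal (\<Sum>i<K. integral {\<sigma> i..\<sigma> (Suc i)} (f i)) = (\<Sum>i<K. ennreal (integral {\<sigma> i..\<sigma> (Suc i)} (f i)))"
    by (rule sum_ennreal[symmetric], rule integral_nonneg[OF integrable_continuous_interval[OF cf]])
      (auto simp: f_def)
  also have "\<dots> = (\<Sum>i<K. \<integral>\<^sup>+t. ennreal (f i t) * indicator {\<sigma> i..\<sigma> (Suc i)} t \<partial>lborel)"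
    by (intro sum.cong refl int) auto
  also have "\<dots> = (\<integral>\<^sup>+t. (\<Sum>i<K. ennreal (f i t) * indicator {\<sigma> i..\<sigma> (Suc i)} t) \<partial>lborel)"
    by (rule nn_integral_sum[symmetric]) (rule meas, simp)
  also have "\<dots> \<le> (\<integral>\<^sup>+t. \<phi> t * indicator {..0} t \<partial>lborel)"
  proof (rule nn_integral_mono_AE)
    have "AE t in lborel. t \<notin> \<sigma> ` {..K}"
      by (intro AE_not_in finite_imp_null_set_lborel) simp
    then show "AE t in lborel. (\<Sum>i<K. ennreal (f i t) * indicator {\<sigma> i..\<sigma> (Suc i)} t) \<le> \<phi> t * indicator {..0} t"
      by eventually_elim (rule le)
  qed
  finally show ?thesis unfolding beta_abs_integral_def f_def \<phi>_def .
qed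

text \<open>The path is cut off at a parameter t0, the arc estimates are chained, and t0 tends to
  minus infinity, where \<open>LG_err\<close> tends to 0. Finiteness allows the extended integrals
  to be treated as reals.\<close>

lemma LG_path_estimate:
  assumes e: "e \<in> {1, -1}" and u: "u > 0" and E: "LG_sequence E" and n: "n \<ge> 2"
    and h: "LG_solution E n e u h" and path: "LG_path (e * pi / 4) z \<gamma>"
    and fin: "LG_varpi E n u \<gamma> < \<infinity>" "LG_omega E n u \<gamma> < \<infinity>"
  shows "cmod (h z - 1) \<le> enn2real (LG_omega E n u \<gamma>) / u ^ n *
        exp (enn2real (LG_varpi E n u \<gamma>) / u + enn2real (LG_omega E n u \<gamma>) / u ^ n)"
proof -
  define G where "G s p = (\<Sum>k = s..n - 1. (1 - p\<^sup>2)\<^sup>2 * deriv (E k) p * deriv (E (s + n - k - 1)) p)" for s p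
  have GG: "G s = (\<lambda>p. \<Sum>k = s..n - 1. (1 - p\<^sup>2)\<^sup>2 * deriv (E k) p * deriv (E (s + n - k - 1)) p)" for s
    by (simp add: G_def fun_eq_iff)
  define A where "A g = enn2real (beta_abs_integral \<gamma> g)" for g
  have u0: "1 / u ^ s > 0" for s using u by simp
  \<comment> \<open>All weights 1 / u^s are positive, so a finite weighted sum forces each integral
    to be finite.\<close>
  have finA: "beta_abs_integral \<gamma> (deriv (E s)) < \<infinity>" if "s \<in> {1..n - 1}" for s
  proof -
    have "(\<Sum>s = 0..n - 2. ennreal (1 / u ^ s) * beta_abs_integral \<gamma> (deriv (E (s + 1)))) < \<infinity>"
      using fin(1) unfolding LG_varpi_def by (auto simp: ennreal_mult_less_top)
    moreover have "s - 1 \<in> {0..n - 2}" using that by auto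
    ultimately have "ennreal (1 / u ^ (s - 1)) * beta_abs_integral \<gamma> (deriv (E (s - 1 + 1))) < \<infinity>"
      using member_le_sum[of "s - 1" "{0..n - 2}" "\<lambda>s. ennreal (1 / u ^ s) * beta_abs_integral \<gamma> (deriv (E (s + 1)))"]
      by (auto intro: le_less_trans)
    then show ?thesis using that u u0[of "s - 1"] by (auto simp: ennreal_mult_less_top)
  qed
  have finO: "beta_abs_integral \<gamma> (deriv (E n)) < \<infinity>" "\<And>s. s \<in> {1..n - 1} \<Longrightarrow> beta_abs_integral \<gamma> (G s) < \<infinity>"
  proof -
    have 1: "2 * beta_abs_integral \<gamma> (deriv (E n)) < \<infinity>"
      "(\<Sum>s = 1..n - 1. ennreal (1 / u ^ s) * beta_abs_integral \<gamma> (G s)) < \<infinity>"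
      using fin(2) unfolding LG_omega_def GG[symmetric] by auto
    then show "beta_abs_integral \<gamma> (deriv (E n)) < \<infinity>" by (auto simp: ennreal_mult_less_top)
    show "beta_abs_integral \<gamma> (G s) < \<infinity>" if "s \<in> {1..n - 1}" for s
    proof -
      have "ennreal (1 / u ^ s) * beta_abs_integral \<gamma> (G s) < \<infinity>"
        by (rule le_less_trans[OF member_le_sum[OF that] 1(2)]) auto
      then show ?thesis using u u0[of s] by (auto simp: ennreal_mult_less_top)
    qed
  qed
  have A: "beta_abs_integral \<gamma> g = ennreal (A g)" if "beta_abs_integral \<gamma> g < \<infinity>" for g
    using that by (simp add: A_def)
  have A0: "A g \<ge> 0" for g by (simp add: A_def)
  have em: "ennreal (1 / u ^ s) * ennreal (A g) = ennreal (1 / u ^ s * A g)" for s g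
    by (rule ennreal_mult[symmetric]) (use A0 u0[of s] in auto)
  have pos: "0 \<le> 1 / u ^ s * A g" for s g using A0 u0[of s] by (intro mult_nonneg_nonneg) auto
  have num: "numeral v * ennreal y = ennreal (numeral v * y)" if "y \<ge> 0" for v y
    using that by (simp add: ennreal_mult)
  have varpi: "enn2real (LG_varpi E n u \<gamma>) = 4 * (\<Sum>s = 0..n - 2. 1 / u ^ s * A (deriv (E (s + 1))))"
  proof -
    have "(\<Sum>s = 0..n - 2. ennreal (1 / u ^ s) * beta_abs_integral \<gamma> (deriv (E (s + 1)))) =
        (\<Sum>s = 0..n - 2. ennreal (1 / u ^ s * A (deriv (E (s + 1)))))"
    proof (rule sum.cong)
      fix s assume "s \<in> {0..n - 2}"
      then have "s + 1 \<in> {1..n - 1}" using n by auto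
      from A[OF finA[OF this]] show "ennreal (1 / u ^ s) * beta_abs_integral \<gamma> (deriv (E (s + 1))) =
          ennreal (1 / u ^ s * A (deriv (E (s + 1))))" by (simp only: em)
    qed simp
    also have "\<dots> = ennreal (\<Sum>s = 0..n - 2. 1 / u ^ s * A (deriv (E (s + 1))))"
      by (rule sum_ennreal) (rule pos)
    finally have "LG_varpi E n u \<gamma> = ennreal (4 * (\<Sum>s = 0..n - 2. 1 / u ^ s * A (deriv (E (s + 1)))))"
      unfolding LG_varpi_def using num[OF sum_nonneg[OF pos]] by simp
    moreover have "0 \<le> 4 * (\<Sum>s = 0..n - 2. 1 / u ^ s * A (deriv (E (s + 1))))"
      by (intro mult_nonneg_nonneg sum_nonneg pos) simp
    ultimately show ?thesis by (simp only: enn2real_ennreal)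
  qed
  define O' where "O' = 2 * A (deriv (E n)) + (\<Sum>s = 1..n - 1. 1 / u ^ s * A (G s))"
  have O0: "O' \<ge> 0" unfolding O'_def using A0 sum_nonneg[OF pos] by (intro add_nonneg_nonneg) auto
  have omega: "enn2real (LG_omega E n u \<gamma>) = O'"
  proof -
    have "(\<Sum>s = 1..n - 1. ennreal (1 / u ^ s) * beta_abs_integral \<gamma> (G s)) =
        (\<Sum>s = 1..n - 1. ennreal (1 / u ^ s * A (G s)))"
      by (intro sum.cong refl) (simp only: em A[OF finO(2)])
    also have "\<dots> = ennreal (\<Sum>s = 1..n - 1. 1 / u ^ s * A (G s))"
      by (rule sum_ennreal) (rule pos)
    finally have "LG_omega E n u \<gamma> = ennreal (2 * A (deriv (E n))) + ennreal (\<Sum>s = 1..n - 1. 1 / u ^ s * A (G s))"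
      unfolding LG_omega_def GG[symmetric] A[OF finO(1)] num[OF A0] by simp
    also have "\<dots> = ennreal O'"
      unfolding O'_def by (rule ennreal_plus[symmetric]) (use A0 sum_nonneg[OF pos] in auto)
    finally show ?thesis using O0 by simp
  qed
  define P where "P = enn2real (LG_varpi E n u \<gamma>)"
  have contE: "continuous_on UNIV (deriv (E s))" for s
    using E unfolding LG_sequence_def
    by (intro holomorphic_on_imp_continuous_on holomorphic_deriv) auto
  have contG: "continuous_on UNIV (G s)" for s
    unfolding G_def by (intro continuous_intros contE)
  from path obtain k \<tau> where \<tau>: "\<tau> k = 0" "\<And>i. i < k \<Longrightarrow> \<tau> i < \<tau> (Suc i)"
    "R2_arc_on {..\<tau> 0} \<gamma>" "\<And>i. i < k \<Longrightarrow> R2_arc_on {\<tau> i..\<tau> (Suc i)} \<gamma>"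
    unfolding LG_path_def R2_chain_def by blast
  have cut: "\<gamma> r \<in> cut_plane" if "r \<le> 0" for r
    using path that unfolding LG_path_def by auto
  have z: "\<gamma> 0 = z" using path unfolding LG_path_def by auto
  have arc: "\<exists>\<gamma>'. continuous_on {a..b} \<gamma>' \<and> (\<forall>r\<in>{a..b}. (\<gamma> has_vector_derivative \<gamma>' r) (at r within {a..b}))"
    if arc: "R2_arc_on I \<gamma>" and sub: "{a..b} \<subseteq> I" for I a b
  proof -
    obtain \<gamma>' \<gamma>'' where d: "\<And>t. t \<in> I \<Longrightarrow> (\<gamma> has_vector_derivative \<gamma>' t) (at t within I)"
      "\<And>t. t \<in> I \<Longrightarrow> (\<gamma>' has_vector_derivative \<gamma>'' t) (at t within I)"
      using arc unfolding R2_arc_on_def by blast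
    have "continuous_on I \<gamma>'"
      unfolding continuous_on_eq_continuous_within using has_vector_derivative_continuous[OF d(2)] by blast
    then show ?thesis
      using continuous_on_subset[OF _ sub] has_vector_derivative_within_subset[OF d(1) sub] sub by blast
  qed
  have main: "LG_err e u h z \<le> (LG_err e u h (\<gamma> t0) + u * (O' / u ^ n)) * exp (P / u + O' / u ^ n)"
    if t0: "t0 < \<tau> 0" for t0
  proof -
    \<comment> \<open>Arc 0 is the retained part of the unbounded arc, from t0 to
      \<open>\<tau> 0\<close>; the given bounded arcs follow with their indices shifted by
      one.\<close>
    define \<sigma> where "\<sigma> i = (case i of 0 \<Rightarrow> t0 | Suc j \<Rightarrow> \<tau> j)" for i
    have \<sigma>0: "\<sigma> 0 = t0" "\<sigma> (Suc k) = 0" by (simp_all add: \<sigma>_def \<tau>)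
    have \<sigma>: "\<sigma> i < \<sigma> (Suc i)" if "i < Suc k" for i
      using that t0 \<tau>(2) by (auto simp: \<sigma>_def split: nat.splits)
    have "\<exists>\<gamma>'. \<forall>i<Suc k. continuous_on {\<sigma> i..\<sigma> (Suc i)} (\<gamma>' i) \<and>
        (\<forall>r\<in>{\<sigma> i..\<sigma> (Suc i)}. (\<gamma> has_vector_derivative \<gamma>' i r) (at r within {\<sigma> i..\<sigma> (Suc i)}))"
    proof (intro choice allI)
      fix i
      show "\<exists>\<gamma>'. i < Suc k \<longrightarrow> continuous_on {\<sigma> i..\<sigma> (Suc i)} \<gamma>' \<and>
          (\<forall>r\<in>{\<sigma> i..\<sigma> (Suc i)}. (\<gamma> has_vector_derivative \<gamma>' r) (at r within {\<sigma> i..\<sigma> (Suc i)}))"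
        using arc[OF \<tau>(3), of "\<sigma> 0" "\<sigma> (Suc 0)"] arc[OF \<tau>(4), of "i - 1" "\<sigma> i" "\<sigma> (Suc i)"]
        by (cases i) (auto simp: \<sigma>_def)
    qed
    then obtain \<gamma>' where cont: "\<And>i. i < Suc k \<Longrightarrow> continuous_on {\<sigma> i..\<sigma> (Suc i)} (\<gamma>' i)"
      and \<gamma>': "\<And>i r. i < Suc k \<Longrightarrow> r \<in> {\<sigma> i..\<sigma> (Suc i)} \<Longrightarrow>
        (\<gamma> has_vector_derivative \<gamma>' i r) (at r within {\<sigma> i..\<sigma> (Suc i)})"
      by blast
    have \<sigma>mono: "\<sigma> i \<le> \<sigma> j" if "i \<le> j" "j \<le> Suc k" for i j
      using that
    proof (induction rule: dec_induct)
      case (step j)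
      then show ?case using \<sigma>[of j] by simp
    qed simp
    have le0: "r \<le> 0" if "i < Suc k" "r \<in> {\<sigma> i..\<sigma> (Suc i)}" for i r
      using \<sigma>mono[of "Suc i" "Suc k"] that \<sigma>0(2) by auto
    define d where "d i r = csqrt ((\<gamma> r)\<^sup>2 + 1) * \<gamma>' i r" for i r
    define b where "b r = beta_bar (\<gamma> r)" for r
    define J where "J i g = integral {\<sigma> i..\<sigma> (Suc i)} (\<lambda>r. cmod (g (b r) * ((1 - (b r)\<^sup>2)\<^sup>2 * d i r)))" for i g
    have J: "(\<Sum>i<Suc k. J i g) \<le> A g" if "continuous_on UNIV g" "beta_abs_integral \<gamma> g < \<infinity>" for g
      using beta_abs_integral_ge[of "Suc k" \<sigma> \<gamma> \<gamma>' g, OF \<sigma> \<sigma>0(2) \<gamma>' cont cut that(1)] A0[of g]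
      unfolding A[OF that(2)] J_def b_def d_def by simp
    have c: "continuous_on {\<sigma> i..\<sigma> (Suc i)} (d i)" "continuous_on {\<sigma> i..\<sigma> (Suc i)} b" if i: "i < Suc k" for i
    proof -
      have c\<gamma>: "continuous_on {\<sigma> i..\<sigma> (Suc i)} \<gamma>"
        unfolding continuous_on_eq_continuous_within using has_vector_derivative_continuous[OF \<gamma>'[OF i]] by blast
      have cq: "continuous_on {\<sigma> i..\<sigma> (Suc i)} (\<lambda>r. csqrt ((\<gamma> r)\<^sup>2 + 1))"
        using cut le0[OF i]
        by (intro continuous_on_compose2[OF holomorphic_on_imp_continuous_on[OF holomorphic_on_cut_plane(1)] c\<gamma>]) auto
      show "continuous_on {\<sigma> i..\<sigma> (Suc i)} b"
        unfolding b_def using cut le0[OF i]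
        by (intro continuous_on_compose2[OF holomorphic_on_imp_continuous_on[OF holomorphic_on_cut_plane(2)] c\<gamma>]) auto
      show "continuous_on {\<sigma> i..\<sigma> (Suc i)} (d i)"
        unfolding d_def by (intro continuous_intros cq cont i)
    qed
    have int: "(\<lambda>r. cmod (g (b r) * ((1 - (b r)\<^sup>2)\<^sup>2 * d i r))) integrable_on {\<sigma> i..\<sigma> (Suc i)}"
      if "i < Suc k" "continuous_on UNIV g" for i g
      using c[OF that(1)]
      by (intro integrable_continuous_interval continuous_intros continuous_on_compose2[OF that(2)]) auto
    define IR where "IR i = integral {\<sigma> i..\<sigma> (Suc i)} (\<lambda>r. LG_R_bound E n u (b r) * cmod (d i r))" for i
    define IT where "IT i = integral {\<sigma> i..\<sigma> (Suc i)} (\<lambda>r. LG_T_bound E n u (b r) * cmod (d i r))" for i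
    have IR: "IR i = 2 / u ^ (n - 1) * J i (deriv (E n)) + (\<Sum>s = 1..n - 1. 1 / u ^ (n - 1 + s) * J i (G s))"
      if i: "i < Suc k" for i
    proof -
      have eq: "(\<lambda>r. LG_R_bound E n u (b r) * cmod (d i r)) =
        (\<lambda>r. 2 / u ^ (n - 1) * cmod (deriv (E n) (b r) * ((1 - (b r)\<^sup>2)\<^sup>2 * d i r)) +
          (\<Sum>s = 1..n - 1. 1 / u ^ (n - 1 + s) * cmod (G s (b r) * ((1 - (b r)\<^sup>2)\<^sup>2 * d i r))))"
      proof
        fix r
        have S: "(\<Sum>k = s..n - 1. LG_F E k (b r) * LG_F E (s + n - k - 1) (b r)) = G s (b r) * (1 - (b r)\<^sup>2)\<^sup>2" for s
          unfolding LG_F_def G_def sum_distrib_right by (intro sum.cong) (auto simp: mult_ac)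
        show "LG_R_bound E n u (b r) * cmod (d i r) = 2 / u ^ (n - 1) * cmod (deriv (E n) (b r) * ((1 - (b r)\<^sup>2)\<^sup>2 * d i r)) +
          (\<Sum>s = 1..n - 1. 1 / u ^ (n - 1 + s) * cmod (G s (b r) * ((1 - (b r)\<^sup>2)\<^sup>2 * d i r)))"
          unfolding LG_R_bound_def S LG_F_def[of E n] distrib_right sum_distrib_right
          by (intro arg_cong2[where f = "(+)"] sum.cong) (simp_all add: norm_mult mult_ac)
      qed
      show ?thesis
        unfolding IR_def eq J_def
        by (subst integral_add, simp_all only: integral_mult_right integral_sum finite_atLeastAtMost)
          (intro integrable_on_mult_right integrable_sum finite_atLeastAtMost int i contE contG
            | subst integral_sum | simp)+
    qed
    have IT: "IT i = (\<Sum>s = 1..n - 1. 1 / u ^ s * J i (deriv (E s)))" if i: "i < Suc k" for i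
    proof -
      have eq: "(\<lambda>r. LG_T_bound E n u (b r) * cmod (d i r)) =
        (\<lambda>r. \<Sum>s = 1..n - 1. 1 / u ^ s * cmod (deriv (E s) (b r) * ((1 - (b r)\<^sup>2)\<^sup>2 * d i r)))"
        unfolding LG_T_bound_def LG_F_def sum_distrib_right
        by (intro ext sum.cong) (simp_all add: norm_mult mult_ac)
      show ?thesis
        unfolding IT_def eq J_def integral_mult_right[symmetric]
        by (rule integral_sum[OF finite_atLeastAtMost])
          (intro integrable_on_mult_right int i contE)
    qed
    have IR0: "IR i \<ge> 0" and IT0: "IT i \<ge> 0" if i: "i < Suc k" for i
    proof -
      have "0 \<le> LG_R_bound E n u y" "0 \<le> LG_T_bound E n u y" for y
        using u by (auto simp: LG_R_bound_def LG_T_bound_def intro!: add_nonneg_nonneg sum_nonneg)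
      then show "IR i \<ge> 0" "IT i \<ge> 0"
        unfolding IR_def IT_def using c[OF i]
        by (auto intro!: integral_nonneg integrable_continuous_interval continuous_intros continuous_LG_bounds[OF E])
    qed
    have sumR: "(\<Sum>i<Suc k. IR i) \<le> u * (O' / u ^ n)"
    proof -
      have "(\<Sum>i<Suc k. IR i) = 2 / u ^ (n - 1) * (\<Sum>i<Suc k. J i (deriv (E n))) +
          (\<Sum>s = 1..n - 1. 1 / u ^ (n - 1 + s) * (\<Sum>i<Suc k. J i (G s)))"
      proof -
        have "(\<Sum>i<Suc k. IR i) = (\<Sum>i<Suc k. 2 / u ^ (n - 1) * J i (deriv (E n)) + (\<Sum>s = 1..n - 1. 1 / u ^ (n - 1 + s) * J i (G s)))"
          by (intro sum.cong IR) auto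
        then show ?thesis
          unfolding sum.distrib sum_distrib_left
          by (rule trans) (intro arg_cong2[where f = "(+)"] refl sum.swap)
      qed
      also have "\<dots> \<le> 2 / u ^ (n - 1) * A (deriv (E n)) + (\<Sum>s = 1..n - 1. 1 / u ^ (n - 1 + s) * A (G s))"
        using u by (intro add_mono mult_left_mono sum_mono J contE contG finO) auto
      also have "\<dots> = 1 / u ^ (n - 1) * O'"
        unfolding O'_def by (simp add: distrib_left sum_distrib_left power_add)
      also have "\<dots> = u * (O' / u ^ n)"
        using u n by (cases n) auto
      finally show ?thesis .
    qed
    \<comment> \<open>The Gronwall exponent contains 2 |T|, which the factor 4 in
      \<open>LG_varpi\<close> covers.\<close>
    have sumT: "2 * (\<Sum>i<Suc k. IT i) \<le> P / u"
    proof -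
      have "(\<Sum>i<Suc k. IT i) = (\<Sum>s = 1..n - 1. 1 / u ^ s * (\<Sum>i<Suc k. J i (deriv (E s))))"
      proof -
        have "(\<Sum>i<Suc k. IT i) = (\<Sum>i<Suc k. \<Sum>s = 1..n - 1. 1 / u ^ s * J i (deriv (E s)))"
          by (intro sum.cong IT) auto
        then show ?thesis unfolding sum_distrib_left by (rule trans) (rule sum.swap)
      qed
      also have "\<dots> \<le> (\<Sum>s = 1..n - 1. 1 / u ^ s * A (deriv (E s)))"
        using u by (intro mult_left_mono sum_mono J contE finA) auto
      also have "\<dots> = (\<Sum>s = 0..n - 2. 1 / u ^ (s + 1) * A (deriv (E (s + 1))))"
        by (rule sum.reindex_bij_witness[of _ "\<lambda>s. s + 1" "\<lambda>s. s - 1"]) (use n in auto)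
      also have "\<dots> = (\<Sum>s = 0..n - 2. 1 / u ^ s * A (deriv (E (s + 1)))) / u"
        by (simp add: sum_divide_distrib mult.commute)
      finally have "4 * (\<Sum>i<Suc k. IT i) \<le> P / u" unfolding P_def varpi by simp
      moreover have "(\<Sum>i<Suc k. IT i) \<ge> 0"
        by (intro sum_nonneg IT0) simp
      ultimately show ?thesis by linarith
    qed
    have step: "LG_err e u h (\<gamma> (\<sigma> (Suc i))) \<le> (LG_err e u h (\<gamma> (\<sigma> i)) + IR i) * exp (2 * IT i + 1 / u * IR i)"
      if i: "i < Suc k" for i
    proof -
      have "LG_err e u h (\<gamma> (\<sigma> (Suc i))) \<le> (LG_err e u h (\<gamma> (\<sigma> i)) + IR i) *
          exp (integral {\<sigma> i..\<sigma> (Suc i)} (\<lambda>r. 2 * (LG_T_bound E n u (b r) * cmod (d i r)) +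
            1 / u * (LG_R_bound E n u (b r) * cmod (d i r))))"
        unfolding IR_def b_def d_def
        by (rule LG_segment_estimate[OF e u E h less_imp_le[OF \<sigma>[OF i]] \<gamma>'[OF i] cont[OF i]])
          (use cut le0[OF i] LG_path_properties(2)[OF e path] in auto)
      also have "integral {\<sigma> i..\<sigma> (Suc i)} (\<lambda>r. 2 * (LG_T_bound E n u (b r) * cmod (d i r)) +
            1 / u * (LG_R_bound E n u (b r) * cmod (d i r))) = 2 * IT i + 1 / u * IR i"
        unfolding IT_def IR_def using c[OF i]
        by (subst integral_add)
          (use u in \<open>auto intro!: integrable_continuous_interval continuous_intros continuous_LG_bounds[OF E]\<close>)
      finally show ?thesis .
    qed
    \<comment> \<open>Chaining the arcs: the exponentials multiply, and exp ?X >= 1 allows the new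
      contribution \<open>IR j\<close> into the bracket.\<close>
    have "LG_err e u h (\<gamma> (\<sigma> j)) \<le> (LG_err e u h (\<gamma> t0) + (\<Sum>i<j. IR i)) *
        exp (2 * (\<Sum>i<j. IT i) + 1 / u * (\<Sum>i<j. IR i))" if "j \<le> Suc k" for j
      using that
    proof (induction j)
      case 0
      then show ?case by (simp add: \<sigma>0)
    next
      case (Suc j)
      let ?X = "2 * (\<Sum>i<j. IT i) + 1 / u * (\<Sum>i<j. IR i)"
      have X: "?X \<ge> 0"
        using Suc.prems u by (intro add_nonneg_nonneg mult_nonneg_nonneg sum_nonneg IT0 IR0) auto
      have "LG_err e u h (\<gamma> (\<sigma> (Suc j))) \<le> (LG_err e u h (\<gamma> (\<sigma> j)) + IR j) * exp (2 * IT j + 1 / u * IR j)"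
        using step[of j] Suc by simp
      also have "\<dots> \<le> ((LG_err e u h (\<gamma> t0) + (\<Sum>i<j. IR i)) * exp ?X + IR j * exp ?X) * exp (2 * IT j + 1 / u * IR j)"
        using Suc IR0[of j] X by (intro mult_right_mono add_mono) (auto simp: mult_le_cancel_left1)
      also have "\<dots> = (LG_err e u h (\<gamma> t0) + (\<Sum>i<Suc j. IR i)) * (exp ?X * exp (2 * IT j + 1 / u * IR j))"
        by (simp add: algebra_simps)
      also have "exp ?X * exp (2 * IT j + 1 / u * IR j) = exp (2 * (\<Sum>i<Suc j. IT i) + 1 / u * (\<Sum>i<Suc j. IR i))"
        unfolding mult_exp_exp by (rule arg_cong[where f = exp]) (simp add: algebra_simps add_divide_distrib)
      finally show ?case .
    qed
    from this[of "Suc k"] have "LG_err e u h z \<le> (LG_err e u h (\<gamma> t0) + (\<Sum>i<Suc k. IR i)) *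
        exp (2 * (\<Sum>i<Suc k. IT i) + 1 / u * (\<Sum>i<Suc k. IR i))"
      by (simp only: \<sigma>0 z order_refl)
    also have "\<dots> \<le> (LG_err e u h (\<gamma> t0) + u * (O' / u ^ n)) * exp (P / u + O' / u ^ n)"
    proof (intro mult_mono add_mono order_refl sumR sumT iffD2[OF exp_le_cancel_iff])
      have "1 / u * (\<Sum>i<Suc k. IR i) \<le> 1 / u * (u * (O' / u ^ n))"
        by (intro mult_left_mono sumR) (use u in auto)
      then show "1 / u * (\<Sum>i<Suc k. IR i) \<le> O' / u ^ n" using u by simp
    qed (use LG_err_nonneg O0 u in auto)
    finally show ?thesis .
  qed
  have "((\<lambda>t0. LG_err e u h (\<gamma> t0)) \<longlongrightarrow> 0) at_bot"
    by (rule filterlim_compose[OF tendsto_LG_err[OF e h] LG_path_properties(1)[OF e path]]) simp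
  then have "((\<lambda>t0. (LG_err e u h (\<gamma> t0) + u * (O' / u ^ n)) * exp (P / u + O' / u ^ n)) \<longlongrightarrow>
      (0 + u * (O' / u ^ n)) * exp (P / u + O' / u ^ n)) at_bot"
    by (intro tendsto_intros)
  moreover have "\<forall>\<^sub>F t0 in at_bot. LG_err e u h z \<le> (LG_err e u h (\<gamma> t0) + u * (O' / u ^ n)) * exp (P / u + O' / u ^ n)"
    using eventually_gt_at_bot[of "\<tau> 0"] by eventually_elim (rule main)
  ultimately have "LG_err e u h z \<le> (0 + u * (O' / u ^ n)) * exp (P / u + O' / u ^ n)"
    by (intro tendsto_lowerbound) (auto simp: trivial_limit_at_bot_linorder)
  with LG_err_ge[OF e u, of h z] have "u * cmod (h z - 1) \<le> u * (O' / u ^ n * exp (P / u + O' / u ^ n))"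
    by (simp add: mult.assoc)
  then have "cmod (h z - 1) \<le> O' / u ^ n * exp (P / u + O' / u ^ n)"
    by (rule mult_left_le_imp_le[OF _ u])
  then show ?thesis unfolding omega P_def .
qed

section \<open>Uniform estimates\<close>

text \<open>For \<nu> = |z^2 + 1| the left side is |d beta / dz|. When s^2 >= 2, the second lower
  bound on \<nu> provides the decay; otherwise \<nu> * sqrt \<nu> >= (\<delta>/2)^2 and 1 + s^2 <=
  3, whence 12 = 4 * 3.\<close>

lemma weight_bound:
  fixes \<nu> s \<delta> :: real
  assumes \<delta>: "0 < \<delta>" "\<delta> \<le> 1" and \<nu>: "\<delta> / 2 \<le> \<nu>" "s\<^sup>2 - 1 \<le> \<nu>"
  shows "sqrt \<nu> / \<nu>\<^sup>2 \<le> 12 / \<delta>\<^sup>2 * (1 / (1 + s\<^sup>2))"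
proof -
  have \<nu>0: "\<nu> > 0" using \<delta> \<nu> by linarith
  have s0: "1 + s\<^sup>2 > 0" by (simp add: add_pos_nonneg)
  have \<delta>2: "0 < \<delta>\<^sup>2" "\<delta>\<^sup>2 \<le> 1" using \<delta> by (auto simp: power_le_one)
  have "\<delta>\<^sup>2 * (1 + s\<^sup>2) \<le> 12 * (sqrt \<nu> * \<nu>)"
  proof (cases "s\<^sup>2 \<ge> 2")
    case True
    then have \<nu>1: "\<nu> \<ge> 1" using \<nu> by linarith
    have "\<delta>\<^sup>2 * (1 + s\<^sup>2) \<le> 1 * (1 + s\<^sup>2)" using \<delta>2 s0 by (intro mult_right_mono) auto
    also have "\<dots> \<le> 12 * \<nu>" using \<nu>1 \<nu>(2) by simp
    also have "\<dots> \<le> 12 * (sqrt \<nu> * \<nu>)" using \<nu>1 by simp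
    finally show ?thesis .
  next
    case False
    have "(\<delta> / 2)\<^sup>2 \<le> \<delta> / 2" using \<delta> by (simp add: power2_eq_square)
    then have "\<delta> / 2 \<le> sqrt \<nu>" using \<nu>(1) by (intro real_le_rsqrt) linarith
    then have "\<delta> / 2 * (\<delta> / 2) \<le> sqrt \<nu> * \<nu>" using \<nu>(1) \<delta> by (intro mult_mono) auto
    then have "3 * \<delta>\<^sup>2 \<le> 12 * (sqrt \<nu> * \<nu>)" by (simp add: power2_eq_square mult_ac)
    moreover have "\<delta>\<^sup>2 * (1 + s\<^sup>2) \<le> \<delta>\<^sup>2 * 3" using False \<delta>2 by (intro mult_left_mono) auto
    ultimately show ?thesis by (simp only: mult.commute[of _ 3])
  qed
  then have "12 / (12 * (sqrt \<nu> * \<nu>)) \<le> 12 / (\<delta>\<^sup>2 * (1 + s\<^sup>2))"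
    by (rule divide_left_mono) (use \<nu>0 s0 \<delta>2 in auto)
  then have "1 / (sqrt \<nu> * \<nu>) \<le> 12 / (\<delta>\<^sup>2 * (1 + s\<^sup>2))" by simp
  moreover have "sqrt \<nu> / \<nu>\<^sup>2 = 1 / (sqrt \<nu> * \<nu>)"
  proof -
    have "sqrt \<nu> * sqrt \<nu> = \<nu>" using \<nu>0 by simp
    then show ?thesis using \<nu>0 by (simp add: field_simps power2_eq_square)
  qed
  ultimately show ?thesis by simp
qed

text \<open>Apart from (1 - b^2)^2 the majorants are continuous in b, hence bounded on the disc, and
  u >= 1 absorbs all powers of u except the one in front of R.\<close>

lemma LG_bounds_le:
  assumes E: "LG_sequence E" and M: "M > 0"
  shows "\<exists>C\<ge>0. \<forall>u\<ge>1. \<forall>b. cmod b \<le> M \<longrightarrow>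
    LG_T_bound E n u b \<le> C * (cmod (1 - b\<^sup>2))\<^sup>2 \<and>
    LG_R_bound E n u b \<le> 1 / u ^ (n - 1) * (C * (cmod (1 - b\<^sup>2))\<^sup>2)"
proof -
  define T where "T b = (\<Sum>s = 1..n - 1. cmod (deriv (E s) b))" for b
  define Q where "Q s b = cmod (\<Sum>k = s..n - 1. (1 - b\<^sup>2)\<^sup>2 * deriv (E k) b * deriv (E (s + n - k - 1)) b)" for s b
  define R where "R b = 2 * cmod (deriv (E n) b) + (\<Sum>s = 1..n - 1. Q s b)" for b
  have contE: "continuous_on S (deriv (E s))" for s S
    using E unfolding LG_sequence_def
    by (intro continuous_on_subset[OF holomorphic_on_imp_continuous_on[OF holomorphic_deriv]]) auto
  have "continuous_on (cball 0 M) (\<lambda>b. T b + R b)"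
    unfolding T_def R_def Q_def by (intro continuous_intros contE)
  from compact_continuous_image[OF this compact_cball]
  have "bounded ((\<lambda>b. T b + R b) ` cball 0 M)" by (rule compact_imp_bounded)
  then obtain C where "\<forall>y\<in>(\<lambda>b. T b + R b) ` cball 0 M. norm y \<le> C"
    unfolding bounded_iff by blast
  then have C: "\<And>b. b \<in> cball 0 M \<Longrightarrow> \<bar>T b + R b\<bar> \<le> C" by auto
  have T0: "T b \<ge> 0" "R b \<ge> 0" for b
    by (auto simp: T_def R_def Q_def intro!: sum_nonneg add_nonneg_nonneg)
  have TR: "T b \<le> C" "R b \<le> C" if "cmod b \<le> M" for b
    using C[of b] T0[of b] that by auto
  have "LG_T_bound E n u b \<le> C * (cmod (1 - b\<^sup>2))\<^sup>2 \<and>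
    LG_R_bound E n u b \<le> 1 / u ^ (n - 1) * (C * (cmod (1 - b\<^sup>2))\<^sup>2)"
    if u: "u \<ge> 1" and b: "cmod b \<le> M" for u b
  proof
    have up: "1 / u ^ s \<le> 1" for s using u by simp
    have "LG_T_bound E n u b \<le> (\<Sum>s = 1..n - 1. 1 * cmod (LG_F E s b))"
      unfolding LG_T_bound_def by (intro sum_mono mult_right_mono up) auto
    also have "\<dots> = T b * (cmod (1 - b\<^sup>2))\<^sup>2"
      unfolding T_def LG_F_def sum_distrib_right by (simp add: norm_mult norm_power mult.commute)
    also have "\<dots> \<le> C * (cmod (1 - b\<^sup>2))\<^sup>2" by (intro mult_right_mono TR b) auto
    finally show "LG_T_bound E n u b \<le> C * (cmod (1 - b\<^sup>2))\<^sup>2" .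
    have S: "cmod (\<Sum>k = s..n - 1. LG_F E k b * LG_F E (s + n - k - 1) b) =
        Q s b * (cmod (1 - b\<^sup>2))\<^sup>2" for s
      unfolding Q_def norm_power[symmetric] norm_mult[symmetric] sum_distrib_right LG_F_def
      by (intro arg_cong[where f = cmod] sum.cong) (auto simp: mult_ac)
    have "LG_R_bound E n u b \<le> 2 / u ^ (n - 1) * cmod (LG_F E n b) +
      (\<Sum>s = 1..n - 1. 1 / u ^ (n - 1) * cmod (\<Sum>k = s..n - 1. LG_F E k b * LG_F E (s + n - k - 1) b))"
      unfolding LG_R_bound_def
      using u by (intro add_left_mono sum_mono mult_right_mono divide_left_mono power_increasing) auto
    also have "\<dots> = 1 / u ^ (n - 1) * (R b * (cmod (1 - b\<^sup>2))\<^sup>2)"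
      unfolding S unfolding R_def LG_F_def distrib_right distrib_left sum_distrib_right sum_distrib_left
      by (simp add: norm_mult norm_power mult_ac)
    also have "\<dots> \<le> 1 / u ^ (n - 1) * (C * (cmod (1 - b\<^sup>2))\<^sup>2)"
      using u by (intro mult_left_mono mult_right_mono TR b) auto
    finally show "LG_R_bound E n u b \<le> 1 / u ^ (n - 1) * (C * (cmod (1 - b\<^sup>2))\<^sup>2)" .
  qed
  moreover have "C \<ge> 0" using C[of 0] M by auto
  ultimately show ?thesis by blast
qed

lemma integral_arctan_le:
  assumes "a \<le> b"
  shows "(\<lambda>t. 1 / (1 + t\<^sup>2)) integrable_on {a..b}" "integral {a..b} (\<lambda>t :: real. 1 / (1 + t\<^sup>2)) \<le> pi"
proof -
  have "((\<lambda>t. 1 / (1 + t\<^sup>2)) has_integral arctan b - arctan a) {a..b}"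
    by (rule fundamental_theorem_of_calculus[OF assms])
      (auto intro!: derivative_eq_intros simp: divide_inverse simp flip: has_real_derivative_iff_has_vector_derivative)
  then show "(\<lambda>t. 1 / (1 + t\<^sup>2)) integrable_on {a..b}" "integral {a..b} (\<lambda>t :: real. 1 / (1 + t\<^sup>2)) \<le> pi"
    using arctan_bounded[of a] arctan_bounded[of b] by (auto simp: has_integral_integrable integral_unique)
qed

text \<open>Along a unit speed line the integrands are at most a multiple of 1 / (1 + t^2), which
  contributes at most \<pi> over any interval; so B is independent of the line, its length, u and h.
  The exponent 3 B is 2 B from T and B from R.\<close>

lemma LG_line_estimate:
  assumes E: "LG_sequence E" and \<delta>: "0 < \<delta>" "\<delta> \<le> 1"
  shows "\<exists>B\<ge>0. \<forall>e\<in>{1, -1}. \<forall>u\<ge>1. \<forall>h. LG_solution E n e u h \<longrightarrow>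
    (\<forall>a b z d. a \<le> b \<longrightarrow> cmod d = 1 \<longrightarrow>
      (\<forall>t\<in>{a..b}. z + of_real t * d \<in> cut_plane \<and> \<delta> / 2 \<le> cmod ((z + of_real t * d)\<^sup>2 + 1) \<and>
        t\<^sup>2 - 1 \<le> cmod ((z + of_real t * d)\<^sup>2 + 1) \<and> e * Im (csqrt ((z + of_real t * d)\<^sup>2 + 1) * d) \<le> 0) \<longrightarrow>
      LG_err e u h (z + of_real b * d) \<le> (LG_err e u h (z + of_real a * d) + 1 / u ^ (n - 1) * B) * exp (3 * B))"
proof -
  obtain C where C: "C \<ge> 0" "\<And>u b. u \<ge> 1 \<Longrightarrow> cmod b \<le> 1 + 2 / \<delta> \<Longrightarrow>
    LG_T_bound E n u b \<le> C * (cmod (1 - b\<^sup>2))\<^sup>2 \<and>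
    LG_R_bound E n u b \<le> 1 / u ^ (n - 1) * (C * (cmod (1 - b\<^sup>2))\<^sup>2)"
    using LG_bounds_le[OF E, of "1 + 2 / \<delta>" n] \<delta> by (auto simp: add_pos_pos)
  define B where "B = C * (12 / \<delta>\<^sup>2) * pi"
  have B0: "B \<ge> 0" using C(1) by (simp add: B_def)
  have "LG_err e u h (z + of_real b * d) \<le> (LG_err e u h (z + of_real a * d) + 1 / u ^ (n - 1) * B) * exp (3 * B)"
    if e: "e \<in> {1, -1}" and u: "u \<ge> 1" and h: "LG_solution E n e u h" and ab: "a \<le> b" and d: "cmod d = 1"
      and cut: "\<And>t. t \<in> {a..b} \<Longrightarrow> z + of_real t * d \<in> cut_plane"
      and \<nu>: "\<And>t. t \<in> {a..b} \<Longrightarrow> \<delta> / 2 \<le> cmod ((z + of_real t * d)\<^sup>2 + 1)"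
        "\<And>t. t \<in> {a..b} \<Longrightarrow> t\<^sup>2 - 1 \<le> cmod ((z + of_real t * d)\<^sup>2 + 1)"
      and im: "\<And>t. t \<in> {a..b} \<Longrightarrow> e * Im (csqrt ((z + of_real t * d)\<^sup>2 + 1) * d) \<le> 0"
    for e u h a b z d
  proof -
    define \<gamma> where "\<gamma> t = z + of_real t * d" for t
    have u0: "u > 0" using u by simp
    have \<gamma>': "(\<gamma> has_vector_derivative d) (at t within S)" for t S
      unfolding \<gamma>_def[abs_def] has_vector_derivative_def by (auto intro!: derivative_eq_intros simp: scaleR_conv_of_real)
    have xd: "((\<lambda>t. e * Im (xi_bar (\<gamma> t))) has_real_derivative e * Im (csqrt ((\<gamma> t)\<^sup>2 + 1) * d)) (at t)"
      if "t \<in> {a..b}" for t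
    proof -
      have "((\<lambda>t. xi_bar (\<gamma> t)) has_vector_derivative csqrt ((\<gamma> t)\<^sup>2 + 1) * d) (at t)"
        using field_vector_diff_chain_at[OF \<gamma>' has_field_derivative_xi_bar] cut[OF that]
        by (simp add: o_def \<gamma>_def mult.commute)
      then have "((\<lambda>t. Im (xi_bar (\<gamma> t))) has_vector_derivative Im (csqrt ((\<gamma> t)\<^sup>2 + 1) * d)) (at t)"
        by (rule bounded_linear.has_vector_derivative[OF bounded_linear_Im])
      then show ?thesis
        by (intro DERIV_cmult) (simp add: has_real_derivative_iff_has_vector_derivative)
    qed
    have mono: "e * Im (xi_bar (\<gamma> r')) \<le> e * Im (xi_bar (\<gamma> r))" if "a \<le> r" "r \<le> r'" "r' \<le> b" for r r'
    proof (rule DERIV_nonpos_imp_nonincreasing[OF that(2)])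
      fix t assume "r \<le> t" "t \<le> r'"
      then have t: "t \<in> {a..b}" using that by auto
      show "\<exists>y. ((\<lambda>t. e * Im (xi_bar (\<gamma> t))) has_real_derivative y) (at t) \<and> y \<le> 0"
        using xd[OF t] im[OF t] unfolding \<gamma>_def by blast
    qed
    let ?w = "\<lambda>t. cmod (csqrt ((\<gamma> t)\<^sup>2 + 1) * d)"
    let ?R = "\<lambda>t. LG_R_bound E n u (beta_bar (\<gamma> t)) * ?w t"
    let ?T = "\<lambda>t. LG_T_bound E n u (beta_bar (\<gamma> t)) * ?w t"
    define K where "K = C * (12 / \<delta>\<^sup>2)"
    have K0: "K \<ge> 0" using C(1) by (simp add: K_def)
    have pt: "?T t \<le> K * (1 / (1 + t\<^sup>2))" "?R t \<le> 1 / u ^ (n - 1) * (K * (1 / (1 + t\<^sup>2)))"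
      if t: "t \<in> {a..b}" for t
    proof -
      define \<mu> where "\<mu> = cmod ((\<gamma> t)\<^sup>2 + 1)"
      have \<mu>: "\<delta> / 2 \<le> \<mu>" "t\<^sup>2 - 1 \<le> \<mu>" using \<nu> t by (auto simp: \<mu>_def \<gamma>_def)
      have \<mu>0: "\<mu> > 0" using \<mu> \<delta> by linarith
      have cz: "\<gamma> t \<in> cut_plane" using cut t by (simp add: \<gamma>_def)
      have sq: "cmod (csqrt ((\<gamma> t)\<^sup>2 + 1)) = sqrt \<mu>"
        by (metis \<mu>_def norm_ge_zero norm_power power2_csqrt real_sqrt_unique)
      have b: "(cmod (1 - (beta_bar (\<gamma> t))\<^sup>2))\<^sup>2 * ?w t = sqrt \<mu> / \<mu>\<^sup>2"
        unfolding one_minus_beta_bar_sq[OF cz] norm_mult sq d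
        by (simp add: norm_divide power_divide \<mu>_def)
      \<comment> \<open>|beta|^2 <= 1 + 1/\<mu> <= 1 + 2/\<delta>, and that number is at most its
        own square; it is the radius of the disc on which \<open>C\<close> was chosen.\<close>
      have "cmod (beta_bar (\<gamma> t)) \<le> 1 + 2 / \<delta>"
      proof -
        have "(cmod (\<gamma> t))\<^sup>2 \<le> \<mu> + 1"
          using norm_triangle_ineq4[of "(\<gamma> t)\<^sup>2 + 1" 1] by (simp add: \<mu>_def norm_power)
        then have "(cmod (beta_bar (\<gamma> t)))\<^sup>2 \<le> (\<mu> + 1) / \<mu>"
          using \<mu>0 unfolding beta_bar_def norm_divide sq power_divide by (simp add: divide_right_mono)
        also have "\<dots> = 1 + 1 / \<mu>" using \<mu>0 by (simp add: field_simps)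
        also have "1 / \<mu> \<le> 1 / (\<delta> / 2)" using \<mu>(1) \<delta> by (intro divide_left_mono) auto
        also have "1 + 1 / (\<delta> / 2) \<le> (1 + 2 / \<delta>)\<^sup>2"
          using \<delta> self_le_power[of "1 + 2 / \<delta>" 2] by simp
        finally show ?thesis by (rule power2_le_imp_le) (use \<delta> in \<open>auto intro!: add_nonneg_nonneg\<close>)
      qed
      from C(2)[OF u this] have T: "LG_T_bound E n u (beta_bar (\<gamma> t)) \<le> C * (cmod (1 - (beta_bar (\<gamma> t))\<^sup>2))\<^sup>2"
        and R: "LG_R_bound E n u (beta_bar (\<gamma> t)) \<le> 1 / u ^ (n - 1) * (C * (cmod (1 - (beta_bar (\<gamma> t))\<^sup>2))\<^sup>2)"
        by auto
      have W: "C * (sqrt \<mu> / \<mu>\<^sup>2) \<le> K * (1 / (1 + t\<^sup>2))"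
        unfolding K_def mult.assoc by (intro mult_left_mono weight_bound \<delta> \<mu> C(1))
      have "?T t \<le> C * (cmod (1 - (beta_bar (\<gamma> t))\<^sup>2))\<^sup>2 * ?w t"
        by (rule mult_right_mono[OF T]) simp
      also have "\<dots> = C * (sqrt \<mu> / \<mu>\<^sup>2)" unfolding mult.assoc b ..
      finally show "?T t \<le> K * (1 / (1 + t\<^sup>2))" using W by linarith
      have "?R t \<le> 1 / u ^ (n - 1) * (C * (cmod (1 - (beta_bar (\<gamma> t))\<^sup>2))\<^sup>2) * ?w t"
        by (rule mult_right_mono[OF R]) simp
      also have "\<dots> = 1 / u ^ (n - 1) * (C * (sqrt \<mu> / \<mu>\<^sup>2))" unfolding mult.assoc b ..
      also have "\<dots> \<le> 1 / u ^ (n - 1) * (K * (1 / (1 + t\<^sup>2)))"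
        using u by (intro mult_left_mono W) auto
      finally show "?R t \<le> 1 / u ^ (n - 1) * (K * (1 / (1 + t\<^sup>2)))" .
    qed
    have c\<gamma>: "continuous_on {a..b} \<gamma>" unfolding \<gamma>_def by (intro continuous_intros)
    have cb: "continuous_on {a..b} (\<lambda>t. beta_bar (\<gamma> t))" "continuous_on {a..b} (\<lambda>t. csqrt ((\<gamma> t)\<^sup>2 + 1))"
      using cut[folded \<gamma>_def] holomorphic_on_cut_plane(1,2)[THEN holomorphic_on_imp_continuous_on]
      by (auto intro!: continuous_on_compose2[OF _ c\<gamma>])
    have int: "?T integrable_on {a..b}" "?R integrable_on {a..b}"
      by (intro integrable_continuous_interval continuous_intros cb continuous_LG_bounds[OF E])+
    note at = integral_arctan_le[OF ab]
    have IT: "integral {a..b} ?T \<le> B"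
    proof -
      have "integral {a..b} ?T \<le> integral {a..b} (\<lambda>t. K * (1 / (1 + t\<^sup>2)))"
        by (intro integral_le int integrable_on_mult_right at pt)
      also have "\<dots> \<le> K * pi" unfolding integral_mult_right by (intro mult_left_mono at K0)
      finally show ?thesis by (simp add: B_def K_def)
    qed
    have IR: "integral {a..b} ?R \<le> 1 / u ^ (n - 1) * B"
    proof -
      have "integral {a..b} ?R \<le> integral {a..b} (\<lambda>t. 1 / u ^ (n - 1) * (K * (1 / (1 + t\<^sup>2))))"
        by (intro integral_le int integrable_on_mult_right at pt)
      also have "\<dots> \<le> 1 / u ^ (n - 1) * (K * pi)"
        unfolding integral_mult_right using u by (intro mult_left_mono at K0) auto
      finally show ?thesis by (simp add: B_def K_def)
    qed
    have "LG_err e u h (\<gamma> b) \<le> (LG_err e u h (\<gamma> a) + integral {a..b} ?R) *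
        exp (integral {a..b} (\<lambda>t. 2 * ?T t + 1 / u * ?R t))"
      by (rule LG_segment_estimate[OF e u0 E h ab \<gamma>' continuous_on_const _ mono])
        (use cut in \<open>auto simp: \<gamma>_def\<close>)
    also have "\<dots> \<le> (LG_err e u h (\<gamma> a) + 1 / u ^ (n - 1) * B) * exp (3 * B)"
    proof (intro mult_mono add_left_mono IR iffD2[OF exp_le_cancel_iff])
      have "integral {a..b} (\<lambda>t. 2 * ?T t + 1 / u * ?R t) = 2 * integral {a..b} ?T + 1 / u * integral {a..b} ?R"
        using int by (subst integral_add) (auto intro!: integrable_on_mult_right simp del: times_divide_eq_left mult_1)
      also have "\<dots> \<le> 2 * B + 1 / u * (1 / u ^ (n - 1) * B)"
        using u by (intro add_mono mult_left_mono IT IR) auto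
      also have "1 / u * (1 / u ^ (n - 1) * B) \<le> 1 * (1 * B)"
        using u B0 by (intro mult_mono) auto
      finally show "integral {a..b} (\<lambda>t. 2 * ?T t + 1 / u * ?R t) \<le> 3 * B" by simp
      show "0 \<le> LG_err e u h (\<gamma> a) + 1 / u ^ (n - 1) * B"
        using LG_err_nonneg u B0 by (intro add_nonneg_nonneg) auto
    qed simp
    finally show ?thesis by (simp add: \<gamma>_def)
  qed
  with B0 show ?thesis by blast
qed

text \<open>At most two lines lead to z, each adding a multiple of B and costing a factor exp (3 B).
  The lower bounds on z^2 + 1 that the line estimate demands are checked on the factors z - e i and
  z + e i.\<close>

lemma LG_region_estimate:
  assumes E: "LG_sequence E" and n: "n \<ge> 1" and \<delta>: "0 < \<delta>" "\<delta> \<le> 1"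
  shows "\<exists>C. \<forall>e\<in>{1, -1}. \<forall>u\<ge>1. \<forall>h. LG_solution E n e u h \<longrightarrow>
    (\<forall>z\<in>LG_region e \<delta>. cmod (h z - 1) \<le> C / u ^ n)"
proof -
  obtain B where B0: "B \<ge> 0" and B: "\<And>e u h a b z d. e \<in> {1, -1} \<Longrightarrow> u \<ge> 1 \<Longrightarrow> LG_solution E n e u h \<Longrightarrow>
      a \<le> b \<Longrightarrow> cmod d = 1 \<Longrightarrow>
      (\<forall>t\<in>{a..b}. z + of_real t * d \<in> cut_plane \<and> \<delta> / 2 \<le> cmod ((z + of_real t * d)\<^sup>2 + 1) \<and>
        t\<^sup>2 - 1 \<le> cmod ((z + of_real t * d)\<^sup>2 + 1) \<and> e * Im (csqrt ((z + of_real t * d)\<^sup>2 + 1) * d) \<le> 0) \<Longrightarrow>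
      LG_err e u h (z + of_real b * d) \<le> (LG_err e u h (z + of_real a * d) + 1 / u ^ (n - 1) * B) * exp (3 * B)"
    using LG_line_estimate[OF E \<delta>, of n] by meson
  \<comment> \<open>\<open>B1\<close> is the constant after the ray, where the error starts from 0,
    and \<open>C\<close> the one after a segment that starts from \<open>B1\<close>.\<close>
  define B1 where "B1 = B * exp (3 * B)"
  define C where "C = (B1 + B) * exp (3 * B)"
  have B1: "B1 \<ge> 0" "B1 \<le> C"
  proof -
    show "B1 \<ge> 0" using B0 by (simp add: B1_def)
    then have "B1 * 1 \<le> (B1 + B) * exp (3 * B)" using B0 by (intro mult_mono) auto
    then show "B1 \<le> C" by (simp add: C_def)
  qed
  have factor: "cmod (z\<^sup>2 + 1) = cmod (z - of_real e * \<i>) * cmod (z + of_real e * \<i>)"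
    if "e \<in> {1, -1}" for e z
  proof -
    have "z\<^sup>2 + 1 = (z - of_real e * \<i>) * (z + of_real e * \<i>)"
      using that by (auto simp: algebra_simps power2_eq_square)
    then show ?thesis by (simp only: norm_mult)
  qed
  have ray: "LG_err e u h z \<le> 1 / u ^ (n - 1) * B1"
    if e: "e \<in> {1, -1}" and u: "u \<ge> 1" and h: "LG_solution E n e u h"
      and z: "z \<in> cut_plane" "0 \<le> Re z" "0 \<le> e * Im z" "\<delta> \<le> cmod (z - of_real e * \<i>)" for e u h z
  proof -
    \<comment> \<open>d points from infinity towards z, so the ray is z - a d with a >= 0, traversed
      as t runs from - a to 0.\<close>
    define d where "d = - ((1 + of_real e * \<i>) / complex_of_real (sqrt 2))"
    have ed: "- d * LG_rot e = 1"
      using e unfolding d_def LG_rot_expand[OF e]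
      by (auto simp: complex_eq_iff field_simps real_div_sqrt)
    have nd: "cmod d = 1"
    proof -
      have "cmod (- d * LG_rot e) = 1" unfolding ed by simp
      then show ?thesis by (simp add: norm_mult)
    qed
    have pt: "z + of_real t * d \<in> cut_plane" "\<delta> / 2 \<le> cmod ((z + of_real t * d)\<^sup>2 + 1)"
        "t\<^sup>2 - 1 \<le> cmod ((z + of_real t * d)\<^sup>2 + 1)" "e * Im (csqrt ((z + of_real t * d)\<^sup>2 + 1) * d) \<le> 0"
      if t: "t \<le> 0" for t
    proof -
      define s where "s = - t / sqrt 2"
      define w where "w = z + of_real t * d"
      define x y where "x = Re z" and "y = e * Im z"
      have s: "s \<ge> 0" "t\<^sup>2 = 2 * s\<^sup>2" using t by (auto simp: s_def power_divide divide_nonpos_pos)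
      have xy: "x \<ge> 0" "y \<ge> 0" using z by (auto simp: x_def y_def)
      have w: "Re w = x + s" "e * Im w = y + s"
        using e by (auto simp: w_def d_def s_def x_def y_def algebra_simps)
      show cw: "w \<in> cut_plane"
      proof (cases "t = 0")
        case True
        then show ?thesis using z by (simp add: w_def)
      next
        case False
        then have "s > 0" using t by (simp add: s_def divide_neg_pos)
        then show ?thesis using w xy by (intro Re_pos_imp_cut_plane) auto
      qed
      have nsq: "(cmod (v - of_real e * \<i>))\<^sup>2 = (Re v)\<^sup>2 + (e * Im v - 1)\<^sup>2"
        "(cmod (v + of_real e * \<i>))\<^sup>2 = (Re v)\<^sup>2 + (e * Im v + 1)\<^sup>2" "(cmod v)\<^sup>2 = (Re v)\<^sup>2 + (e * Im v)\<^sup>2" for v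
        using e unfolding cmod_power2 by (auto simp: power2_eq_square algebra_simps)
      have "1\<^sup>2 \<le> (cmod (w + of_real e * \<i>))\<^sup>2"
      proof -
        have "1\<^sup>2 \<le> (e * Im w + 1)\<^sup>2" unfolding w using xy s by (intro power_mono) auto
        then show ?thesis unfolding nsq(2) using zero_le_power2[of "Re w"] by linarith
      qed
      then have far: "1 \<le> cmod (w + of_real e * \<i>)" by (rule power2_le_imp_le) simp
      have "(\<delta> / 2)\<^sup>2 \<le> (cmod (w - of_real e * \<i>))\<^sup>2"
      proof -
        have d0: "\<delta>\<^sup>2 \<le> x\<^sup>2 + (y - 1)\<^sup>2"
          using power_mono[OF z(4), of 2] \<delta> unfolding nsq(1) by (simp add: x_def y_def)
        \<comment> \<open>Along the ray the distance to the turning point e i may shrink below that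
          of z, but at most by a factor sqrt 2. For y < 1 the difference of the two sides is a
          square in s plus x (1 - y).\<close>
        have "(x\<^sup>2 + (y - 1)\<^sup>2) / 2 \<le> (x + s)\<^sup>2 + (y + s - 1)\<^sup>2"
        proof (cases "y \<ge> 1")
          case True
          have "x\<^sup>2 \<le> (x + s)\<^sup>2" "(y - 1)\<^sup>2 \<le> (y + s - 1)\<^sup>2"
            using xy s True by (auto intro!: power_mono)
          moreover have "0 \<le> x\<^sup>2 + (y - 1)\<^sup>2" by simp
          moreover have "(p + q) / 2 \<le> p' + q'" if "p \<le> p'" "q \<le> q'" "0 \<le> p + q" for p q p' q' :: real
          proof -
            have "(p + q) / 2 \<le> p + q" using that(3) by simp
            also have "\<dots> \<le> p' + q'" using that(1,2) by (rule add_mono)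
            finally show ?thesis .
          qed
          ultimately show ?thesis by blast
        next
          case False
          have "0 \<le> 2 * (s + (x + y - 1) / 2 )\<^sup>2 + x * (1 - y)"
            using xy False by (intro add_nonneg_nonneg mult_nonneg_nonneg) auto
          then show ?thesis by (simp add: power2_eq_square field_simps)
        qed
        moreover have "(\<delta> / 2)\<^sup>2 \<le> \<delta>\<^sup>2 / 2" by (simp add: power_divide)
        moreover have "p \<le> q" if "p \<le> a / 2" "a \<le> b" "b / 2 \<le> q" for p q a b :: real
          using that by linarith
        ultimately show ?thesis unfolding nsq(1) w using d0 by blast
      qed
      then have near: "\<delta> / 2 \<le> cmod (w - of_real e * \<i>)" by (rule power2_le_imp_le) simp
      show "\<delta> / 2 \<le> cmod (w\<^sup>2 + 1)"
        unfolding factor[OF e] using mult_mono[OF near far] by simp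
      have "2 * s\<^sup>2 \<le> (cmod w)\<^sup>2"
        unfolding nsq(3) w mult_2 using xy s by (intro add_mono power_mono) auto
      moreover have "(cmod w)\<^sup>2 - 1 \<le> cmod (w\<^sup>2 + 1)"
        using norm_diff_ineq[of "w\<^sup>2" 1] by (simp add: norm_power)
      ultimately show "t\<^sup>2 - 1 \<le> cmod (w\<^sup>2 + 1)" using s by linarith
      define q where "q = csqrt (w\<^sup>2 + 1)"
      have q: "q\<^sup>2 = w\<^sup>2 + 1" "Re q \<ge> 0"
        unfolding q_def by (simp, rule Re_csqrt)
      have Rq: "Re q > 0"
      proof (rule ccontr)
        assume "\<not> Re q > 0"
        then have "Re q = 0" using q(2) by simp
        then have "w\<^sup>2 + 1 = of_real (- (Im q)\<^sup>2)"
          unfolding q(1)[symmetric] by (simp add: complex_eq_iff Re_power2 Im_power2)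
        then have "w\<^sup>2 + 1 \<in> \<real>\<^sub>\<le>\<^sub>0" by (simp add: nonpos_Reals_of_real_iff del: of_real_minus)
        then show False using cw by (simp add: cut_plane_iff)
      qed
      \<comment> \<open>The sign of Im q follows from that of Im (q^2) = 2 Re w Im w and Re q > 0;
        it makes e Im xi nonincreasing along the ray.\<close>
      have "e * Im (q\<^sup>2) = 2 * Re w * (e * Im w)"
        unfolding q(1) by (simp add: Im_power2 algebra_simps)
      then have "e * Im (q\<^sup>2) = 2 * (x + s) * (y + s)" unfolding w .
      then have "2 * (Re q * (e * Im q)) = 2 * (x + s) * (y + s)" by (simp add: Im_power2 mult_ac)
      moreover have "0 \<le> 2 * (x + s) * (y + s)" using xy s by (intro mult_nonneg_nonneg) auto
      ultimately have "Re q * (e * Im q) \<ge> 0" by simp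
      with Rq have "e * Im q \<ge> 0" by (simp add: zero_le_mult_iff)
      moreover have "e * Im (q * d) = - (Re q + e * Im q) / sqrt 2"
        using e by (auto simp: d_def field_simps)
      ultimately show "e * Im (q * d) \<le> 0" using q(2) by (simp add: divide_nonpos_pos)
    qed
    have step: "LG_err e u h z \<le> (LG_err e u h (z - of_real a * d) + 1 / u ^ (n - 1) * B) * exp (3 * B)"
      if "a \<ge> 0" for a
      using B[OF e u h _ nd, of "- a" 0 z] pt that by simp
    have "filterlim (\<lambda>a. z - of_real a * d) (LG_at e (19 / 20)) at_top"
      unfolding filterlim_iff
    proof (intro allI impI)
      fix P assume "eventually P (LG_at e (19 / 20))"
      then obtain R where R: "\<And>v. v \<in> LG_sector e (19 / 20) \<Longrightarrow> R \<le> cmod v \<Longrightarrow> P v"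
        unfolding eventually_LG_at by blast
      \<comment> \<open>The 39 is what gives a - |z| >= 19/20 (a + |z|).\<close>
      show "\<forall>\<^sub>F a in at_top. P (z - of_real a * d)"
        using eventually_ge_at_top[of "max 0 (max (R + cmod z) (39 * cmod z))"]
      proof eventually_elim
        case (elim a)
        let ?v = "z - of_real a * d"
        have a: "a \<ge> 0" "a \<ge> R + cmod z" "a \<ge> 39 * cmod z" using elim by auto
        have "cmod ?v \<le> cmod z + a"
          using norm_triangle_ineq4[of z "of_real a * d"] a by (simp add: norm_mult nd)
        moreover have "cmod ?v \<ge> a - cmod z"
          using norm_triangle_ineq2[of "of_real a * d" z] a by (simp add: norm_mult nd norm_minus_commute)
        moreover have "Re (?v * LG_rot e) \<ge> a - cmod z"
        proof -
          have "?v * LG_rot e = z * LG_rot e + of_real a * (- d * LG_rot e)" by (simp add: algebra_simps)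
          then have "Re (?v * LG_rot e) = Re (z * LG_rot e) + a" unfolding ed by simp
          moreover have "\<bar>Re (z * LG_rot e)\<bar> \<le> cmod z"
            using abs_Re_le_cmod[of "z * LG_rot e"] by (simp only: norm_mult norm_LG_rot mult_1_right)
          ultimately show ?thesis by linarith
        qed
        ultimately show ?case using a by (intro R) (auto simp: LG_sector_def simp del: times_complex.sel)
      qed
    qed
    from filterlim_compose[OF tendsto_LG_err[OF e h] this]
    have "((\<lambda>a. (LG_err e u h (z - of_real a * d) + 1 / u ^ (n - 1) * B) * exp (3 * B)) \<longlongrightarrow>
        (0 + 1 / u ^ (n - 1) * B) * exp (3 * B)) at_top"
      by (intro tendsto_intros)
    moreover have "\<forall>\<^sub>F a in at_top. LG_err e u h z \<le> (LG_err e u h (z - of_real a * d) + 1 / u ^ (n - 1) * B) * exp (3 * B)"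
      using eventually_ge_at_top[of 0] by eventually_elim (rule step)
    ultimately have "LG_err e u h z \<le> (0 + 1 / u ^ (n - 1) * B) * exp (3 * B)"
      by (intro tendsto_lowerbound) auto
    then show ?thesis by (simp add: B1_def)
  qed
  have region: "LG_err e u h z \<le> 1 / u ^ (n - 1) * C"
    if e: "e \<in> {1, -1}" and u: "u \<ge> 1" and h: "LG_solution E n e u h" and z: "z \<in> LG_region e \<delta>" for e u h z
  proof (cases "0 \<le> e * Im z")
    case True
    have "LG_err e u h z \<le> 1 / u ^ (n - 1) * B1"
      using z True by (intro ray e u h) (auto simp: LG_region_def dist_norm)
    also have "\<dots> \<le> 1 / u ^ (n - 1) * C" using u B1 by (intro mult_left_mono) auto
    finally show ?thesis .
  next
    case False
    \<comment> \<open>The segment leaves the real axis at x = Re z, a point reached by a ray, and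
      ends at depth Y. In its direction d = - e i the monotonicity is immediate, as e Im (q d) = -
      Re q <= 0.\<close>
    define Y where "Y = - e * Im z"
    define x where "x = Re z"
    define d where "d = - (of_real e * \<i>)"
    have nd: "cmod d = 1" using e by (auto simp: d_def norm_mult)
    have zc: "z \<in> cut_plane" "x \<ge> 0" "Y > 0" using z False by (auto simp: LG_region_def Y_def x_def)
    have zx: "z = of_real x + of_real Y * d"
      using e by (auto simp: complex_eq_iff x_def Y_def d_def)
    have dist: "\<delta> \<le> cmod (z + of_real (e * y) * \<i>)" if "y \<ge> 1" for y
      using z that by (auto simp: LG_region_def dist_norm)
    have pt: "of_real x + of_real t * d \<in> cut_plane \<and> \<delta> / 2 \<le> cmod ((of_real x + of_real t * d)\<^sup>2 + 1) \<and>
        t\<^sup>2 - 1 \<le> cmod ((of_real x + of_real t * d)\<^sup>2 + 1) \<and>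
        e * Im (csqrt ((of_real x + of_real t * d)\<^sup>2 + 1) * d) \<le> 0" if t: "t \<in> {0..Y}" for t
    proof -
      define w where "w = of_real x + of_real t * d"
      have w: "Re w = x" "Im w = - e * t" by (simp_all add: w_def d_def)
      have cw: "w \<in> cut_plane"
      proof (cases "x = 0")
        case True
        then have "Y < 1" using zc e by (auto simp: cut_plane_def Y_def x_def)
        then show ?thesis using w t e by (auto simp: cut_plane_def)
      qed (use zc w in \<open>auto intro!: Re_pos_imp_cut_plane\<close>)
      have far: "1 + t \<le> cmod (w - of_real e * \<i>)"
        using abs_Im_le_cmod[of "w - of_real e * \<i>"] w t e by (auto simp: algebra_simps)
      have near: "\<bar>t - 1\<bar> \<le> cmod (w + of_real e * \<i>)"
        using abs_Im_le_cmod[of "w + of_real e * \<i>"] w t e by (auto simp: algebra_simps)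
      \<comment> \<open>Here the exclusion of the whole cut beyond - e i matters: for Y >= 1 the cut
        point at the height of z is at distance x, so x >= \<delta>, and no point of the segment is
        closer than x to - e i. For Y < 1 the point of the segment nearest to - e i is z
        itself.\<close>
      have near': "\<delta> \<le> cmod (w + of_real e * \<i>)"
      proof (cases "Y \<ge> 1")
        case True
        have "z + of_real (e * Y) * \<i> = of_real x" using e by (auto simp: complex_eq_iff x_def Y_def)
        then have "\<delta> \<le> x" using dist[OF True] zc by simp
        also have "x \<le> cmod (w + of_real e * \<i>)" using complex_Re_le_cmod[of "w + of_real e * \<i>"] w by simp
        finally show ?thesis .
      next
        case False
        have "\<delta>\<^sup>2 \<le> (cmod (z + of_real e * \<i>))\<^sup>2" using dist[of 1] \<delta> by (intro power_mono) auto
        also have "\<dots> = x\<^sup>2 + (1 - Y)\<^sup>2"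
          using e unfolding cmod_power2 by (auto simp: x_def Y_def power2_eq_square algebra_simps)
        also have "\<dots> \<le> x\<^sup>2 + (1 - t)\<^sup>2" using t False by (intro add_left_mono power_mono) auto
        also have "\<dots> = (cmod (w + of_real e * \<i>))\<^sup>2"
          using e w unfolding cmod_power2 by (auto simp: power2_eq_square algebra_simps)
        finally show ?thesis by (rule power2_le_imp_le) simp
      qed
      have f: "cmod (w\<^sup>2 + 1) = cmod (w - of_real e * \<i>) * cmod (w + of_real e * \<i>)" by (rule factor[OF e])
      have 1: "1 * \<delta> \<le> cmod (w\<^sup>2 + 1)" unfolding f using far near' t \<delta> by (intro mult_mono) auto
      have "(1 + t) * \<bar>t - 1\<bar> \<le> cmod (w\<^sup>2 + 1)" unfolding f using far near t by (intro mult_mono) auto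
      moreover have "(1 + t) * (t - 1) \<le> (1 + t) * \<bar>t - 1\<bar>" using t by (intro mult_left_mono) auto
      ultimately have 2: "t\<^sup>2 - 1 \<le> cmod (w\<^sup>2 + 1)" by (simp add: power2_eq_square algebra_simps)
      have "e * Im (q * d) = - Re q" for q using e by (auto simp: d_def)
      then have 3: "e * Im (csqrt (w\<^sup>2 + 1) * d) \<le> 0" using Re_csqrt[of "w\<^sup>2 + 1"] by (simp only:)
      show ?thesis using cw 1 2 3 \<delta> unfolding w_def[symmetric] by simp
    qed
    have corner: "LG_err e u h (of_real x) \<le> 1 / u ^ (n - 1) * B1"
    proof (rule ray[OF e u h])
      show "complex_of_real x \<in> cut_plane" by (auto simp: cut_plane_def)
      have "1 \<le> cmod (of_real x - of_real e * \<i>)"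
        using abs_Im_le_cmod[of "of_real x - of_real e * \<i>"] e by auto
      then show "\<delta> \<le> cmod (of_real x - of_real e * \<i>)" using \<delta> by simp
    qed (use zc in auto)
    have "LG_err e u h (of_real x + of_real Y * d) \<le>
        (LG_err e u h (of_real x + of_real 0 * d) + 1 / u ^ (n - 1) * B) * exp (3 * B)"
      using pt zc by (intro B[OF e u h _ nd]) auto
    also have "\<dots> \<le> (1 / u ^ (n - 1) * B1 + 1 / u ^ (n - 1) * B) * exp (3 * B)"
      using corner by (intro mult_right_mono add_right_mono) auto
    also have "\<dots> = 1 / u ^ (n - 1) * C" by (simp add: C_def algebra_simps add_divide_distrib)
    finally show ?thesis unfolding zx[symmetric] .
  qed
  have "cmod (h z - 1) \<le> C / u ^ n"
    if e: "e \<in> {1, -1}" and u: "u \<ge> 1" and h: "LG_solution E n e u h" and z: "z \<in> LG_region e \<delta>" for e u h z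
  proof -
    have u0: "u > 0" using u by simp
    have "u * cmod (h z - 1) \<le> 1 / u ^ (n - 1) * C"
      using LG_err_ge[OF e u0, of h z] region[OF e u h z] by linarith
    also have "\<dots> = u * (C / u ^ n)" using u0 n by (cases n) auto
    finally show ?thesis by (rule mult_left_le_imp_le[OF _ u0])
  qed
  then show ?thesis by blast
qed

section \<open>The expansions\<close>

context pcf_LG
begin

lemma pcf_W_rot:
  assumes "(j, e) \<in> {(0 :: nat, 1 :: real), (3, -1)}"
  shows "pcf_W j (- (1 / 2) * of_real u) (of_real (sqrt (2 * u)) * z) = w z"
    and "deriv (pcf_W j (- (1 / 2) * of_real u)) (of_real (sqrt (2 * u)) * z) = v z"
proof -
  have W: "pcf_W j (- (1 / 2) * of_real u) = (\<lambda>z. parabolic_cylinder_U a (z * LG_rot e))"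
    unfolding pcf_W_eq[OF assms] a_def ..
  show "pcf_W j (- (1 / 2) * of_real u) (of_real (sqrt (2 * u)) * z) = w z"
    unfolding W w_def c_def by (simp add: mult_ac)
  have d: "((\<lambda>z. parabolic_cylinder_U a (z * LG_rot e)) has_field_derivative
      deriv (parabolic_cylinder_U a) (y * LG_rot e) * LG_rot e) (at y)" for y
    by (intro DERIV_chain2[OF holomorphic_derivI[OF U_hol]]) (auto intro!: derivative_eq_intros)
  show "deriv (pcf_W j (- (1 / 2) * of_real u)) (of_real (sqrt (2 * u)) * z) = v z"
    unfolding W DERIV_imp_deriv[OF d] by (simp add: v_def c_def mult_ac)
qed

text \<open>By \<open>LG_chi_eq\<close> the coefficients in the phase are \<open>LG_S\<close> at 1,
  so all coefficient sums merge into the single exponent that \<open>LG_G\<close> inverts; \<theta>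
  stands for \<pi>/8 or 5 \<pi>/8.\<close>

lemma LG_product:
  assumes E: "LG_sequence E"
  shows "exp (- of_real e * \<i> * (LG_chi E m u - of_real \<theta>)) *
      (exp (\<Sum>s = 1..m. (-1) ^ s * E (2 * s) b / of_real u ^ (2 * s)) *
       exp (of_real e * \<i> * of_real u * X - of_real e * \<i> *
         (\<Sum>s = 0..m. (-1) ^ s * E (2 * s + 1) b / of_real u ^ (2 * s + 1)))) =
    exp (- \<i> * of_real e * of_real (u / 4 * ln (2 * exp 1 / u) - \<theta>)) *
    exp (X / x + LG_S E (2 * m + 2) x b - LG_S E (2 * m + 2) x 1)"
proof -
  have X: "X / x = \<i> * of_real e * of_real u * X"
    using x(2) by (metis mult.commute mult.right_neutral times_divide_eq_right)
  have chi: "- of_real e * \<i> * (LG_chi E m u - of_real \<theta>) =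
      - (of_real e * \<i> * LG_chi E m u) + of_real e * \<i> * of_real \<theta>"
    by (simp add: algebra_simps)
  show ?thesis
    unfolding mult_exp_exp chi LG_chi_eq[OF E e u] x_def[symmetric] X
      LG_S_even_odd[OF e u, folded x_def, of E m b]
    by (rule arg_cong[where f = exp]) (simp add: algebra_simps)
qed

lemma powr_quarter: "complex_of_real ((2 * u) powr (1 / 4)) = exp (of_real (ln (2 * u) / 4))"
proof -
  have "(2 * u) powr (1 / 4) = exp (ln (2 * u) / 4)" using u by (simp add: powr_def)
  then show ?thesis by (simp only: exp_of_real)
qed

text \<open>An exact identity: \<open>LG_G\<close> is the reciprocal of the preceding factors, and
  the last factor is what becomes 1 + \<eta>.\<close>

lemma w_expansion:
  assumes z: "z \<in> cut_plane"
  shows "w z = exp (- of_real e * \<i> * (LG_chi E_bar m u - of_real (pi / 8))) * of_real (exp (pi * u / 8)) /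
     (of_real ((2 * u) powr (1 / 4)) * (1 + z\<^sup>2) powr (1 / 4)) *
     exp (\<Sum>s = 1..m. (-1) ^ s * E_bar (2 * s) (beta_bar z) / of_real u ^ (2 * s)) *
     exp (of_real e * \<i> * of_real u * xi_bar z - of_real e * \<i> *
       (\<Sum>s = 0..m. (-1) ^ s * E_bar (2 * s + 1) (beta_bar z) / of_real u ^ (2 * s + 1))) *
     (w z * LG_G E_bar (2 * m + 2) x f_bar z)"
proof -
  define g where "g = (1 + z\<^sup>2) powr (1 / 4)"
  define r where "r = exp (of_real (ln (2 * u) / 4) :: complex)"
  define p where "p = complex_of_real (exp (pi * u / 8))"
  define A where "A = exp (- of_real e * \<i> * (LG_chi E_bar m u - of_real (pi / 8)))"
  define B where "B = exp (\<Sum>s = 1..m. (-1) ^ s * E_bar (2 * s) (beta_bar z) / of_real u ^ (2 * s))"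
  define C where "C = exp (of_real e * \<i> * of_real u * xi_bar z - of_real e * \<i> *
       (\<Sum>s = 0..m. (-1) ^ s * E_bar (2 * s + 1) (beta_bar z) / of_real u ^ (2 * s + 1)))"
  define k where "k = exp (- \<i> * of_real e * of_real (u / 4 * ln (2 * exp 1 / u) - pi / 8))"
  define S where "S = xi_bar z / x + LG_S E_bar (2 * m + 2) x (beta_bar z) - LG_S E_bar (2 * m + 2) x 1"
  have g0: "g \<noteq> 0" using cut_plane_nonzero[OF z] by (simp add: g_def add.commute)
  have ABC: "A * (B * C) = k * exp S"
    unfolding A_def B_def C_def k_def S_def by (rule LG_product[OF LG_sequence_E_bar])
  have K: "exp (- k0) = r / (k * p)"
  proof -
    have "exp (- (a + (b - c))) = exp c / (exp a * exp b)" for a b c :: complex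
      by (simp add: exp_add exp_diff exp_minus field_simps)
    then show ?thesis unfolding k0_def k_def r_def p_def exp_of_real[symmetric] of_real_diff[of "pi * u / 8"] .
  qed
  have G: "LG_G E_bar (2 * m + 2) x f_bar z = r / (k * p) * g * exp (- S)"
    unfolding LG_G_def f_bar_def S_def K g_def by simp
  have P: "A * p / (r * g) * B * C = k * exp S * p / (r * g)"
    unfolding ABC[symmetric] by simp
  have "k \<noteq> 0" "p \<noteq> 0" "r \<noteq> 0" by (simp_all add: k_def p_def r_def)
  then have "A * p / (r * g) * B * C * (w z * LG_G E_bar (2 * m + 2) x f_bar z) = w z"
    unfolding G P using g0 by (simp add: exp_minus field_simps)
  then show ?thesis
    unfolding powr_quarter g_def[symmetric] r_def[symmetric] p_def[symmetric] A_def[symmetric]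
      B_def[symmetric] C_def[symmetric] by simp
qed

lemma v_expansion:
  assumes z: "z \<in> cut_plane"
  shows "v z = 1 / 2 * exp (- of_real e * \<i> * (LG_chi E_tilde m u - of_real (5 / 8 * pi))) *
     of_real ((2 * u) powr (1 / 4)) * of_real (exp (pi * u / 8)) * (1 + z\<^sup>2) powr (1 / 4) *
     exp (\<Sum>s = 1..m. (-1) ^ s * E_tilde (2 * s) (beta_bar z) / of_real u ^ (2 * s)) *
     exp (of_real e * \<i> * of_real u * xi_bar z - of_real e * \<i> *
       (\<Sum>s = 0..m. (-1) ^ s * E_tilde (2 * s + 1) (beta_bar z) / of_real u ^ (2 * s + 1))) *
     (v z * LG_G E_tilde (2 * m + 2) x f_tilde z)"
proof -
  define g where "g = (1 + z\<^sup>2) powr (1 / 4)"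
  define r where "r = exp (of_real (ln (2 * u) / 4) :: complex)"
  define p where "p = complex_of_real (exp (pi * u / 8))"
  define A where "A = exp (- of_real e * \<i> * (LG_chi E_tilde m u - of_real (5 / 8 * pi)))"
  define B where "B = exp (\<Sum>s = 1..m. (-1) ^ s * E_tilde (2 * s) (beta_bar z) / of_real u ^ (2 * s))"
  define C where "C = exp (of_real e * \<i> * of_real u * xi_bar z - of_real e * \<i> *
       (\<Sum>s = 0..m. (-1) ^ s * E_tilde (2 * s + 1) (beta_bar z) / of_real u ^ (2 * s + 1)))"
  define k where "k = exp (- \<i> * of_real e * of_real (u / 4 * ln (2 * exp 1 / u) - 5 / 8 * pi))"
  define S where "S = xi_bar z / x + LG_S E_tilde (2 * m + 2) x (beta_bar z) - LG_S E_tilde (2 * m + 2) x 1"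
  have g0: "g \<noteq> 0" using cut_plane_nonzero[OF z] by (simp add: g_def add.commute)
  have ABC: "A * (B * C) = k * exp S"
    unfolding A_def B_def C_def k_def S_def by (rule LG_product[OF LG_sequence_E_tilde])
  have two: "exp (complex_of_real (ln 2)) = 2" by (subst exp_of_real) simp
  have K: "exp (- k1) = 2 / (k * p * r)"
  proof -
    have "exp (- (a + (b + c - d))) = exp d / (exp a * exp b * exp c)" for a b c d :: complex
      by (simp add: exp_add exp_diff exp_minus field_simps)
    then show ?thesis
      unfolding k1_def k_def r_def p_def exp_of_real[symmetric] of_real_diff[of _ "ln 2"] of_real_add two[symmetric] .
  qed
  have G: "LG_G E_tilde (2 * m + 2) x f_tilde z = 2 / (k * p * r) * inverse g * exp (- S)"
    unfolding LG_G_def f_tilde_def S_def K g_def by simp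
  have P: "1 / 2 * A * r * p * g * B * C = 1 / 2 * (k * exp S) * r * p * g"
    unfolding ABC[symmetric] by (simp add: mult_ac)
  have "k \<noteq> 0" "p \<noteq> 0" "r \<noteq> 0" by (simp_all add: k_def p_def r_def)
  then have "1 / 2 * A * r * p * g * B * C * (v z * LG_G E_tilde (2 * m + 2) x f_tilde z) = v z"
    unfolding G P using g0 by (simp add: exp_minus field_simps)
  then show ?thesis
    unfolding powr_quarter g_def[symmetric] r_def[symmetric] p_def[symmetric] A_def[symmetric]
      B_def[symmetric] C_def[symmetric] by simp
qed

end

theorem mainTheorem12:
  fixes m :: nat
  shows "\<exists>\<eta>_bar \<eta>_tilde :: nat \<Rightarrow> real \<Rightarrow> complex \<Rightarrow> complex.
    \<forall>(j, e) \<in> {(0 :: nat, 1 :: real), (3, -1)}.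
      (\<forall>u>0. \<forall>z\<in>cut_plane.
         pcf_W j (- (1 / 2) * of_real u) (of_real (sqrt (2 * u)) * z) =
           exp (- of_real e * \<i> * (LG_chi E_bar m u - of_real (pi / 8))) * of_real (exp (pi * u / 8)) /
           (of_real ((2 * u) powr (1 / 4)) * (1 + z\<^sup>2) powr (1 / 4)) *
           exp (\<Sum>s = 1..m. (-1) ^ s * E_bar (2 * s) (beta_bar z) / of_real u ^ (2 * s)) *
           exp (of_real e * \<i> * of_real u * xi_bar z - of_real e * \<i> *
             (\<Sum>s = 0..m. (-1) ^ s * E_bar (2 * s + 1) (beta_bar z) / of_real u ^ (2 * s + 1))) *
           (1 + \<eta>_bar j u z)
       \<and> deriv (pcf_W j (- (1 / 2) * of_real u)) (of_real (sqrt (2 * u)) * z) =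
           1 / 2 * exp (- of_real e * \<i> * (LG_chi E_tilde m u - of_real (5 / 8 * pi))) *
           of_real ((2 * u) powr (1 / 4)) * of_real (exp (pi * u / 8)) * (1 + z\<^sup>2) powr (1 / 4) *
           exp (\<Sum>s = 1..m. (-1) ^ s * E_tilde (2 * s) (beta_bar z) / of_real u ^ (2 * s)) *
           exp (of_real e * \<i> * of_real u * xi_bar z - of_real e * \<i> *
             (\<Sum>s = 0..m. (-1) ^ s * E_tilde (2 * s + 1) (beta_bar z) / of_real u ^ (2 * s + 1))) *
           (1 + \<eta>_tilde j u z))
    \<and> (\<forall>\<delta>>0. \<exists>C. \<forall>\<^sub>F u in at_top. \<forall>z\<in>LG_region e \<delta>.
         cmod (\<eta>_bar j u z) \<le> C / u ^ (2 * m + 2) \<and>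
         cmod (\<eta>_tilde j u z) \<le> C / u ^ (2 * m + 2))
    \<and> (\<forall>u>0. \<forall>z\<in>cut_plane. \<forall>\<gamma>. LG_path (e * pi / 4) z \<gamma> \<longrightarrow>
         LG_error_bound E_bar (2 * m + 2) u \<gamma> (\<eta>_bar j u z) \<and>
         LG_error_bound E_tilde (2 * m + 2) u \<gamma> (\<eta>_tilde j u z))"
proof -
  define n where "n = 2 * m + 2"
  have n: "n \<ge> 2" "n \<ge> 1" by (simp_all add: n_def)
  \<comment> \<open>The error functions are indexed by j alone, so the sign e has to be recovered
    from j.\<close>
  define sg :: "nat \<Rightarrow> real" where "sg j = (if j = 0 then 1 else - 1)" for j
  define hb where "hb j u z = pcf_LG.w (sg j) u z * LG_G E_bar n (pcf_LG.x (sg j) u) (pcf_LG.f_bar (sg j) u) z" for j u z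
  define ht where "ht j u z = pcf_LG.v (sg j) u z * LG_G E_tilde n (pcf_LG.x (sg j) u) (pcf_LG.f_tilde (sg j) u) z" for j u z
  have main: "(\<forall>u>0. \<forall>z\<in>cut_plane.
         pcf_W j (- (1 / 2) * of_real u) (of_real (sqrt (2 * u)) * z) =
           exp (- of_real e * \<i> * (LG_chi E_bar m u - of_real (pi / 8))) * of_real (exp (pi * u / 8)) /
           (of_real ((2 * u) powr (1 / 4)) * (1 + z\<^sup>2) powr (1 / 4)) *
           exp (\<Sum>s = 1..m. (-1) ^ s * E_bar (2 * s) (beta_bar z) / of_real u ^ (2 * s)) *
           exp (of_real e * \<i> * of_real u * xi_bar z - of_real e * \<i> *
             (\<Sum>s = 0..m. (-1) ^ s * E_bar (2 * s + 1) (beta_bar z) / of_real u ^ (2 * s + 1))) *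
           (1 + (hb j u z - 1))
       \<and> deriv (pcf_W j (- (1 / 2) * of_real u)) (of_real (sqrt (2 * u)) * z) =
           1 / 2 * exp (- of_real e * \<i> * (LG_chi E_tilde m u - of_real (5 / 8 * pi))) *
           of_real ((2 * u) powr (1 / 4)) * of_real (exp (pi * u / 8)) * (1 + z\<^sup>2) powr (1 / 4) *
           exp (\<Sum>s = 1..m. (-1) ^ s * E_tilde (2 * s) (beta_bar z) / of_real u ^ (2 * s)) *
           exp (of_real e * \<i> * of_real u * xi_bar z - of_real e * \<i> *
             (\<Sum>s = 0..m. (-1) ^ s * E_tilde (2 * s + 1) (beta_bar z) / of_real u ^ (2 * s + 1))) *
           (1 + (ht j u z - 1)))
    \<and> (\<forall>\<delta>>0. \<exists>C. \<forall>\<^sub>F u in at_top. \<forall>z\<in>LG_region e \<delta>.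
         cmod (hb j u z - 1) \<le> C / u ^ (2 * m + 2) \<and>
         cmod (ht j u z - 1) \<le> C / u ^ (2 * m + 2))
    \<and> (\<forall>u>0. \<forall>z\<in>cut_plane. \<forall>\<gamma>. LG_path (e * pi / 4) z \<gamma> \<longrightarrow>
         LG_error_bound E_bar (2 * m + 2) u \<gamma> (hb j u z - 1) \<and>
         LG_error_bound E_tilde (2 * m + 2) u \<gamma> (ht j u z - 1))"
    if je: "(j, e) \<in> {(0 :: nat, 1 :: real), (3, -1)}" for j e
  proof -
    have sg_e: "sg j = e" "e \<in> {1, -1}" using je by (auto simp: sg_def)
    have loc: "pcf_LG e u" if "u > 0" for u using sg_e(2) that by unfold_locales
    have sol: "LG_solution E_bar n e u (hb j u)" "LG_solution E_tilde n e u (ht j u)" if "u > 0" for u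
      using pcf_LG.LG_solution_bar[OF loc[OF that] n(1)] pcf_LG.LG_solution_tilde[OF loc[OF that] n(1)]
      unfolding hb_def ht_def sg_e(1) by auto
    have 2: "\<exists>C. \<forall>\<^sub>F u in at_top. \<forall>z\<in>LG_region e \<delta>.
         cmod (hb j u z - 1) \<le> C / u ^ (2 * m + 2) \<and> cmod (ht j u z - 1) \<le> C / u ^ (2 * m + 2)"
      if \<delta>: "\<delta> > 0" for \<delta>
    proof -
      \<comment> \<open>The uniform estimate assumes \<delta> <= 1; a larger \<delta> only shrinks
        the region.\<close>
      have sub: "LG_region e \<delta> \<subseteq> LG_region e (min \<delta> 1)" by (auto simp: LG_region_def)
      have "0 < min \<delta> 1" "min \<delta> 1 \<le> 1" using \<delta> by auto
      from LG_region_estimate[OF LG_sequence_E_bar n(2) this]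
      obtain Cb where "\<forall>e\<in>{1, -1}. \<forall>u\<ge>1. \<forall>h. LG_solution E_bar n e u h \<longrightarrow>
          (\<forall>z\<in>LG_region e (min \<delta> 1). cmod (h z - 1) \<le> Cb / u ^ n)" by blast
      then have Cb: "cmod (h z - 1) \<le> Cb / u ^ n"
        if "u \<ge> 1" "LG_solution E_bar n e u h" "z \<in> LG_region e (min \<delta> 1)" for u h z
        using that sg_e(2) by blast
      have "0 < min \<delta> 1" "min \<delta> 1 \<le> 1" using \<delta> by auto
      from LG_region_estimate[OF LG_sequence_E_tilde n(2) this]
      obtain Ct where "\<forall>e\<in>{1, -1}. \<forall>u\<ge>1. \<forall>h. LG_solution E_tilde n e u h \<longrightarrow>
          (\<forall>z\<in>LG_region e (min \<delta> 1). cmod (h z - 1) \<le> Ct / u ^ n)" by blast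
      then have Ct: "cmod (h z - 1) \<le> Ct / u ^ n"
        if "u \<ge> 1" "LG_solution E_tilde n e u h" "z \<in> LG_region e (min \<delta> 1)" for u h z
        using that sg_e(2) by blast
      have "\<forall>z\<in>LG_region e \<delta>. cmod (hb j u z - 1) \<le> max Cb Ct / u ^ (2 * m + 2) \<and>
          cmod (ht j u z - 1) \<le> max Cb Ct / u ^ (2 * m + 2)" if u: "u \<ge> 1" for u
      proof
        fix z assume "z \<in> LG_region e \<delta>"
        then have z: "z \<in> LG_region e (min \<delta> 1)" using sub by blast
        have "Cb / u ^ n \<le> max Cb Ct / u ^ n" "Ct / u ^ n \<le> max Cb Ct / u ^ n"
          using u by (auto intro!: divide_right_mono)
        with Cb[OF u sol(1) z] Ct[OF u sol(2) z] u
        show "cmod (hb j u z - 1) \<le> max Cb Ct / u ^ (2 * m + 2) \<and>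
          cmod (ht j u z - 1) \<le> max Cb Ct / u ^ (2 * m + 2)"
          unfolding n_def[symmetric] by linarith
      qed
      then show ?thesis
        by (intro exI[of _ "max Cb Ct"] eventually_mono[OF eventually_ge_at_top[of 1]])
    qed
    have 3: "LG_error_bound E_bar (2 * m + 2) u \<gamma> (hb j u z - 1) \<and> LG_error_bound E_tilde (2 * m + 2) u \<gamma> (ht j u z - 1)"
      if "u > 0" "LG_path (e * pi / 4) z \<gamma>" for u z \<gamma>
      unfolding LG_error_bound_def n_def[symmetric]
    proof (intro conjI impI; elim conjE)
      assume fin: "LG_varpi E_bar n u \<gamma> < \<infinity>" "LG_omega E_bar n u \<gamma> < \<infinity>"
      show "cmod (hb j u z - 1) \<le> enn2real (LG_omega E_bar n u \<gamma>) / u ^ n *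
          exp (enn2real (LG_varpi E_bar n u \<gamma>) / u + enn2real (LG_omega E_bar n u \<gamma>) / u ^ n)"
        by (rule LG_path_estimate[OF sg_e(2) that(1) LG_sequence_E_bar n(1) sol(1)[OF that(1)] that(2) fin])
    next
      assume fin: "LG_varpi E_tilde n u \<gamma> < \<infinity>" "LG_omega E_tilde n u \<gamma> < \<infinity>"
      show "cmod (ht j u z - 1) \<le> enn2real (LG_omega E_tilde n u \<gamma>) / u ^ n *
          exp (enn2real (LG_varpi E_tilde n u \<gamma>) / u + enn2real (LG_omega E_tilde n u \<gamma>) / u ^ n)"
        by (rule LG_path_estimate[OF sg_e(2) that(1) LG_sequence_E_tilde n(1) sol(2)[OF that(1)] that(2) fin])
    qed
    have one: "1 + (y - 1) = y" for y :: complex by simp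
    show ?thesis
    proof (intro conjI allI impI ballI)
      fix u :: real and z assume uz: "u > 0" "z \<in> cut_plane"
      interpret pcf_LG e u by (rule loc[OF uz(1)])
      show "pcf_W j (- (1 / 2) * of_real u) (of_real (sqrt (2 * u)) * z) =
           exp (- of_real e * \<i> * (LG_chi E_bar m u - of_real (pi / 8))) * of_real (exp (pi * u / 8)) /
           (of_real ((2 * u) powr (1 / 4)) * (1 + z\<^sup>2) powr (1 / 4)) *
           exp (\<Sum>s = 1..m. (-1) ^ s * E_bar (2 * s) (beta_bar z) / of_real u ^ (2 * s)) *
           exp (of_real e * \<i> * of_real u * xi_bar z - of_real e * \<i> *
             (\<Sum>s = 0..m. (-1) ^ s * E_bar (2 * s + 1) (beta_bar z) / of_real u ^ (2 * s + 1))) *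
           (1 + (hb j u z - 1))"
        unfolding pcf_W_rot(1)[OF je] one hb_def sg_e(1) n_def by (rule w_expansion[OF uz(2)])
      show "deriv (pcf_W j (- (1 / 2) * of_real u)) (of_real (sqrt (2 * u)) * z) =
           1 / 2 * exp (- of_real e * \<i> * (LG_chi E_tilde m u - of_real (5 / 8 * pi))) *
           of_real ((2 * u) powr (1 / 4)) * of_real (exp (pi * u / 8)) * (1 + z\<^sup>2) powr (1 / 4) *
           exp (\<Sum>s = 1..m. (-1) ^ s * E_tilde (2 * s) (beta_bar z) / of_real u ^ (2 * s)) *
           exp (of_real e * \<i> * of_real u * xi_bar z - of_real e * \<i> *
             (\<Sum>s = 0..m. (-1) ^ s * E_tilde (2 * s + 1) (beta_bar z) / of_real u ^ (2 * s + 1))) *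
           (1 + (ht j u z - 1))"
        unfolding pcf_W_rot(2)[OF je] one ht_def sg_e(1) n_def by (rule v_expansion[OF uz(2)])
    qed (erule 2, erule (1) 3[THEN conjunct1], erule (1) 3[THEN conjunct2])
  qed
  show ?thesis
    by (rule exI[of _ "\<lambda>j u z. hb j u z - 1"], rule exI[of _ "\<lambda>j u z. ht j u z - 1"],
        rule ballI, rule case_prodI2, rule main, hypsubst, assumption)
qed

end
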